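(* Let $\mathbb{F}$ be an algebraically closed field of prime characteristic $p>2$, and let $L$ be the root lattice of type $A_n$ with $n+1\equiv 0\pmod p$. Then the subspace $\operatorname{Rad}(\cdot,\cdot)_{V_{L,\mathbb F}}$ is a nontrivial ideal of the vertex algebra $V_{L,\mathbb F}$ (nontrivial meaning nonzero and different from $V_{L,\mathbb F}$).
   Context: **Vertex algebras.** A vertex algebra over a field is a vector space $V$ with a vector $\mathbf 1$ and a linear map $Y(\cdot,x):V\to(\operatorname{End}V)[[x,x^{-1}]]$, $Y(v,x)=\sum_{m\in\mathbb Z}v_mx^{-m-1}$, such that for $u,v\in V$: $u_mv=0$ for $m$ sufficiently large; $Y(\mathbf 1,x)=\mathrm{id}$; $Y(v,x)\mathbf 1\in V[[x]]$ with constant term $v$; and the Jacobi identity $x_0^{-1}\delta\left(\frac{x_1-x_2}{x_0}\right)Y(u,x_1)Y(v,x_2)-x_0^{-1}\delta\left(\frac{x_2-x_1}{-x_0}\right)Y(v,x_2)Y(u,x_1)=x_2^{-1}\delta\left(\frac{x_1-x_0}{x_2}\right)Y(Y(u,x_0)v,x_2)$ holds. An ideal is a subspace $I$ with $u_mw,\,w_mu\in I$ for all $u\in V$, $w\in I$, $m\in\mathbb Z$. **Lattice vertex algebra.** $L=\bigoplus_{i=1}^n\mathbb Z\alpha_i$, $\Pi=\{\alpha_1,\dots,\alpha_n\}$, with $\langle\alpha_i,\alpha_i\rangle=2$, $\langle\alpha_i,\alpha_{i\pm1}\rangle=-1$, and $\langle\alpha_i,\alpha_j\rangle=0$ otherwise.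 Fix a bimultiplicative $\epsilon:L\times L\to\{\pm1\}$ with $\epsilon(\alpha,\beta)\epsilon(\beta,\alpha)=(-1)^{\langle\alpha,\beta\rangle}$. Let $\mathfrak h_{\mathbb C}=\mathbb C\otimes_{\mathbb Z}L$. Over $\mathbb C$, $V_L=S(t^{-1}\mathfrak h_{\mathbb C}[t^{-1}])\otimes\mathbb C\{L\}$, where $\mathbb C\{L\}$ has basis $\{\iota(e_\alpha)\mid\alpha\in L\}$ and $\mathbf 1=1\otimes\iota(e_0)$. For $h\in\mathfrak h_{\mathbb C}$, $m>0$: $h(-m)$ is multiplication by $h\otimes t^{-m}$; $h(m)$ acts as the derivation of $S(t^{-1}\mathfrak h_{\mathbb C}[t^{-1}])$ with $h(m)\cdot h'(-k)=m\langle h,h'\rangle\delta_{m,k}$; $h(0)\iota(e_\alpha)=\langle h,\alpha\rangle\iota(e_\alpha)$. Also $e_\alpha\iota(e_\beta)=\epsilon(\alpha,\beta)\iota(e_{\alpha+\beta})$, $x^\alpha\iota(e_\beta)=x^{\langle\alpha,\beta\rangle}\iota(e_\beta)$. The vertex algebra structure is determined by $Y(h(-1)\mathbf 1,x)=\sum_mh(m)x^{-m-1}$ and $Y(\iota(e_\alpha),x)=E^-(-\alpha,x)E^+(-\alpha,x)e_\alpha x^\alpha$, where $E^-(-\alpha,x)=\exp\left(\sum_{m\ge1}\frac{\alpha(-m)}{m}x^m\right)=\sum_{m\ge0}s_{\alpha,m}x^m$ and $E^+(-\alpha,x)=\exp\left(\sum_{m\ge1}\frac{-\alpha(m)}{m}x^{-m}\right)=\sum_{m\ge0}r_{\alpha,m}x^{-m}$.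 The $\mathbb Z$-span $V_{L,\mathbb Z}$ of the elements $s_{\alpha^1,m_1}\cdots s_{\alpha^k,m_k}\iota(e_\alpha)$ ($k\ge0$, $\alpha^i\in\Pi$, $m_i\ge1$, $\alpha\in L$) is an integral form of $V_L$ with these elements as a $\mathbb Z$-basis, preserved by all $s_{\alpha,m},r_{\alpha,m}$; $V_{L,\mathbb F}:=V_{L,\mathbb Z}\otimes_{\mathbb Z}\mathbb F$ is a vertex algebra. **Radical.** $(\cdot,\cdot)_{V_{L,\mathbb F}}$ is the symmetric bilinear form on $V_{L,\mathbb F}$ determined by $(\iota(e_\alpha),\iota(e_\beta))=\delta_{\alpha,-\beta}$ and $(s_{\alpha,m}u,v)=(u,r_{\alpha,m}v)$ for $\alpha,\beta\in L$, $m\ge0$, $u,v\in V_{L,\mathbb F}$. $\operatorname{Rad}(\cdot,\cdot)_{V_{L,\mathbb F}}=\{v\in V_{L,\mathbb F}\mid(v,u)=0\text{ for all }u\in V_{L,\mathbb F}\}$. *)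

theory Defs
  imports
    "HOL-Number_Theory.Number_Theory"
    "HOL-Computational_Algebra.Computational_Algebra"
    "HOL-Library.Poly_Mapping"
    "HOL-Library.Multiset"
    "HOL-Library.Cardinality"
    Complex_Main
begin

section \<open>Vertex algebras\<close>

text \<open>
  This is \<^const>\<open>gbinomial\<close> on integers, where the library restricts the input of that constant
  to fields; the division is exact.
\<close>

definition int_binomial :: "int \<Rightarrow> nat \<Rightarrow> int" where
  "int_binomial a k = (\<Prod>i = 0..<k. a - int i) div fact k"

text \<open>
  \<open>Y u m v\<close> is the mode $u_m v$ in $Y(u,x) = \sum_m u_m x^{-m-1}$.

  The axiom \<open>jacobi\<close> is the equality of the coefficients of
  $x_0^{-r-1} x_1^{-p-1} x_2^{-q-1}$ on the two sides of the Jacobi identity, applied to $w$, where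
  $x_0^{-1}\delta((x_1-x_2)/x_0) = \sum_n x_0^{-n-1} (x_1-x_2)^n$ and $(x_1-x_2)^n$ is expanded in
  nonnegative powers of $x_2$, and similarly for the other two terms.  On the right-hand side this
  expansion gives the factor $(-1)^i \binom{i-p-1}{i} = \binom{p}{i}$.

  \<^const>\<open>Sum_any\<close> is the sum over the support; all supports are finite by \<open>truncation\<close>.
\<close>

locale vertex_algebra = vector_space scale
  for scale :: "'f::field \<Rightarrow> 'v::ab_group_add \<Rightarrow> 'v" +
  fixes vac :: 'v
    and Y :: "'v \<Rightarrow> int \<Rightarrow> 'v \<Rightarrow> 'v"
  assumes add_left: "Y (u + u') m v = Y u m v + Y u' m v"
    and scale_left: "Y (scale c u) m v = scale c (Y u m v)"
    and add_right: "Y u m (v + v') = Y u m v + Y u m v'"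
    and scale_right: "Y u m (scale c v) = scale c (Y u m v)"
    and truncation: "\<exists>N. \<forall>m\<ge>N. Y u m v = 0"
    and vacuum: "Y vac m v = (if m = -1 then v else 0)"
    and creation_regular: "m \<ge> 0 \<Longrightarrow> Y v m vac = 0"
    and creation_constant: "Y v (-1) vac = v"
    and jacobi: "\<And>(p::int) (q::int) (r::int) u v w.
       Sum_any (\<lambda>i::nat. scale ((-1) ^ i * of_int (int_binomial r i))
          (Y u (p + r - int i) (Y v (q + int i) w)))
       - Sum_any (\<lambda>i::nat. scale ((if even r then 1 else -1) * (-1) ^ i * of_int (int_binomial r i))
          (Y v (q + r - int i) (Y u (p + int i) w)))
       = Sum_any (\<lambda>i::nat. scale (of_int (int_binomial p i))
          (Y (Y u (r + int i) v) (p + q - int i) w))"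

definition va_ideal ::
  "('f::field \<Rightarrow> 'v::ab_group_add \<Rightarrow> 'v) \<Rightarrow> 'v \<Rightarrow> ('v \<Rightarrow> int \<Rightarrow> 'v \<Rightarrow> 'v) \<Rightarrow> 'v set \<Rightarrow> bool" where
  "va_ideal scale vac Y I \<longleftrightarrow>
     vertex_algebra scale vac Y \<and> module.subspace scale I \<and>
     (\<forall>u. \<forall>w\<in>I. \<forall>m. Y u m w \<in> I \<and> Y w m u \<in> I)"


section \<open>The root lattice of type A\<close>

text \<open>
  The simple roots are indexed by a finite linearly ordered type \<open>'n\<close>; \<open>pos\<close> is the order
  isomorphism from \<open>'n\<close> to $\{1,\dots,n\}$, where $n$ is the cardinality of \<open>'n\<close>.
\<close>

definition pos :: "'n::{finite,linorder} \<Rightarrow> nat" where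
  "pos i = card {j. j \<le> i}"

definition cartan :: "'n::{finite,linorder} \<Rightarrow> 'n \<Rightarrow> int" where
  "cartan i j = (if i = j then 2 else if pos j = pos i + 1 \<or> pos i = pos j + 1 then -1 else 0)"

type_synonym 'n lat = "'n \<Rightarrow>\<^sub>0 int"

definition simple_root :: "'n \<Rightarrow> 'n lat" where
  "simple_root i = Poly_Mapping.single i 1"

definition lat_form :: "('n::{finite,linorder}) lat \<Rightarrow> 'n lat \<Rightarrow> int" where
  "lat_form \<alpha> \<beta> = (\<Sum>i\<in>UNIV. \<Sum>j\<in>UNIV.
     Poly_Mapping.lookup \<alpha> i * Poly_Mapping.lookup \<beta> j * cartan i j)"

text \<open>An element of $\mathfrak h_{\mathbb C}$ is given by its coordinates in the simple roots.\<close>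

definition h_form :: "('n::{finite,linorder} \<Rightarrow> complex) \<Rightarrow> ('n \<Rightarrow> complex) \<Rightarrow> complex" where
  "h_form h h' = (\<Sum>i\<in>UNIV. \<Sum>j\<in>UNIV. h i * h' j * of_int (cartan i j))"

definition h_of_lat :: "'n lat \<Rightarrow> 'n \<Rightarrow> complex" where
  "h_of_lat \<alpha> = (\<lambda>i. of_int (Poly_Mapping.lookup \<alpha> i))"

definition lat_cocycle :: "(('n::{finite,linorder}) lat \<Rightarrow> 'n lat \<Rightarrow> int) \<Rightarrow> bool" where
  "lat_cocycle \<epsilon> \<longleftrightarrow>
     (\<forall>\<alpha> \<beta>. \<epsilon> \<alpha> \<beta> \<in> {1, -1}) \<and>
     (\<forall>\<alpha> \<alpha>' \<beta>. \<epsilon> (\<alpha> + \<alpha>') \<beta> = \<epsilon> \<alpha> \<beta> * \<epsilon> \<alpha>' \<beta>) \<and>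
     (\<forall>\<alpha> \<beta> \<beta>'. \<epsilon> \<alpha> (\<beta> + \<beta>') = \<epsilon> \<alpha> \<beta> * \<epsilon> \<alpha> \<beta>') \<and>
     (\<forall>\<alpha> \<beta>. \<epsilon> \<alpha> \<beta> * \<epsilon> \<beta> \<alpha> = (if even (lat_form \<alpha> \<beta>) then 1 else -1))"


section \<open>The lattice vertex algebra over the complex numbers\<close>

definition smul :: "'k::semiring_0 \<Rightarrow> ('b \<Rightarrow>\<^sub>0 'k) \<Rightarrow> ('b \<Rightarrow>\<^sub>0 'k)" where
  "smul c v = Poly_Mapping.map ((*) c) v"

definition lin_ext :: "('b \<Rightarrow> ('c \<Rightarrow>\<^sub>0 'k)) \<Rightarrow> ('b \<Rightarrow>\<^sub>0 'k::semiring_0) \<Rightarrow> ('c \<Rightarrow>\<^sub>0 'k)" where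
  "lin_ext f v = (\<Sum>b\<in>Poly_Mapping.keys v. smul (Poly_Mapping.lookup v b) (f b))"

text \<open>
  The index \<open>(M, \<alpha>)\<close> stands for the product of all $\alpha_i \otimes t^{-k-1}$ with $(i,k) \in M$,
  tensored with $\iota(e_\alpha)$.  Note the shift: \<open>k = 0\<close> stands for $t^{-1}$.
\<close>

type_synonym 'n fock_index = "('n \<times> nat) multiset \<times> 'n lat"

type_synonym ('n, 'k) fock = "'n fock_index \<Rightarrow>\<^sub>0 'k"

definition iota_e :: "'n lat \<Rightarrow> ('n, 'k::zero_neq_one) fock" where
  "iota_e \<alpha> = Poly_Mapping.single ({#}, \<alpha>) 1"

definition heis_create ::
  "('n::{finite,linorder} \<Rightarrow> complex) \<Rightarrow> nat \<Rightarrow> ('n, complex) fock \<Rightarrow> ('n, complex) fock" where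
  "heis_create h m = lin_ext (\<lambda>(M, \<alpha>).
     \<Sum>i\<in>UNIV. Poly_Mapping.single (add_mset (i, m - 1) M, \<alpha>) (h i))"

text \<open>On monomials, the derivation with $h(m) \cdot h'(-k) = m \langle h,h'\rangle \delta_{m,k}$.\<close>

definition heis_annihilate ::
  "('n::{finite,linorder} \<Rightarrow> complex) \<Rightarrow> nat \<Rightarrow> ('n, complex) fock \<Rightarrow> ('n, complex) fock" where
  "heis_annihilate h m = lin_ext (\<lambda>(M, \<alpha>).
     \<Sum>j\<in>UNIV. Poly_Mapping.single (M - {#(j, m - 1)#}, \<alpha>)
       (of_nat (count M (j, m - 1)) * of_nat m * h_form h (h_of_lat (simple_root j))))"

definition heis_zero ::
  "('n::{finite,linorder} \<Rightarrow> complex) \<Rightarrow> ('n, complex) fock \<Rightarrow> ('n, complex) fock" where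
  "heis_zero h = lin_ext (\<lambda>(M, \<alpha>).
     Poly_Mapping.single (M, \<alpha>) (h_form h (h_of_lat \<alpha>)))"

definition heis ::
  "('n::{finite,linorder} \<Rightarrow> complex) \<Rightarrow> int \<Rightarrow> ('n, complex) fock \<Rightarrow> ('n, complex) fock" where
  "heis h m = (if m < 0 then heis_create h (nat (-m))
               else if m = 0 then heis_zero h
               else heis_annihilate h (nat m))"

text \<open>
  For operators $T_1, T_2, \dots$, \<open>series_power T k m\<close> is the coefficient of $x^m$ in
  $\left(\sum_{j\ge1} T_j x^j\right)^k$ and \<open>series_exp T m\<close> that of $x^m$ in
  $\exp\left(\sum_{j\ge1} T_j x^j\right)$; only the powers $k \le m$ contribute.
\<close>

primrec series_power ::
  "(nat \<Rightarrow> ('b \<Rightarrow>\<^sub>0 complex) \<Rightarrow> ('b \<Rightarrow>\<^sub>0 complex)) \<Rightarrow> nat \<Rightarrow> nat \<Rightarrow>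
   ('b \<Rightarrow>\<^sub>0 complex) \<Rightarrow> ('b \<Rightarrow>\<^sub>0 complex)" where
  "series_power T 0 = (\<lambda>m v. if m = 0 then v else 0)"
| "series_power T (Suc k) = (\<lambda>m v. \<Sum>j = 1..m. T j (series_power T k (m - j) v))"

definition series_exp ::
  "(nat \<Rightarrow> ('b \<Rightarrow>\<^sub>0 complex) \<Rightarrow> ('b \<Rightarrow>\<^sub>0 complex)) \<Rightarrow> nat \<Rightarrow>
   ('b \<Rightarrow>\<^sub>0 complex) \<Rightarrow> ('b \<Rightarrow>\<^sub>0 complex)" where
  "series_exp T m v = (\<Sum>k\<le>m. smul (1 / fact k) (series_power T k m v))"

text \<open>The coefficients of $E^-(-\alpha,x)$ and $E^+(-\alpha,x)$.\<close>

definition s_op ::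
  "('n::{finite,linorder}) lat \<Rightarrow> nat \<Rightarrow> ('n, complex) fock \<Rightarrow> ('n, complex) fock" where
  "s_op \<alpha> = series_exp (\<lambda>m v. smul (1 / of_nat m) (heis (h_of_lat \<alpha>) (- int m) v))"

definition r_op ::
  "('n::{finite,linorder}) lat \<Rightarrow> nat \<Rightarrow> ('n, complex) fock \<Rightarrow> ('n, complex) fock" where
  "r_op \<alpha> = series_exp (\<lambda>m v. smul (- 1 / of_nat m) (heis (h_of_lat \<alpha>) (int m) v))"

definition e_op ::
  "(('n::{finite,linorder}) lat \<Rightarrow> 'n lat \<Rightarrow> int) \<Rightarrow> 'n lat \<Rightarrow>
   ('n, complex) fock \<Rightarrow> ('n, complex) fock" where
  "e_op \<epsilon> \<alpha> = lin_ext (\<lambda>(M, \<beta>). Poly_Mapping.single (M, \<alpha> + \<beta>) (of_int (\<epsilon> \<alpha> \<beta>)))"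

text \<open>
  The coefficient of $x^{-m-1}$ in $E^-(-\alpha,x) E^+(-\alpha,x) e_\alpha x^\alpha$.  On the index
  \<open>(M, \<beta>)\<close> the term $s_{\alpha,i} r_{\alpha,j} e_\alpha$ carries the power
  $x^{i-j+\langle\alpha,\beta\rangle}$, and \<^term>\<open>r_op \<alpha> j\<close> vanishes there for large \<open>j\<close>.
\<close>

definition lattice_vertex_op ::
  "(('n::{finite,linorder}) lat \<Rightarrow> 'n lat \<Rightarrow> int) \<Rightarrow> 'n lat \<Rightarrow> int \<Rightarrow>
   ('n, complex) fock \<Rightarrow> ('n, complex) fock" where
  "lattice_vertex_op \<epsilon> \<alpha> m = lin_ext (\<lambda>(M, \<beta>).
     Sum_any (\<lambda>j. let i = int j - lat_form \<alpha> \<beta> - m - 1 in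
       if i \<ge> 0
       then s_op \<alpha> (nat i) (r_op \<alpha> j (e_op \<epsilon> \<alpha> (Poly_Mapping.single (M, \<beta>) 1)))
       else 0))"

text \<open>
  The vertex algebra structure on $V_L$, determined by the fields of generators: for every
  \<open>\<epsilon>\<close> satisfying \<^const>\<open>lat_cocycle\<close> there is exactly one such \<open>Y\<close>.
\<close>

definition lattice_vertex_algebra ::
  "(('n::{finite,linorder}) lat \<Rightarrow> 'n lat \<Rightarrow> int) \<Rightarrow>
   (('n, complex) fock \<Rightarrow> int \<Rightarrow> ('n, complex) fock \<Rightarrow> ('n, complex) fock) \<Rightarrow> bool" where
  "lattice_vertex_algebra \<epsilon> Y \<longleftrightarrow>
     vertex_algebra smul (iota_e 0) Y \<and>
     (\<forall>h m. Y (heis h (-1) (iota_e 0)) m = heis h m) \<and>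
     (\<forall>\<alpha> m. Y (iota_e \<alpha>) m = lattice_vertex_op \<epsilon> \<alpha> m)"


section \<open>The integral form and base change\<close>

text \<open>
  \<open>int_basis (M, \<alpha>)\<close> is the product of all $s_{\alpha_i,k+1}$ with $(i,k) \in M$, applied to
  $\iota(e_\alpha)$; these operators commute.
\<close>

definition int_basis :: "('n::{finite,linorder}) fock_index \<Rightarrow> ('n, complex) fock" where
  "int_basis = (\<lambda>(M, \<alpha>).
     fold_mset (\<lambda>(i, k). s_op (simple_root i) (Suc k)) (iota_e \<alpha>) M)"

definition int_vector :: "('n::{finite,linorder}, int) fock \<Rightarrow> ('n, complex) fock" where
  "int_vector c = (\<Sum>b\<in>Poly_Mapping.keys c.
     smul (of_int (Poly_Mapping.lookup c b)) (int_basis b))"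

text \<open>
  The range of \<^const>\<open>int_vector\<close> is $V_{L,\mathbb Z}$, on which \<open>int_coords\<close> gives the coordinates
  in the $\mathbb Z$-basis.  Accordingly $V_{L,\mathbb F} = V_{L,\mathbb Z} \otimes \mathbb F$ is the
  type \<open>('n, 'f) fock\<close>, where now the index \<open>b\<close> stands for \<open>int_basis b\<close> tensored with 1.
  For $v$ in $V_{L,\mathbb Z}$, \<open>base_change v\<close> is $v \otimes 1$.
\<close>

definition int_coords :: "('n::{finite,linorder}, complex) fock \<Rightarrow> ('n, int) fock" where
  "int_coords v = (THE c. int_vector c = v)"

definition base_change :: "('n::{finite,linorder}, complex) fock \<Rightarrow> ('n, 'f::field) fock" where
  "base_change v = Poly_Mapping.map of_int (int_coords v)"

definition base_change_op ::
  "(('n::{finite,linorder}, complex) fock \<Rightarrow> ('n, complex) fock) \<Rightarrow>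
   ('n, 'f::field) fock \<Rightarrow> ('n, 'f) fock" where
  "base_change_op T = lin_ext (\<lambda>b. base_change (T (int_basis b)))"

definition base_change_Y ::
  "(('n::{finite,linorder}, complex) fock \<Rightarrow> int \<Rightarrow> ('n, complex) fock \<Rightarrow> ('n, complex) fock) \<Rightarrow>
   ('n, 'f::field) fock \<Rightarrow> int \<Rightarrow> ('n, 'f) fock \<Rightarrow> ('n, 'f) fock" where
  "base_change_Y Y u m v =
     lin_ext (\<lambda>b. lin_ext (\<lambda>b'. base_change (Y (int_basis b) m (int_basis b'))) v) u"


section \<open>The bilinear form and its radical\<close>

text \<open>These conditions determine the form uniquely, and such a form exists.\<close>

definition lattice_bilinear_form ::
  "(('n::{finite,linorder}, 'f::field) fock \<Rightarrow> ('n, 'f) fock \<Rightarrow> 'f) \<Rightarrow> bool" where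
  "lattice_bilinear_form B \<longleftrightarrow>
     (\<forall>u u' v. B (u + u') v = B u v + B u' v) \<and>
     (\<forall>c u v. B (smul c u) v = c * B u v) \<and>
     (\<forall>u v. B u v = B v u) \<and>
     (\<forall>\<alpha> \<beta>. B (iota_e \<alpha>) (iota_e \<beta>) = (if \<alpha> = - \<beta> then 1 else 0)) \<and>
     (\<forall>\<alpha> m u v. B (base_change_op (s_op \<alpha> m) u) v = B u (base_change_op (r_op \<alpha> m) v))"

definition form_radical :: "('v \<Rightarrow> 'v \<Rightarrow> 'f::zero) \<Rightarrow> 'v set" where
  "form_radical B = {v. \<forall>u. B v u = 0}"

end

theory Submission
  imports Defs
begin

text \<open>
  The argument has three parts.

  \<^bold>\<open>The reduction is a vertex algebra.\<close>  Everything rests on the commutation rule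
  $E^+(-\alpha,x) E^-(-\beta,z) = (1 - z/x)^{\langle\alpha,\beta\rangle} E^-(-\beta,z) E^+(-\alpha,x)$
  (\<open>r_op_s_op\<close>), whose coefficients are integers.  It shows that the integral form is stable under
  the modes of the $\iota(e_\alpha)$.  Conversely, these modes generate the integral form from the
  vacuum over $\mathbb Z$ (\<open>integral_form_generated\<close>): the term of $Y(\iota(e_{\alpha_i}),x) v$ without
  annihilation operators yields the $s_{\alpha_i,k} v$, and the remaining terms are known by induction
  on the weight.  By the associativity formula, all modes of integral vectors then preserve the
  integral form.  As the given elements are linearly independent, the structure constants are
  well-defined integers, and the axioms pass to $\mathbb F$ (\<open>vertex_algebra_base_change\<close>).

  \<^bold>\<open>The radical is an ideal.\<close>  The operator $e_\alpha$ is self-adjoint up to the sign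
  $\epsilon(\alpha,\alpha)$, and $s_{\alpha,i}$ is adjoint to $r_{\alpha,i}$.  Hence the adjoint of the mode
  $\iota(e_\alpha)_q$ is, up to this sign, again a mode of $\iota(e_\alpha)$ (\<open>B_iota_e_mode\<close>).  So the
  radical is stable under the modes of the generators, and is a left ideal.  Commuting the modes
  $w_m$ of a vector $w$ of the radical past those of the generators reduces the right ideal property
  to stability under the operators $w \mapsto w_{-k-1} \mathbf 1$, the divided powers $D^{(k)}$ of the
  translation operator.  This stability is shown by duality, from the commutation of $D^{(k)}$ with
  modes and from $(D^{(k)} w, \mathbf 1) = 0$ for $k > 0$; the latter holds because the form with
  $\mathbf 1$ reads off the coefficient at $\mathbf 1$.  This part is valid for every vertex algebra
  with a form of this kind and is proved in that generality (\<open>form_radical_is_ideal\<close>).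

  \<^bold>\<open>The radical is nontrivial.\<close>  The vacuum pairs with itself to $1$.  On the other hand, the
  Cartan matrix of $A_n$ has determinant $n + 1$, which is zero in $\mathbb F$, and
  $h = \sum_i i\,\alpha_i$ is in its kernel.  Thus $h(-1) \mathbf 1$ is a nonzero vector of the radical.
\<close>

section \<open>Vertex algebras\<close>

text \<open>
  The sets shown below to be stable under modes are of two kinds: linear subspaces, and
  $\mathbb Z$-spans inside a complex space.  Additive subgroups cover both, because the structure
  constants in the Jacobi identity are integers.
\<close>

definition add_subgroup :: "'a::ab_group_add set \<Rightarrow> bool" where
  "add_subgroup A \<longleftrightarrow> 0 \<in> A \<and> (\<forall>x\<in>A. \<forall>y\<in>A. x - y \<in> A)"

lemma add_subgroup_0: "add_subgroup A \<Longrightarrow> 0 \<in> A"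
  and add_subgroup_diff: "add_subgroup A \<Longrightarrow> x \<in> A \<Longrightarrow> y \<in> A \<Longrightarrow> x - y \<in> A"
  by (auto simp: add_subgroup_def)

lemma add_subgroup_uminus: "add_subgroup A \<Longrightarrow> x \<in> A \<Longrightarrow> - x \<in> A"
  using add_subgroup_diff[of A 0 x] by (auto simp: add_subgroup_0)

lemma add_subgroup_add: "add_subgroup A \<Longrightarrow> x \<in> A \<Longrightarrow> y \<in> A \<Longrightarrow> x + y \<in> A"
  using add_subgroup_diff[of A x "- y"] by (auto simp: add_subgroup_uminus)

lemma add_subgroup_sum: "add_subgroup A \<Longrightarrow> (\<And>i. i \<in> I \<Longrightarrow> f i \<in> A) \<Longrightarrow> sum f I \<in> A"
  by (induction I rule: infinite_finite_induct) (auto simp: add_subgroup_0 add_subgroup_add)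

lemma add_subgroup_Sum_any: "add_subgroup A \<Longrightarrow> (\<And>i. f i \<in> A) \<Longrightarrow> Sum_any f \<in> A"
  by (auto simp: Sum_any.expand_set intro: add_subgroup_sum)

lemma Sum_any_eq_sum_lessThan:
  assumes "\<And>i::nat. i \<ge> N \<Longrightarrow> f i = 0"
  shows "Sum_any f = sum f {..<N}"
  using assms by (intro Sum_any.expand_superset) (auto simp: not_le[symmetric])

lemma (in Modules.module) add_subgroup_scale_of_int:
  assumes "add_subgroup A" "x \<in> A"
  shows "scale (of_int z) x \<in> A"
proof -
  have nat: "scale (of_nat n) x \<in> A" for n
    using assms by (induction n) (auto simp: scale_left_distrib add_subgroup_0 add_subgroup_add)
  show ?thesis
  proof (cases z rule: int_cases)
    case (neg n)
    have "scale (of_int z) x = - scale (of_nat (Suc n)) x"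
      unfolding neg by (simp del: of_nat_Suc)
    then show ?thesis using nat[of "Suc n"] assms add_subgroup_uminus by metis
  qed (use nat in auto)
qed

lemma (in Modules.module) subspace_imp_add_subgroup: "subspace A \<Longrightarrow> add_subgroup A"
  by (auto simp: add_subgroup_def subspace_0 subspace_diff)

lemma int_binomial_0_right [simp]: "int_binomial a 0 = 1"
  by (simp add: int_binomial_def)

lemma int_binomial_0_left: "int_binomial 0 k = (if k = 0 then 1 else 0)"
proof (cases "k = 0")
  case False
  then have "(\<Prod>i = 0..<k. 0 - int i) = 0"
    by (intro prod_zero) auto
  then show ?thesis using False by (simp only: int_binomial_def) auto
qed (simp add: int_binomial_def)

context vertex_algebra
begin

lemma Y_zero_left [simp]: "Y 0 m v = 0"
  using scale_left[of 0 0 m v] by simp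

lemma Y_zero_right [simp]: "Y u m 0 = 0"
  using scale_right[of u m 0 0] by simp

text \<open>
  The case $p = 0$ of the Jacobi identity: the modes of $u_r v$ are combinations of products of modes
  of $u$ and of $v$.
\<close>

lemma product_mode:
  "Y (Y u r v) q w =
     Sum_any (\<lambda>i. scale ((-1) ^ i * of_int (int_binomial r i)) (Y u (r - int i) (Y v (q + int i) w)))
     - Sum_any (\<lambda>i. scale ((if even r then 1 else -1) * (-1) ^ i * of_int (int_binomial r i))
          (Y v (q + r - int i) (Y u (int i) w)))"
proof -
  have "Sum_any (\<lambda>i::nat. scale (of_int (int_binomial 0 i)) (Y (Y u (r + int i) v) (0 + q - int i) w))
      = Y (Y u r v) q w"
    by (subst Sum_any_eq_sum_lessThan[where N = 1]) (auto simp: int_binomial_0_left)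
  then show ?thesis using jacobi[of r u 0 v q w] by simp
qed

text \<open>
  The case $r = 0$ of the Jacobi identity.
\<close>

lemma commutator:
  "Y u p (Y v q w) - Y v q (Y u p w) =
     Sum_any (\<lambda>i. scale (of_int (int_binomial p i)) (Y (Y u (int i) v) (p + q - int i) w))"
proof -
  have "Sum_any (\<lambda>i::nat. scale ((-1) ^ i * of_int (int_binomial 0 i))
          (Y u (p + 0 - int i) (Y v (q + int i) w))) = Y u p (Y v q w)"
    by (subst Sum_any_eq_sum_lessThan[where N = 1]) (auto simp: int_binomial_0_left)
  moreover have "Sum_any (\<lambda>i::nat. scale ((if even (0::int) then 1 else -1) * (-1) ^ i
          * of_int (int_binomial 0 i)) (Y v (q + 0 - int i) (Y u (p + int i) w))) = Y v q (Y u p w)"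
    by (subst Sum_any_eq_sum_lessThan[where N = 1]) (auto simp: int_binomial_0_left)
  ultimately show ?thesis using jacobi[of 0 u p v q w] by simp
qed

text \<open>
  This reduces statements about the modes of all vectors to the modes of generators.  It serves both
  for the stability of the integral form and for that of the radical.
\<close>

lemma modes_of_product_preserve:
  assumes A: "add_subgroup A"
    and u: "\<And>m w. w \<in> A \<Longrightarrow> Y u m w \<in> A"
    and v: "\<And>m w. w \<in> A \<Longrightarrow> Y v m w \<in> A"
    and w: "w \<in> A"
  shows "Y (Y u r v) q w \<in> A"
proof -
  have *: "(-1) ^ i * of_int z = of_int ((-1) ^ i * z)"
    "(if even r then 1 else -1) * (-1) ^ i * of_int z
      = of_int ((if even r then 1 else -1) * (-1) ^ i * z)" for i :: nat and z :: int
    by auto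
  show ?thesis
    unfolding product_mode *
    by (intro add_subgroup_diff[OF A] add_subgroup_Sum_any[OF A]
        add_subgroup_scale_of_int[OF A] u v w)
qed

text \<open>
  The operators $D^{(k)} w = w_{-k-1} \mathbf 1$ are the divided powers of the translation operator;
  this is their commutation with modes.  The other half of \<open>product_mode\<close> vanishes because
  $u_i \mathbf 1 = 0$ for $i \ge 0$.
\<close>

lemma translation_mode:
  "Y (Y u q w) (- int k - 1) vac =
     (\<Sum>i\<le>k. scale (of_int ((-1) ^ i * int_binomial q i))
        (Y u (q - int i) (Y w (- int (k - i) - 1) vac)))"
proof -
  have "Sum_any (\<lambda>i. scale ((if even q then 1 else -1) * (-1) ^ i * of_int (int_binomial q i))
      (Y w (- int k - 1 + q - int i) (Y u (int i) vac))) = 0"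
    by (simp add: creation_regular)
  moreover have "Sum_any (\<lambda>i. scale ((-1) ^ i * of_int (int_binomial q i))
        (Y u (q - int i) (Y w (- int k - 1 + int i) vac)))
    = (\<Sum>i\<le>k. scale (of_int ((-1) ^ i * int_binomial q i))
        (Y u (q - int i) (Y w (- int (k - i) - 1) vac)))"
    by (subst Sum_any_eq_sum_lessThan[where N = "Suc k"])
       (auto simp: creation_regular lessThan_Suc_atMost of_nat_diff algebra_simps intro!: sum.cong)
  ultimately show ?thesis by (simp add: product_mode)
qed

text \<open>
  The radical $R$ is stable under the modes of the generators, as these have adjoints, and hence is a
  left ideal.

  For right multiplication, $w_m$ is moved past the generators out of which its argument is built.
  The commutators are modes of vectors $(g_i)_j w \in R$, so only $w_m \mathbf 1$ is left to be
  treated, which is zero or one of the $D^{(k)} w$.  Stability under $D^{(k)}$ is not automatic for a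
  left ideal.  It follows here by duality: in $(D^{(k)} w, v)$ a mode
  of a generator is taken off $v$ by adjunction and moved to the right of the $D^{(j)}$, where it
  acts within $R$, until $v$ is a multiple of $\mathbf 1$.
\<close>

theorem form_radical_is_ideal:
  assumes gen: "\<And>T. subspace T \<Longrightarrow> vac \<in> T \<Longrightarrow> (\<And>i q v. v \<in> T \<Longrightarrow> Y (g i) q v \<in> T) \<Longrightarrow> T = UNIV"
    and B_add: "\<And>u u' v. B (u + u') v = B u v + B u' v"
    and B_scale: "\<And>c u v. B (scale c u) v = c * B u v"
    and B_sym: "\<And>u v. B u v = B v u"
    and adjoint: "\<And>i q. \<exists>c q'. \<forall>u v. B u (Y (g i) q v) = c * B (Y (g i) q' u) v"
    and vac: "\<And>w k. k \<ge> 1 \<Longrightarrow> B (Y w (- int k - 1) vac) vac = 0"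
  shows "va_ideal scale vac Y (form_radical B)"
proof -
  define R where "R = form_radical B"
  have B_add': "B u (v + v') = B u v + B u v'" for u v v'
    using B_add B_sym by metis
  have B_scale': "B u (scale c v) = c * B u v" for u c v
    using B_scale B_sym by metis
  have B_zero [simp]: "B 0 v = 0" "B v 0 = 0" for v
    using B_scale[of 0 0 v] B_scale'[of v 0 0] by auto
  have subR: "subspace R"
    by (auto simp: subspace_def R_def form_radical_def B_add B_scale)
  note agR = subspace_imp_add_subgroup[OF subR]
  have gR: "Y (g i) q w \<in> R" if "w \<in> R" for i q w
    unfolding R_def form_radical_def
  proof safe
    fix u
    obtain c q' where "B u (Y (g i) q w) = c * B (Y (g i) q' u) w"
      using adjoint[of i q] by blast
    moreover have "B w (Y (g i) q' u) = 0"
      using that by (simp add: R_def form_radical_def)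
    ultimately show "B (Y (g i) q w) u = 0"
      by (simp add: B_sym[of _ u] B_sym[of w])
  qed
  \<comment> \<open>Modes of arbitrary vectors are built from the modes of the generators.\<close>
  have left: "Y u m w \<in> R" if "w \<in> R" for u m w
  proof -
    have "{u. \<forall>m. \<forall>w\<in>R. Y u m w \<in> R} = UNIV"
    proof (rule gen)
      show "subspace {u. \<forall>m. \<forall>w\<in>R. Y u m w \<in> R}"
        by (auto simp: subspace_def add_left scale_left subspace_0[OF subR]
            subspace_add[OF subR] subspace_scale[OF subR])
      show "vac \<in> {u. \<forall>m. \<forall>w\<in>R. Y u m w \<in> R}"
        by (auto simp: vacuum subspace_0[OF subR])
    next
      fix i q v
      assume v: "v \<in> {u. \<forall>m. \<forall>w\<in>R. Y u m w \<in> R}"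
      show "Y (g i) q v \<in> {u. \<forall>m. \<forall>w\<in>R. Y u m w \<in> R}"
        using v by (auto intro!: modes_of_product_preserve[OF agR] gR)
    qed
    then show ?thesis using that by auto
  qed
  have translation: "Y w (- int k - 1) vac \<in> R" if "w \<in> R" for w k
  proof -
    let ?T = "{v. \<forall>k. \<forall>w\<in>R. B (Y w (- int k - 1) vac) v = 0}"
    have "?T = UNIV"
    proof (rule gen)
      show "subspace ?T"
        by (auto simp: subspace_def B_add' B_scale')
      show "vac \<in> ?T"
      proof safe
        fix k w
        assume "w \<in> R"
        then show "B (Y w (- int k - 1) vac) vac = 0"
          using vac[of k w]
          by (cases "k = 0") (auto simp: creation_constant R_def form_radical_def)
      qed
    next
      fix i q v
      assume v: "v \<in> ?T"
      \<comment> \<open>The commutation formula is solved for the term in which the mode is applied last.\<close>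
      have *: "B (Y (g i) q' (Y w (- int k - 1) vac)) v = 0" if "w \<in> R" for q' k w
        using that
      proof (induction k arbitrary: q' w rule: less_induct)
        case (less k)
        let ?f = "\<lambda>j. scale (of_int ((-1) ^ j * int_binomial q' j))
            (Y (g i) (q' - int j) (Y w (- int (k - j) - 1) vac))"
        have "Y (Y (g i) q' w) (- int k - 1) vac
            = Y (g i) q' (Y w (- int k - 1) vac) + (\<Sum>j\<in>{..k} - {0}. ?f j)"
          unfolding translation_mode by (subst sum.remove[of _ 0]) auto
        moreover have "(\<Sum>j\<in>{..k} - {0}. B (?f j) v) = 0"
        proof (intro sum.neutral ballI)
          fix j
          assume "j \<in> {..k} - {0}"
          then have "k - j < k" by auto
          then show "B (?f j) v = 0"
            unfolding B_scale using less by simp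
        qed
        moreover have "B (sum f J) v = (\<Sum>j\<in>J. B (f j) v)" for f and J :: "nat set"
          by (induction J rule: infinite_finite_induct) (auto simp: B_add)
        moreover have "B (Y (Y (g i) q' w) (- int k - 1) vac) v = 0"
          using v gR[OF less.prems] by blast
        ultimately show ?case by (simp only: B_add add_0_right)
      qed
      show "Y (g i) q v \<in> ?T"
      proof safe
        fix k w
        assume "w \<in> R"
        obtain c q' where "\<forall>u v. B u (Y (g i) q v) = c * B (Y (g i) q' u) v"
          using adjoint by blast
        then show "B (Y w (- int k - 1) vac) (Y (g i) q v) = 0"
          using *[OF \<open>w \<in> R\<close>] by simp
      qed
    qed
    then show ?thesis using that by (auto simp: R_def form_radical_def)
  qed
  have right: "Y w m u \<in> R" if "w \<in> R" for u m w
  proof -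
    let ?T = "{v. \<forall>m. \<forall>w\<in>R. Y w m v \<in> R}"
    have "?T = UNIV"
    proof (rule gen)
      show "subspace ?T"
        by (auto simp: subspace_def add_right scale_right subspace_0[OF subR]
            subspace_add[OF subR] subspace_scale[OF subR])
      show "vac \<in> ?T"
      proof safe
        fix m w
        assume w: "w \<in> R"
        show "Y w m vac \<in> R"
        proof (cases "m \<ge> 0")
          case False
          then have "m = - int (nat (- m - 1)) - 1" by auto
          then show ?thesis using translation[OF w] by metis
        qed (simp add: creation_regular subspace_0[OF subR])
      qed
    next
      fix i q v
      assume v: "v \<in> ?T"
      have "Y w m (Y (g i) q v) \<in> R" if w: "w \<in> R" for m w
      proof -
        have "Y w m (Y (g i) q v) = Y (g i) q (Y w m v) -
            Sum_any (\<lambda>j. scale (of_int (int_binomial q j)) (Y (Y (g i) (int j) w) (q + m - int j) v))"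
          using commutator[of "g i" q w m v] by (simp add: algebra_simps)
        also have "\<dots> \<in> R"
          using v w by (intro add_subgroup_diff[OF agR] add_subgroup_Sum_any[OF agR]
              subspace_scale[OF subR] gR) (auto intro: gR)
        finally show ?thesis .
      qed
      then show "Y (g i) q v \<in> ?T" by auto
    qed
    then show ?thesis using that by auto
  qed
  show ?thesis
    unfolding va_ideal_def
    using subR left right by (auto simp: R_def vertex_algebra_axioms)
qed

lemma Y_diff_left: "Y (u - u') m v = Y u m v - Y u' m v"
  using add_left[of "u - u'" u' m v] by simp

lemma Y_diff_right: "Y u m (v - v') = Y u m v - Y u m v'"
  using add_right[of u m "v - v'" v'] by simp

end

text \<open>
  The difference of the two sides of the Jacobi identity with all sums cut off at $N$.  For a bilinear
  \<open>Y\<close> and a fixed \<open>N\<close> it is trilinear, which the sums over the support are not before finiteness is known.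
\<close>

definition jacobi_defect ::
  "('k::ring_1 \<Rightarrow> 'v \<Rightarrow> 'v) \<Rightarrow> ('v \<Rightarrow> int \<Rightarrow> 'v \<Rightarrow> 'v::ab_group_add) \<Rightarrow> int \<Rightarrow> int \<Rightarrow> int \<Rightarrow> nat \<Rightarrow> 'v \<Rightarrow> 'v \<Rightarrow> 'v \<Rightarrow> 'v" where
  "jacobi_defect scale Y p q r N u v w =
     (\<Sum>i<N. scale (of_int ((-1) ^ i * int_binomial r i)) (Y u (p + r - int i) (Y v (q + int i) w)))
     - (\<Sum>i<N. scale (of_int ((if even r then 1 else -1) * (-1) ^ i * int_binomial r i))
          (Y v (q + r - int i) (Y u (p + int i) w)))
     - (\<Sum>i<N. scale (of_int (int_binomial p i)) (Y (Y u (r + int i) v) (p + q - int i) w))"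

lemma Sum_any_eventually:
  assumes "\<exists>K::int. \<forall>m\<ge>K. g m = 0" "\<And>i. g (m + int i) = 0 \<Longrightarrow> f i = 0"
  shows "\<forall>\<^sub>F N in sequentially. Sum_any f = sum f {..<N}"
proof -
  obtain K where K: "\<forall>m\<ge>K. g m = 0" using assms by blast
  have "\<forall>\<^sub>F N in sequentially. nat (K - m) \<le> N" by (rule eventually_ge_at_top)
  then show ?thesis
  proof eventually_elim
    case (elim N)
    then show ?case using K assms(2) by (intro Sum_any_eq_sum_lessThan) auto
  qed
qed

lemma eventually_jacobi_defect:
  assumes trunc: "\<And>u v. \<exists>N::int. \<forall>m\<ge>N. Y u m v = 0"
    and [simp]: "\<And>m v. Y 0 m v = 0" "\<And>u m. Y u m 0 = 0" "\<And>c. scale c 0 = 0"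
  shows "\<forall>\<^sub>F N in sequentially. jacobi_defect scale Y p q r N u v w =
     Sum_any (\<lambda>i::nat. scale ((-1) ^ i * of_int (int_binomial r i))
          (Y u (p + r - int i) (Y v (q + int i) w)))
       - Sum_any (\<lambda>i::nat. scale ((if even r then 1 else -1) * (-1) ^ i * of_int (int_binomial r i))
          (Y v (q + r - int i) (Y u (p + int i) w)))
       - Sum_any (\<lambda>i::nat. scale (of_int (int_binomial p i))
          (Y (Y u (r + int i) v) (p + q - int i) w))"
proof -
  have "\<forall>\<^sub>F N in sequentially. Sum_any (\<lambda>i::nat. scale ((-1) ^ i * of_int (int_binomial r i))
          (Y u (p + r - int i) (Y v (q + int i) w))) =
        (\<Sum>i<N. scale ((-1) ^ i * of_int (int_binomial r i)) (Y u (p + r - int i) (Y v (q + int i) w)))"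
    by (rule Sum_any_eventually[OF trunc[of v w], where m = q]) auto
  moreover have "\<forall>\<^sub>F N in sequentially. Sum_any (\<lambda>i::nat. scale ((if even r then 1 else -1) * (-1) ^ i * of_int (int_binomial r i))
          (Y v (q + r - int i) (Y u (p + int i) w))) =
        (\<Sum>i<N. scale ((if even r then 1 else -1) * (-1) ^ i * of_int (int_binomial r i))
          (Y v (q + r - int i) (Y u (p + int i) w)))"
    by (rule Sum_any_eventually[OF trunc[of u w], where m = p]) auto
  moreover have "\<forall>\<^sub>F N in sequentially. Sum_any (\<lambda>i::nat. scale (of_int (int_binomial p i))
          (Y (Y u (r + int i) v) (p + q - int i) w)) =
        (\<Sum>i<N. scale (of_int (int_binomial p i)) (Y (Y u (r + int i) v) (p + q - int i) w))"
    by (rule Sum_any_eventually[OF trunc[of u v], where m = r]) auto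
  ultimately show ?thesis
    by eventually_elim (simp add: jacobi_defect_def)
qed

section \<open>Finitely supported functions as a free module\<close>

lemma lookup_smul [simp]: "Poly_Mapping.lookup (smul c v) b = c * Poly_Mapping.lookup v b"
  by (simp add: smul_def Poly_Mapping.map.rep_eq when_def)

lemma smul_single [simp]: "smul c (Poly_Mapping.single b d) = Poly_Mapping.single b (c * d)"
  by (rule poly_mapping_eqI) (simp add: lookup_single when_def)

interpretation smul: Modules.module "smul :: 'k::comm_ring_1 \<Rightarrow> ('b \<Rightarrow>\<^sub>0 'k) \<Rightarrow> _"
  by unfold_locales (auto intro!: poly_mapping_eqI simp: lookup_add algebra_simps)

lemma vector_space_smul: "vector_space (smul :: 'k::field \<Rightarrow> ('b \<Rightarrow>\<^sub>0 'k) \<Rightarrow> _)"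
  by (simp add: vector_space_def smul.scale_right_distrib smul.scale_left_distrib)

abbreviation lin :: "(('b \<Rightarrow>\<^sub>0 'k::comm_ring_1) \<Rightarrow> ('c \<Rightarrow>\<^sub>0 'k)) \<Rightarrow> bool" where
  "lin \<equiv> module_hom smul smul"

lemma linI:
  "(\<And>u v. T (u + v) = T u + T v) \<Longrightarrow> (\<And>c v. T (smul c v) = smul c (T v)) \<Longrightarrow> lin T"
  by (simp add: module_hom_iff smul.module_axioms)

lemmas lin_add = module_hom.add[where ?s1.0 = smul and ?s2.0 = smul]
  and lin_smul = module_hom.scale[where ?s1.0 = smul and ?s2.0 = smul]
  and lin_0 = module_hom.zero[where ?s1.0 = smul and ?s2.0 = smul]
  and lin_uminus = module_hom.neg[where ?s1.0 = smul and ?s2.0 = smul]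
  and lin_diff = module_hom.diff[where ?s1.0 = smul and ?s2.0 = smul]
  and lin_sum = module_hom.sum[where ?s1.0 = smul and ?s2.0 = smul]

lemma lin_id: "lin (\<lambda>v. v)"
  by (rule linI) auto

lemma lin_zero: "lin (\<lambda>v. 0)"
  by (rule linI) auto

lemma lin_compose: "lin S \<Longrightarrow> lin T \<Longrightarrow> lin (\<lambda>v. S (T v))"
  by (rule linI) (simp_all add: lin_add lin_smul)

lemma lin_plus: "lin S \<Longrightarrow> lin T \<Longrightarrow> lin (\<lambda>v. S v + T v)"
  by (rule linI) (simp_all add: lin_add lin_smul smul.scale_right_distrib)

lemma lin_scaled: "lin S \<Longrightarrow> lin (\<lambda>v. smul c (S v))"
  by (rule linI) (simp_all add: lin_add lin_smul smul.scale_right_distrib mult.commute)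

lemma lin_pointwise_sum: "(\<And>i. i \<in> I \<Longrightarrow> lin (T i)) \<Longrightarrow> lin (\<lambda>v. \<Sum>i\<in>I. T i v)"
  by (induction I rule: infinite_finite_induct) (auto intro: lin_zero lin_plus)

lemma fock_expand:
  fixes v :: "'b \<Rightarrow>\<^sub>0 'k::comm_ring_1"
  assumes "finite A" "Poly_Mapping.keys v \<subseteq> A"
  shows "v = (\<Sum>b\<in>A. smul (Poly_Mapping.lookup v b) (Poly_Mapping.single b 1))"
proof (rule poly_mapping_eqI)
  fix c
  have "Poly_Mapping.lookup v c = 0" if "c \<notin> A"
    using assms(2) that by (auto simp: in_keys_iff)
  then show "Poly_Mapping.lookup v c =
      Poly_Mapping.lookup (\<Sum>b\<in>A. smul (Poly_Mapping.lookup v b) (Poly_Mapping.single b 1)) c"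
    using assms(1) by (simp add: lookup_sum lookup_single when_def)
qed

lemma fock_induct [case_names zero add scale basis]:
  fixes v :: "'b \<Rightarrow>\<^sub>0 'k::comm_ring_1"
  assumes "P 0" "\<And>u v. P u \<Longrightarrow> P v \<Longrightarrow> P (u + v)" "\<And>c v. P v \<Longrightarrow> P (smul c v)"
    and "\<And>b. P (Poly_Mapping.single b 1)"
  shows "P v"
proof -
  have "P (\<Sum>b\<in>A. smul (f b) (Poly_Mapping.single b 1))" if "finite A" for A f
    using that by (induction A) (auto intro: assms simp del: smul_single)
  then show ?thesis
    by (subst fock_expand[OF finite_keys order_refl]) simp
qed

lemma lin_eqI:
  assumes "lin S" "lin T" "\<And>b. S (Poly_Mapping.single b 1) = T (Poly_Mapping.single b 1)"
  shows "S v = T v"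
  by (induction v rule: fock_induct)
     (simp_all add: lin_0 lin_add lin_smul assms)

lemma lin_ext_superset:
  assumes "finite A" "Poly_Mapping.keys v \<subseteq> A"
  shows "lin_ext f v = (\<Sum>b\<in>A. smul (Poly_Mapping.lookup v b) (f b))"
  unfolding lin_ext_def
  by (rule sum.mono_neutral_left) (use assms in \<open>auto simp: in_keys_iff intro!: poly_mapping_eqI\<close>)

lemma lin_lin_ext [simp, intro]: "lin (lin_ext f)" for f :: "'b \<Rightarrow> 'c \<Rightarrow>\<^sub>0 'k::comm_ring_1"
proof (rule linI)
  fix u v :: "'b \<Rightarrow>\<^sub>0 'k" and c
  let ?A = "Poly_Mapping.keys u \<union> Poly_Mapping.keys v"
  show "lin_ext f (u + v) = lin_ext f u + lin_ext f v"
    using Poly_Mapping.keys_add[of u v]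
    by (simp add: lin_ext_superset[where A = ?A] lookup_add smul.scale_left_distrib sum.distrib)
  have "Poly_Mapping.keys (smul c v) \<subseteq> Poly_Mapping.keys v"
    by (auto simp: in_keys_iff)
  then show "lin_ext f (smul c v) = smul c (lin_ext f v)"
    by (simp add: lin_ext_superset[where A = "Poly_Mapping.keys v"] smul.scale_sum_right)
qed

lemma lin_ext_single [simp]:
  "lin_ext f (Poly_Mapping.single b c) = smul c (f b)" for c :: "'k::comm_ring_1"
  by (subst lin_ext_superset[where A = "{b}"]) auto

lemma lin_neg: "lin S \<Longrightarrow> lin (\<lambda>v. - S v)"
  using lin_scaled[of S "-1"] by simp

lemma fock_eqI:
  "lin S \<Longrightarrow> lin T \<Longrightarrow>
    (\<And>M \<alpha>. S (Poly_Mapping.single (M, \<alpha>) 1) = T (Poly_Mapping.single (M, \<alpha>) 1)) \<Longrightarrow> S v = T v"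
  by (rule lin_eqI[where S = S]) auto

section \<open>Exponentials of series of commuting operators\<close>

lemma sum_triangle_swap:
  "(\<Sum>j = 1..m. \<Sum>i = 1..m - j. f j i) = (\<Sum>i = 1..m. \<Sum>j = 1..m - (i::nat). f j i)"
  for f :: "nat \<Rightarrow> nat \<Rightarrow> 'a::comm_monoid_add"
  unfolding sum.Sigma[OF finite_atLeastAtMost ballI[OF finite_atLeastAtMost]]
  by (rule sum.reindex_bij_witness[of _ prod.swap prod.swap]) auto

lemma series_power_eq_0: "m < k \<Longrightarrow> (\<And>j. lin (T j)) \<Longrightarrow> series_power T k m v = 0"
  by (induction k arbitrary: m) (auto intro!: sum.neutral simp: lin_0)

lemma lin_series_power: "(\<And>j. lin (T j)) \<Longrightarrow> lin (series_power T k m)"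
proof (induction k arbitrary: m)
  case (Suc k)
  then show ?case by (simp add: lin_pointwise_sum lin_compose)
next
  case 0
  then show ?case by (cases "m = 0") (simp_all add: lin_id lin_zero)
qed

lemma lin_series_exp: "(\<And>j. lin (T j)) \<Longrightarrow> lin (series_exp T m)"
  unfolding series_exp_def by (intro lin_pointwise_sum lin_scaled lin_series_power)

text \<open>
  With $F = \sum_j T_j x^j$ this is $x \frac{d}{dx} F^{k+1} = (k+1) (x \frac{d}{dx} F) F^k$.
\<close>

lemma series_power_deriv:
  assumes lin: "\<And>j. lin (T j)" and comm: "\<And>i j v. T i (T j v) = T j (T i v)"
  shows "smul (of_nat m) (series_power T (Suc k) m v) =
    smul (of_nat (Suc k)) (\<Sum>j = 1..m. smul (of_nat j) (T j (series_power T k (m - j) v)))"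
proof (induction k arbitrary: m)
  case 0
  have "series_power T (Suc 0) m v = (\<Sum>j = 1..m. if j = m then T m v else 0)"
    unfolding series_power.simps by (rule sum.cong) (simp_all add: lin_0[OF lin])
  moreover have "(\<Sum>j = 1..m. smul (of_nat j) (T j (series_power T 0 (m - j) v)))
      = (\<Sum>j = 1..m. if j = m then smul (of_nat m) (T m v) else 0)"
    by (rule sum.cong) (simp_all add: lin_0[OF lin])
  ultimately show ?case by (simp del: series_power.simps)
next
  case (Suc k)
  let ?P = "\<lambda>k m. series_power T k m v"
  have "smul (of_nat m) (?P (Suc (Suc k)) m)
      = (\<Sum>j = 1..m. smul (of_nat j) (T j (?P (Suc k) (m - j))) +
            T j (smul (of_nat (m - j)) (?P (Suc k) (m - j))))"
    unfolding series_power.simps(2)[of T "Suc k"] smul.scale_sum_right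
    by (intro sum.cong refl)
       (simp add: lin_smul[OF lin] lin_diff[OF lin] of_nat_diff smul.scale_left_diff_distrib)
  also have "\<dots> = (\<Sum>j = 1..m. smul (of_nat j) (T j (?P (Suc k) (m - j))))
      + smul (of_nat (Suc k)) (\<Sum>j = 1..m. \<Sum>i = 1..m - j. smul (of_nat i) (T j (T i (?P k (m - j - i)))))"
    unfolding Suc.IH
    by (simp only: lin_smul[OF lin] lin_sum[OF lin] sum.distrib smul.scale_sum_right)
  also have "(\<Sum>j = 1..m. \<Sum>i = 1..m - j. smul (of_nat i) (T j (T i (?P k (m - j - i)))))
      = (\<Sum>i = 1..m. \<Sum>j = 1..m - i. smul (of_nat i) (T i (T j (?P k (m - i - j)))))"
    by (subst sum_triangle_swap) (simp add: comm[of _ "_::nat"] diff_commute add.commute)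
  also have "\<dots> = (\<Sum>i = 1..m. smul (of_nat i) (T i (?P (Suc k) (m - i))))"
    by (simp only: series_power.simps(2) lin_sum[OF lin] smul.scale_sum_right)
  finally show ?case
    by (simp only: of_nat_Suc[of "Suc k"] smul.scale_left_distrib smul.scale_one)
qed

lemma series_exp_0: "series_exp T 0 v = v"
  by (simp add: series_exp_def)

text \<open>
  The coefficientwise form of $x \frac{d}{dx} e^F = (x \frac{d}{dx} F) e^F$.  It determines the
  coefficients of $e^F$ recursively, so that all identities between exponentials below are proved by
  induction on the degree, without any manipulation of powers.
\<close>

lemma series_exp_rec:
  assumes lin: "\<And>j. lin (T j)" and comm: "\<And>i j v. T i (T j v) = T j (T i v)"
  shows "smul (of_nat m) (series_exp T m v) =
    (\<Sum>j = 1..m. smul (of_nat j) (T j (series_exp T (m - j) v)))"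
proof (cases m)
  case (Suc n)
  let ?P = "\<lambda>k m. series_power T k m v"
  have "smul (of_nat m) (series_exp T m v)
      = (\<Sum>k\<le>Suc n. smul (1 / fact k) (smul (of_nat m) (?P k m)))"
    by (simp only: Suc series_exp_def smul.scale_sum_right smul.scale_scale mult.commute)
  also have "\<dots> = (\<Sum>k\<le>n. smul (1 / fact (Suc k)) (smul (of_nat m) (?P (Suc k) m)))"
    by (subst sum.atMost_Suc_shift) (simp add: Suc del: series_power.simps(2))
  also have "\<dots> = (\<Sum>k\<le>n. smul (1 / fact k) (\<Sum>j = 1..m. smul (of_nat j) (T j (?P k (m - j)))))"
    unfolding series_power_deriv[OF lin comm]
    by (intro sum.cong refl) (simp add: field_simps del: of_nat_Suc)
  also have "\<dots> = (\<Sum>j = 1..m. smul (of_nat j) (T j (\<Sum>k\<le>n. smul (1 / fact k) (?P k (m - j)))))"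
    unfolding smul.scale_sum_right lin_sum[OF lin] lin_smul[OF lin]
    by (subst sum.swap) (simp add: mult.commute)
  also have "\<dots> = (\<Sum>j = 1..m. smul (of_nat j) (T j (series_exp T (m - j) v)))"
  proof (intro sum.cong refl)
    fix j
    assume "j \<in> {1..m}"
    then have "(\<Sum>k\<le>n. smul (1 / fact k) (?P k (m - j))) = series_exp T (m - j) v"
      unfolding series_exp_def using Suc
      by (intro sum.mono_neutral_right) (auto simp: series_power_eq_0 lin)
    then show "smul (of_nat j) (T j (\<Sum>k\<le>n. smul (1 / fact k) (?P k (m - j))))
        = smul (of_nat j) (T j (series_exp T (m - j) v))" by simp
  qed
  finally show ?thesis .
qed (simp add: series_exp_0)

lemma smul_cancel: "c \<noteq> 0 \<Longrightarrow> smul c u = smul c v \<longleftrightarrow> u = v" for c :: "'k::field"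
  using vector_space.scale_cancel_left[OF vector_space_smul] by metis

section \<open>Heisenberg operators\<close>

lemma h_form_simple_roots:
  "h_form h h' = (\<Sum>j\<in>UNIV. h' j * h_form h (h_of_lat (simple_root j)))"
proof -
  have "h_form h (h_of_lat (simple_root j)) = (\<Sum>i\<in>UNIV. h i * of_int (cartan i j))" for j
  proof -
    have "(\<Sum>k\<in>UNIV. h i * h_of_lat (simple_root j) k * of_int (cartan i k))
        = (\<Sum>k\<in>UNIV. if k = j then h i * of_int (cartan i j) else 0)" for i
      by (rule sum.cong) (auto simp: h_of_lat_def simple_root_def lookup_single when_def)
    then show ?thesis by (simp add: h_form_def)
  qed
  then show ?thesis
    unfolding h_form_def
    by (subst sum.swap) (simp add: sum_distrib_left mult_ac)
qed

lemma h_form_h_of_lat: "h_form (h_of_lat \<alpha>) (h_of_lat \<beta>) = of_int (lat_form \<alpha> \<beta>)"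
  by (simp add: h_form_def lat_form_def h_of_lat_def)

lemma lin_heis_create: "lin (heis_create h m)"
  and lin_heis_annihilate: "lin (heis_annihilate h m)"
  by (simp_all add: heis_create_def heis_annihilate_def lin_lin_ext)

lemma heis_neg: "m > 0 \<Longrightarrow> heis h (- int m) = heis_create h m"
  and heis_pos: "m > 0 \<Longrightarrow> heis h (int m) = heis_annihilate h m"
  by (auto simp: heis_def)

lemma smul_sum_single:
  "smul c (\<Sum>i\<in>I. Poly_Mapping.single (f i) (g i)) = (\<Sum>i\<in>I. Poly_Mapping.single (f i) (c * g i))"
  for c :: "'k::comm_ring_1"
  by (simp add: smul.scale_sum_right)

lemma single_sum:
  "Poly_Mapping.single b (sum f I) = (\<Sum>i\<in>I. Poly_Mapping.single b (f i))"
  by (induction I rule: infinite_finite_induct) (auto simp: single_add)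

lemma heis_create_single:
  "heis_create h m (Poly_Mapping.single (M, \<alpha>) c) =
     (\<Sum>i\<in>UNIV. Poly_Mapping.single (add_mset (i, m - 1) M, \<alpha>) (c * h i))"
  by (simp add: heis_create_def smul_sum_single)

lemma heis_annihilate_single:
  "heis_annihilate h m (Poly_Mapping.single (M, \<alpha>) c) =
     (\<Sum>j\<in>UNIV. Poly_Mapping.single (M - {#(j, m - 1)#}, \<alpha>)
       (c * (of_nat (count M (j, m - 1)) * of_nat m * h_form h (h_of_lat (simple_root j)))))"
  by (simp add: heis_annihilate_def smul_sum_single)

lemma heis_create_commute:
  "heis_create h i (heis_create h' j v) = heis_create h' j (heis_create h i v)"
proof (rule fock_eqI[where S = "\<lambda>v. heis_create h i (heis_create h' j v)" and v = v])
  fix M \<alpha>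
  show "heis_create h i (heis_create h' j (Poly_Mapping.single (M, \<alpha>) 1)) =
      heis_create h' j (heis_create h i (Poly_Mapping.single (M, \<alpha>) 1))"
    unfolding heis_create_single lin_sum[OF lin_heis_create]
    by (subst sum.swap) (simp add: add_mset_commute mult.commute)
qed (rule lin_compose[OF lin_heis_create lin_heis_create])+

lemma heis_annihilate_commute:
  "heis_annihilate h i (heis_annihilate h' j v) = heis_annihilate h' j (heis_annihilate h i v)"
proof (rule fock_eqI[where S = "\<lambda>v. heis_annihilate h i (heis_annihilate h' j v)" and v = v])
  fix M :: "('a \<times> nat) multiset" and \<alpha>
  have count: "of_nat (count M x) * of_nat (count (M - {#x#}) y)
      = (of_nat (count M y) * of_nat (count (M - {#y#}) x) :: complex)" for x y
    by (cases "x = y") auto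
  show "heis_annihilate h i (heis_annihilate h' j (Poly_Mapping.single (M, \<alpha>) 1)) =
      heis_annihilate h' j (heis_annihilate h i (Poly_Mapping.single (M, \<alpha>) 1))"
    unfolding heis_annihilate_single lin_sum[OF lin_heis_annihilate]
    apply (subst sum.swap)
    apply (intro sum.cong refl arg_cong2[where f = Poly_Mapping.single])
    subgoal by (simp add: add_mset_commute)
    subgoal for k l using count[of "(k, i - 1)" "(l, j - 1)"] by (simp add: mult_ac) 
    done
qed (rule lin_compose[OF lin_heis_annihilate lin_heis_annihilate])+

text \<open>
  The Heisenberg relation $[h(m), h'(-k)] = m \langle h,h' \rangle \delta_{m,k}$.
\<close>

lemma heis_annihilate_create:
  assumes "m > 0" "k > 0"
  shows "heis_annihilate h m (heis_create h' k v) =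
    heis_create h' k (heis_annihilate h m v) + (if m = k then smul (of_nat m * h_form h h') v else 0)"
proof (rule fock_eqI[where S = "\<lambda>v. heis_annihilate h m (heis_create h' k v)" and v = v])
  fix M :: "('a \<times> nat) multiset" and \<alpha> :: "'a lat"
  let ?r = "\<lambda>j. h_form h (h_of_lat (simple_root j))"
  have *: "Poly_Mapping.single (add_mset (i, k - 1) M - {#(j, m - 1)#}, \<alpha>)
        (h' i * (of_nat (count (add_mset (i, k - 1) M) (j, m - 1)) * of_nat m * ?r j))
      = Poly_Mapping.single (add_mset (i, k - 1) (M - {#(j, m - 1)#}), \<alpha>)
        (of_nat (count M (j, m - 1)) * of_nat m * ?r j * h' i)
      + (if i = j then if m = k then Poly_Mapping.single (M, \<alpha>) (of_nat m * (h' j * ?r j)) else 0 else 0)"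
    for i j
  proof (cases "(i, k - 1) = (j, m - 1)")
    case True
    then have *: "i = j" "k = m" using assms by auto
    have "count M (j, m - 1) = 0 \<or> add_mset (j, m - 1) (M - {#(j, m - 1)#}) = M"
      using insert_DiffM[of "(j, m - 1)" M] by (cases "(j, m - 1) \<in># M") (auto simp: count_eq_zero_iff)
    then show ?thesis
      unfolding * by (auto simp: algebra_simps simp flip: single_add)
  next
    case False
    then have "\<not> (i = j \<and> m = k)" by auto
    then show ?thesis
      using False diff_union_swap[OF False[symmetric], of M] by (simp add: mult_ac)
  qed
  show "heis_annihilate h m (heis_create h' k (Poly_Mapping.single (M, \<alpha>) 1)) =
    heis_create h' k (heis_annihilate h m (Poly_Mapping.single (M, \<alpha>) 1))
      + (if m = k then smul (of_nat m * h_form h h') (Poly_Mapping.single (M, \<alpha>) 1) else 0)"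
    unfolding heis_create_single heis_annihilate_single lin_sum[OF lin_heis_create]
      lin_sum[OF lin_heis_annihilate] mult_1 * sum.distrib
    by (subst sum.swap) (simp add: h_form_simple_roots[of h h'] sum_distrib_left single_sum)
next
  have "lin (\<lambda>v. if m = k then smul (of_nat m * h_form h h') v else 0)"
    by (cases "m = k") (simp_all add: lin_zero lin_scaled lin_id)
  then show "lin (\<lambda>v. heis_create h' k (heis_annihilate h m v) +
      (if m = k then smul (of_nat m * h_form h h') v else 0))"
    by (intro lin_plus lin_compose[OF lin_heis_create lin_heis_annihilate])
qed (rule lin_compose[OF lin_heis_annihilate lin_heis_create])

lemma heis_create_add: "heis_create (h_of_lat (\<alpha> + \<beta>)) j v
    = heis_create (h_of_lat \<alpha>) j v + heis_create (h_of_lat \<beta>) j v"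
proof (rule fock_eqI[where S = "heis_create (h_of_lat (\<alpha> + \<beta>)) j" and v = v])
  fix M \<gamma>
  show "heis_create (h_of_lat (\<alpha> + \<beta>)) j (Poly_Mapping.single (M, \<gamma>) 1)
    = heis_create (h_of_lat \<alpha>) j (Poly_Mapping.single (M, \<gamma>) 1)
      + heis_create (h_of_lat \<beta>) j (Poly_Mapping.single (M, \<gamma>) 1)"
    by (simp add: heis_create_single h_of_lat_def lookup_add single_add sum.distrib)
qed (intro lin_plus lin_heis_create)+

lemma heis_create_0: "heis_create (h_of_lat 0) j v = 0"
  using heis_create_add[of 0 0 j v] by simp

lemma heis_create_simple_root:
  "heis_create (h_of_lat (simple_root i)) (Suc k) (Poly_Mapping.single (M, \<alpha>) c)
    = Poly_Mapping.single (add_mset (i, k) M, \<alpha>) c"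
proof -
  have "heis_create (h_of_lat (simple_root i)) (Suc k) (Poly_Mapping.single (M, \<alpha>) c)
      = (\<Sum>j\<in>UNIV. if j = i then Poly_Mapping.single (add_mset (i, k) M, \<alpha>) c else 0)"
    unfolding heis_create_single
    by (rule sum.cong) (auto simp: h_of_lat_def simple_root_def lookup_single when_def)
  then show ?thesis by simp
qed

section \<open>The coefficients of the exponentials\<close>

lemma s_op_series:
  fixes \<alpha> :: "('n::{finite,linorder}) lat"
  defines "T \<equiv> \<lambda>m v. smul (1 / of_nat m) (heis (h_of_lat \<alpha>) (- int m) v)"
  shows "lin (T i)" and "T i (T j v) = T j (T i v)" and "j > 0 \<Longrightarrow> smul (of_nat j) (T j v) = heis_create (h_of_lat \<alpha>) j v"
proof -
  have T: "T m v = (if m = 0 then 0 else smul (1 / of_nat m) (heis_create (h_of_lat \<alpha>) m v))" for m v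
    by (auto simp: T_def heis_neg)
  show "lin (T i)"
    unfolding T by (cases "i = 0") (auto intro: lin_zero lin_scaled lin_heis_create)
  show "T i (T j v) = T j (T i v)"
    unfolding T
    by (auto simp: lin_smul[OF lin_heis_create] lin_0[OF lin_heis_create] mult.commute
        heis_create_commute[of _ i _ j])
  show "j > 0 \<Longrightarrow> smul (of_nat j) (T j v) = heis_create (h_of_lat \<alpha>) j v"
    by (simp add: T)
qed

lemma r_op_series:
  fixes \<alpha> :: "('n::{finite,linorder}) lat"
  defines "T \<equiv> \<lambda>m v. smul (- 1 / of_nat m) (heis (h_of_lat \<alpha>) (int m) v)"
  shows "lin (T i)" and "T i (T j v) = T j (T i v)" and "j > 0 \<Longrightarrow> smul (of_nat j) (T j v) = - heis_annihilate (h_of_lat \<alpha>) j v"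
proof -
  have T: "T m v = (if m = 0 then 0 else smul (- 1 / of_nat m) (heis_annihilate (h_of_lat \<alpha>) m v))" for m v
    by (auto simp: T_def heis_pos)
  show "lin (T i)"
    unfolding T
    by (cases "i = 0") (simp_all add: lin_zero lin_scaled lin_heis_annihilate del: smul.scale_minus_left)
  show "T i (T j v) = T j (T i v)"
    unfolding T
    by (auto simp: lin_smul[OF lin_heis_annihilate] lin_0[OF lin_heis_annihilate]
        lin_uminus[OF lin_heis_annihilate] mult.commute heis_annihilate_commute[of _ i _ j])
  show "j > 0 \<Longrightarrow> smul (of_nat j) (T j v) = - heis_annihilate (h_of_lat \<alpha>) j v"
    by (simp add: T)
qed

lemma lin_s_op: "lin (s_op \<alpha> m)" and lin_r_op: "lin (r_op \<alpha> m)"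
  unfolding s_op_def r_op_def by (intro lin_series_exp s_op_series r_op_series)+

lemma s_op_0 [simp]: "s_op \<alpha> 0 v = v" and r_op_0 [simp]: "r_op \<alpha> 0 v = v"
  by (simp_all add: s_op_def r_op_def series_exp_0)

lemma s_op_rec:
  "smul (of_nat m) (s_op \<alpha> m v) = (\<Sum>j = 1..m. heis_create (h_of_lat \<alpha>) j (s_op \<alpha> (m - j) v))"
  unfolding s_op_def
  by (subst series_exp_rec[OF s_op_series(1) s_op_series(2)])
     (rule sum.cong; simp only: s_op_series(3) atLeastAtMost_iff One_nat_def Suc_le_eq)

lemma r_op_rec:
  "smul (of_nat m) (r_op \<alpha> m v)
    = - (\<Sum>j = 1..m. heis_annihilate (h_of_lat \<alpha>) j (r_op \<alpha> (m - j) v))"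
  unfolding r_op_def sum_negf[symmetric]
  by (subst series_exp_rec[OF r_op_series(1) r_op_series(2)])
     (rule sum.cong; simp only: r_op_series(3) atLeastAtMost_iff One_nat_def Suc_le_eq)

text \<open>
  The recursion involves only the Heisenberg operators, so an operator that commutes with these
  commutes with the coefficients of the exponentials.
\<close>

lemma lin_commutes_with_s_op:
  assumes T: "lin T" and "\<And>j v. j > 0 \<Longrightarrow> T (heis_create (h_of_lat \<alpha>) j v) = heis_create (h_of_lat \<alpha>) j (T v)"
  shows "T (s_op \<alpha> m v) = s_op \<alpha> m (T v)"
proof (induction m rule: less_induct)
  case (less m)
  show ?case
  proof (cases "m = 0")
    case False
    have "smul (of_nat m) (T (s_op \<alpha> m v)) = T (smul (of_nat m) (s_op \<alpha> m v))"
      by (simp add: lin_smul[OF T])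
    also have "\<dots> = (\<Sum>j = 1..m. heis_create (h_of_lat \<alpha>) j (s_op \<alpha> (m - j) (T v)))"
      unfolding s_op_rec lin_sum[OF T] using less False
      by (intro sum.cong) (auto simp: assms(2))
    also have "\<dots> = smul (of_nat m) (s_op \<alpha> m (T v))"
      by (simp add: s_op_rec)
    finally show ?thesis using False by (simp add: smul_cancel)
  qed simp
qed

lemma lin_commutes_with_r_op:
  assumes T: "lin T" and "\<And>j v. j > 0 \<Longrightarrow> T (heis_annihilate (h_of_lat \<alpha>) j v) = heis_annihilate (h_of_lat \<alpha>) j (T v)"
  shows "T (r_op \<alpha> m v) = r_op \<alpha> m (T v)"
proof (induction m rule: less_induct)
  case (less m)
  show ?case
  proof (cases "m = 0")
    case False
    have "smul (of_nat m) (T (r_op \<alpha> m v)) = T (smul (of_nat m) (r_op \<alpha> m v))"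
      by (simp add: lin_smul[OF T])
    also have "\<dots> = - (\<Sum>j = 1..m. heis_annihilate (h_of_lat \<alpha>) j (r_op \<alpha> (m - j) (T v)))"
      unfolding r_op_rec lin_sum[OF T] lin_uminus[OF T] using less False
      by (intro arg_cong[where f = uminus] sum.cong) (auto simp: assms(2))
    also have "\<dots> = smul (of_nat m) (r_op \<alpha> m (T v))"
      by (simp add: r_op_rec)
    finally show ?thesis using False by (simp add: smul_cancel)
  qed simp
qed

lemma heis_create_s_op: "heis_create h j (s_op \<alpha> m v) = s_op \<alpha> m (heis_create h j v)"
  by (rule lin_commutes_with_s_op) (auto intro: lin_heis_create heis_create_commute)

lemma s_op_commute: "s_op \<alpha> m (s_op \<beta> k v) = s_op \<beta> k (s_op \<alpha> m v)"
  by (rule lin_commutes_with_s_op) (auto intro: lin_s_op heis_create_s_op[symmetric])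

lemma sum_triangle_swap_atMost:
  "(\<Sum>i\<le>m. \<Sum>j = 1..m - i. f i j) = (\<Sum>j = 1..m. \<Sum>i\<le>m - (j::nat). f i j)"
  for f :: "nat \<Rightarrow> nat \<Rightarrow> 'a::comm_monoid_add"
  unfolding sum.Sigma[OF finite_atMost ballI[OF finite_atLeastAtMost]]
    sum.Sigma[OF finite_atLeastAtMost ballI[OF finite_atMost]]
  by (rule sum.reindex_bij_witness[of _ prod.swap prod.swap]) auto

lemma sum_triangle_shift:
  "(\<Sum>i\<le>m. \<Sum>j = 1..i. f i j) = (\<Sum>j = 1..m. \<Sum>i\<le>m - (j::nat). f (i + j) j)"
  for f :: "nat \<Rightarrow> nat \<Rightarrow> 'a::comm_monoid_add"
  unfolding sum.Sigma[OF finite_atMost ballI[OF finite_atLeastAtMost]]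
    sum.Sigma[OF finite_atLeastAtMost ballI[OF finite_atMost]]
  by (rule sum.reindex_bij_witness[of _ "\<lambda>(j, i). (i + j, j)" "\<lambda>(i, j). (j, i - j)"]) auto

text \<open>That is, $E^-(-\alpha-\beta,x) = E^-(-\alpha,x) E^-(-\beta,x)$.\<close>

lemma s_op_add: "s_op (\<alpha> + \<beta>) m v = (\<Sum>i\<le>m. s_op \<alpha> i (s_op \<beta> (m - i) v))"
proof (induction m rule: less_induct)
  case (less m)
  let ?a = "heis_create (h_of_lat \<alpha>)" and ?b = "heis_create (h_of_lat \<beta>)"
  show ?case
  proof (cases "m = 0")
    case False
    have "smul (of_nat m) (\<Sum>i\<le>m. s_op \<alpha> i (s_op \<beta> (m - i) v))
        = (\<Sum>i\<le>m. smul (of_nat i) (s_op \<alpha> i (s_op \<beta> (m - i) v))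
            + s_op \<alpha> i (smul (of_nat (m - i)) (s_op \<beta> (m - i) v)))"
      unfolding smul.scale_sum_right
      by (intro sum.cong refl)
         (simp add: lin_smul[OF lin_s_op] of_nat_diff flip: smul.scale_left_distrib)
    also have "\<dots> = (\<Sum>i\<le>m. \<Sum>j = 1..i. ?a j (s_op \<alpha> (i - j) (s_op \<beta> (m - i) v)))
        + (\<Sum>i\<le>m. \<Sum>j = 1..m - i. ?b j (s_op \<alpha> i (s_op \<beta> (m - i - j) v)))"
      unfolding s_op_rec lin_sum[OF lin_s_op] sum.distrib by (simp add: heis_create_s_op)
    also have "\<dots> = (\<Sum>j = 1..m. (\<Sum>i\<le>m - j. ?a j (s_op \<alpha> (i + j - j) (s_op \<beta> (m - (i + j)) v)))
        + (\<Sum>i\<le>m - j. ?b j (s_op \<alpha> i (s_op \<beta> (m - i - j) v))))"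
      unfolding sum_triangle_swap_atMost sum_triangle_shift sum.distrib ..
    also have "\<dots> = (\<Sum>j = 1..m. heis_create (h_of_lat (\<alpha> + \<beta>)) j
        (\<Sum>i\<le>m - j. s_op \<alpha> i (s_op \<beta> (m - j - i) v)))"
    proof (intro sum.cong refl)
      fix j
      have "m - (i + j) = m - j - i" "m - i - j = m - j - i" for i by auto
      then show "(\<Sum>i\<le>m - j. ?a j (s_op \<alpha> (i + j - j) (s_op \<beta> (m - (i + j)) v)))
          + (\<Sum>i\<le>m - j. ?b j (s_op \<alpha> i (s_op \<beta> (m - i - j) v)))
          = heis_create (h_of_lat (\<alpha> + \<beta>)) j (\<Sum>i\<le>m - j. s_op \<alpha> i (s_op \<beta> (m - j - i) v))"
        by (simp only: heis_create_add lin_sum[OF lin_heis_create] add_diff_cancel_right' sum.distrib)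
    qed
    also have "\<dots> = (\<Sum>j = 1..m. heis_create (h_of_lat (\<alpha> + \<beta>)) j (s_op (\<alpha> + \<beta>) (m - j) v))"
      using less False by (intro sum.cong) auto
    also have "\<dots> = smul (of_nat m) (s_op (\<alpha> + \<beta>) m v)"
      by (simp only: s_op_rec)
    finally show ?thesis
      using False by (simp add: smul_cancel)
  qed simp
qed

lemma s_op_zero_root: "s_op 0 m v = (if m = 0 then v else 0)"
proof -
  have "smul (of_nat m) (s_op 0 m v) = 0"
    unfolding s_op_rec by (simp add: heis_create_0)
  then show ?thesis using smul_cancel[of "of_nat m" "s_op 0 m v" 0] by auto
qed

text \<open>
  That is, $[h(m), E^-(-\beta,x)] = \langle h,\beta \rangle x^m E^-(-\beta,x)$.
\<close>

lemma heis_annihilate_s_op: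
  assumes "m > 0"
  shows "heis_annihilate h m (s_op \<beta> k v) = s_op \<beta> k (heis_annihilate h m v)
    + (if m \<le> k then smul (h_form h (h_of_lat \<beta>)) (s_op \<beta> (k - m) v) else 0)"
proof (induction k rule: less_induct)
  case (less k)
  let ?b = "heis_create (h_of_lat \<beta>)" and ?n = "h_form h (h_of_lat \<beta>)"
  show ?case
  proof (cases "k = 0")
    case False
    have "smul (of_nat k) (heis_annihilate h m (s_op \<beta> k v))
        = heis_annihilate h m (smul (of_nat k) (s_op \<beta> k v))"
      by (simp add: lin_smul[OF lin_heis_annihilate])
    also have "\<dots> = (\<Sum>i = 1..k. ?b i (heis_annihilate h m (s_op \<beta> (k - i) v))
        + (if m = i then smul (of_nat m * ?n) (s_op \<beta> (k - i) v) else 0))"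
      unfolding s_op_rec lin_sum[OF lin_heis_annihilate] using assms
      by (intro sum.cong refl heis_annihilate_create) auto
    also have "\<dots> = (\<Sum>i = 1..k. ?b i (heis_annihilate h m (s_op \<beta> (k - i) v)))
        + (if m \<le> k then smul (of_nat m * ?n) (s_op \<beta> (k - m) v) else 0)"
      using assms by (simp add: sum.distrib)
    also have "(\<Sum>i = 1..k. ?b i (heis_annihilate h m (s_op \<beta> (k - i) v)))
        = (\<Sum>i = 1..k. ?b i (s_op \<beta> (k - i) (heis_annihilate h m v))
            + (if m \<le> k - i then smul ?n (?b i (s_op \<beta> (k - m - i) v)) else 0))"
      using less False
      by (intro sum.cong refl)
         (auto simp: lin_add[OF lin_heis_create] lin_smul[OF lin_heis_create]
           lin_0[OF lin_heis_create] add.commute)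
    also have "\<dots> = smul (of_nat k) (s_op \<beta> k (heis_annihilate h m v))
        + (\<Sum>i = 1..k. if m \<le> k - i then smul ?n (?b i (s_op \<beta> (k - m - i) v)) else 0)"
      unfolding sum.distrib s_op_rec ..
    also have "(\<Sum>i = 1..k. if m \<le> k - i then smul ?n (?b i (s_op \<beta> (k - m - i) v)) else 0)
        = (if m \<le> k then smul (of_nat (k - m) * ?n) (s_op \<beta> (k - m) v) else 0)"
    proof (cases "m \<le> k")
      case True
      have "(\<Sum>i = 1..k. if m \<le> k - i then smul ?n (?b i (s_op \<beta> (k - m - i) v)) else 0)
          = (\<Sum>i = 1..k - m. smul ?n (?b i (s_op \<beta> (k - m - i) v)))"
        using True assms by (intro sum.mono_neutral_cong_right) auto
      also have "\<dots> = smul ?n (smul (of_nat (k - m)) (s_op \<beta> (k - m) v))"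
        unfolding s_op_rec smul.scale_sum_right ..
      finally show ?thesis using True by (simp add: mult.commute)
    next
      case False
      then show ?thesis using assms by (auto intro!: sum.neutral)
    qed
    finally have "smul (of_nat k) (heis_annihilate h m (s_op \<beta> k v)) =
        smul (of_nat k) (s_op \<beta> k (heis_annihilate h m v)
          + (if m \<le> k then smul ?n (s_op \<beta> (k - m) v) else 0))"
      by (auto simp: smul.scale_right_distrib of_nat_diff algebra_simps
          simp flip: smul.scale_left_distrib)
    then show ?thesis using False by (simp add: smul_cancel)
  qed (use assms in simp)
qed

text \<open>
  The product of $k$ consecutive integers is divisible by $k!$; the quotient is therefore not
  truncated.
\<close>

lemma of_int_int_binomial: "of_int (int_binomial n k) = (of_int n gchoose k :: complex)"
proof -
  obtain z :: int where z: "(of_int n gchoose k :: complex) = of_int z"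
  proof (cases "n \<ge> 0")
    case True
    then have "(of_int n gchoose k :: complex) = of_int (int (nat n choose k))"
      by (simp add: binomial_gbinomial)
    then show ?thesis by (rule that)
  next
    case False
    then have "of_nat k - of_int n - 1 = (of_nat (nat (int k - n - 1)) :: complex)"
      by (simp add: of_nat_nat)
    then have "(of_int n gchoose k :: complex) = of_int ((-1) ^ k * int (nat (int k - n - 1) choose k))"
      by (subst gbinomial_negated_upper) (simp add: binomial_gbinomial)
    then show ?thesis by (rule that)
  qed
  have "(of_int (\<Prod>i = 0..<k. n - int i) :: complex) = of_int (z * fact k)"
    using z by (simp add: gbinomial_prod_rev field_simps)
  then have "(\<Prod>i = 0..<k. n - int i) = z * fact k"
    by (simp only: of_int_eq_iff)
  then show ?thesis by (simp add: int_binomial_def z)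
qed

text \<open>
  With $b_l$ the coefficient of $y^l$ in $(1-y)^n$, this is $n \sum_{l<t} b_l = - t\, b_t$, which is
  $(1-y) \cdot y \frac{d}{dy} (1-y)^n = - n y (1-y)^n$ divided by $1-y$.
\<close>

lemma alternating_int_binomial_sum:
  "n * (\<Sum>j = 1..t. (-1) ^ (t - j) * int_binomial n (t - j)) = - int t * ((-1) ^ t * int_binomial n t)"
proof (cases t)
  case (Suc k)
  have "(\<Sum>j = 1..t. (-1) ^ (t - j) * (of_int n gchoose (t - j)))
      = (\<Sum>l\<le>k. (of_int n gchoose l) * (-1) ^ l :: complex)"
    by (rule sum.reindex_bij_witness[of _ "\<lambda>l. t - l" "\<lambda>j. t - j"]) (auto simp: Suc mult.commute)
  also have "\<dots> = (-1) ^ k * (of_int n - 1 gchoose k)"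
    by (rule gbinomial_sum_lower_neg)
  finally have "of_int n * (\<Sum>j = 1..t. (-1) ^ (t - j) * (of_int n gchoose (t - j)))
      = (-1) ^ k * (of_int n * (of_int n - 1 gchoose k) :: complex)"
    by (simp only: mult_ac)
  also have "\<dots> = - of_nat t * ((-1) ^ t * (of_int n gchoose t))"
    unfolding gbinomial_absorption[symmetric] by (simp add: Suc algebra_simps)
  finally have "of_int n * (\<Sum>j = 1..t. (-1) ^ (t - j) * (of_int n gchoose (t - j)))
      = - of_nat t * ((-1) ^ t * (of_int n gchoose t) :: complex)" .
  then have "of_int (n * (\<Sum>j = 1..t. (-1) ^ (t - j) * int_binomial n (t - j)))
      = (of_int (- int t * ((-1) ^ t * int_binomial n t)) :: complex)"
    by (simp add: of_int_int_binomial)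
  then show ?thesis by (simp only: of_int_eq_iff)
qed simp

text \<open>
  That is, $E^+(-\alpha,x) E^-(-\beta,z)
  = (1 - z/x)^{\langle\alpha,\beta\rangle} E^-(-\beta,z) E^+(-\alpha,x)$.  The coefficients on the
  right are integers, which is why the integral form is stable under the $r_{\alpha,m}$.
\<close>

lemma r_op_s_op:
  "r_op \<alpha> i (s_op \<beta> k v) = (\<Sum>l\<le>i. if l \<le> k then
      smul (of_int ((-1) ^ l * int_binomial (lat_form \<alpha> \<beta>) l)) (s_op \<beta> (k - l) (r_op \<alpha> (i - l) v)) else 0)"
proof (induction i rule: less_induct)
  case (less i)
  define n where "n = lat_form \<alpha> \<beta>"
  define b where "b = (\<lambda>l. (-1) ^ l * int_binomial n l)"
  define S where "S = (\<lambda>l v. if l \<le> k then s_op \<beta> (k - l) v else 0)"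
  have lin_S: "lin (S l)" for l
    by (cases "l \<le> k") (simp_all add: S_def lin_s_op lin_zero)
  let ?a = "heis_annihilate (h_of_lat \<alpha>)"
  have aS: "?a j (S l w) = S l (?a j w) + smul (of_int n) (S (l + j) w)" if "j > 0" for j l w
    using that
    by (auto simp: S_def heis_annihilate_s_op h_form_h_of_lat n_def lin_0[OF lin_heis_annihilate])
  have IH: "r_op \<alpha> m (s_op \<beta> k v) = (\<Sum>l\<le>m. smul (of_int (b l)) (S l (r_op \<alpha> (m - l) v)))"
    if "m < i" for m
    unfolding less.IH[OF that] by (intro sum.cong refl) (auto simp: S_def b_def n_def)
  have "r_op \<alpha> i (s_op \<beta> k v) = (\<Sum>l\<le>i. smul (of_int (b l)) (S l (r_op \<alpha> (i - l) v)))"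
  proof (cases "i = 0")
    case False
    have "smul (of_nat i) (r_op \<alpha> i (s_op \<beta> k v))
        = - (\<Sum>j = 1..i. ?a j (\<Sum>l\<le>i - j. smul (of_int (b l)) (S l (r_op \<alpha> (i - j - l) v))))"
      unfolding r_op_rec using False
      by (intro arg_cong[where f = uminus] sum.cong refl) (simp add: IH)
    also have "\<dots> = - (\<Sum>j = 1..i. \<Sum>l\<le>i - j. smul (of_int (b l)) (S l (?a j (r_op \<alpha> (i - l - j) v))))
        - (\<Sum>j = 1..i. \<Sum>l\<le>i - j. smul (of_int (n * b (l + j - j))) (S (l + j) (r_op \<alpha> (i - (l + j)) v)))"
    proof -
      have "?a j (\<Sum>l\<le>i - j. smul (of_int (b l)) (S l (r_op \<alpha> (i - j - l) v)))
          = (\<Sum>l\<le>i - j. smul (of_int (b l)) (S l (?a j (r_op \<alpha> (i - l - j) v))))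
          + (\<Sum>l\<le>i - j. smul (of_int (n * b (l + j - j))) (S (l + j) (r_op \<alpha> (i - (l + j)) v)))"
        if "j > 0" for j
        unfolding lin_sum[OF lin_heis_annihilate] lin_smul[OF lin_heis_annihilate] sum.distrib[symmetric]
      proof (intro sum.cong refl)
        fix l
        have "i - j - l = i - (l + j)" "i - l - j = i - (l + j)" by auto
        then show "smul (of_int (b l)) (?a j (S l (r_op \<alpha> (i - j - l) v)))
          = smul (of_int (b l)) (S l (?a j (r_op \<alpha> (i - l - j) v)))
            + smul (of_int (n * b (l + j - j))) (S (l + j) (r_op \<alpha> (i - (l + j)) v))"
          by (simp only: aS[OF that] smul.scale_right_distrib smul.scale_scale of_int_mult
              add_diff_cancel_right' mult.commute[of "of_int (b l)"])
      qed
      then show ?thesis by (simp add: sum.distrib)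
    qed
    also have "(\<Sum>j = 1..i. \<Sum>l\<le>i - j. smul (of_int (b l)) (S l (?a j (r_op \<alpha> (i - l - j) v))))
        = (\<Sum>l\<le>i. smul (of_int (b l)) (S l (\<Sum>j = 1..i - l. ?a j (r_op \<alpha> (i - l - j) v))))"
    proof -
      have "smul (of_int (b l)) (S l (\<Sum>j = 1..i - l. ?a j (r_op \<alpha> (i - l - j) v)))
          = (\<Sum>j = 1..i - l. smul (of_int (b l)) (S l (?a j (r_op \<alpha> (i - l - j) v))))" for l
        by (simp only: lin_sum[OF lin_S] smul.scale_sum_right)
      then show ?thesis
        using sum_triangle_swap_atMost[of "\<lambda>l j. smul (of_int (b l)) (S l (?a j (r_op \<alpha> (i - l - j) v)))" i]
        by (simp only:)
    qed
    also have "\<dots> = - (\<Sum>l\<le>i. smul (of_int (int (i - l) * b l)) (S l (r_op \<alpha> (i - l) v)))"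
    proof -
      have "(\<Sum>j = 1..m. ?a j (r_op \<alpha> (m - j) v)) = - smul (of_nat m) (r_op \<alpha> m v)" for m
        by (simp add: r_op_rec)
      then show ?thesis
        by (simp only: sum_negf[symmetric] lin_uminus[OF lin_S] lin_smul[OF lin_S] smul.scale_scale
            smul.scale_minus_right of_int_mult of_int_of_nat_eq mult.commute[of "of_int (b _)"])
    qed
    also have "(\<Sum>j = 1..i. \<Sum>l\<le>i - j. smul (of_int (n * b (l + j - j))) (S (l + j) (r_op \<alpha> (i - (l + j)) v)))
        = (\<Sum>t\<le>i. \<Sum>j = 1..t. smul (of_int (n * b (t - j))) (S t (r_op \<alpha> (i - t) v)))"
      unfolding sum_triangle_shift ..
    also have "\<dots> = (\<Sum>t\<le>i. smul (of_int (- int t * b t)) (S t (r_op \<alpha> (i - t) v)))"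
    proof (intro sum.cong refl)
      fix t
      have "(\<Sum>j = 1..t. n * b (t - j)) = - int t * b t"
        using alternating_int_binomial_sum[of n t] by (simp add: b_def sum_distrib_left)
      moreover have "(\<Sum>j = 1..t. smul (of_int (n * b (t - j))) w)
          = smul (of_int (\<Sum>j = 1..t. n * b (t - j))) w" for w :: "('a, complex) fock"
        unfolding of_int_sum smul.scale_sum_left ..
      ultimately show "(\<Sum>j = 1..t. smul (of_int (n * b (t - j))) (S t (r_op \<alpha> (i - t) v)))
          = smul (of_int (- int t * b t)) (S t (r_op \<alpha> (i - t) v))"
        by (simp only:)
    qed
    also have "- (- (\<Sum>l\<le>i. smul (of_int (int (i - l) * b l)) (S l (r_op \<alpha> (i - l) v))))
        - (\<Sum>t\<le>i. smul (of_int (- int t * b t)) (S t (r_op \<alpha> (i - t) v)))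
        = smul (of_nat i) (\<Sum>l\<le>i. smul (of_int (b l)) (S l (r_op \<alpha> (i - l) v)))"
      unfolding minus_minus sum_subtractf[symmetric] smul.scale_sum_right
      by (intro sum.cong refl)
         (simp add: of_nat_diff left_diff_distrib flip: smul.scale_left_distrib)
    finally show ?thesis using False by (simp add: smul_cancel)
  qed (simp add: b_def S_def)
  also have "\<dots> = (\<Sum>l\<le>i. if l \<le> k then
      smul (of_int ((-1) ^ l * int_binomial (lat_form \<alpha> \<beta>) l)) (s_op \<beta> (k - l) (r_op \<alpha> (i - l) v)) else 0)"
    by (intro sum.cong refl) (auto simp: S_def b_def n_def)
  finally show ?case .
qed

text \<open>
  That is, $[E^+(-\alpha,x), h(-k)] = - \langle \alpha,h \rangle x^{-k} E^+(-\alpha,x)$.  Since the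
  monomials are built up by the $h(-k)$, it follows that the $r_{\alpha,m}$ are locally nilpotent.
\<close>

lemma r_op_heis_create:
  assumes "k > 0"
  shows "r_op \<alpha> i (heis_create h k v) = heis_create h k (r_op \<alpha> i v)
    - (if k \<le> i then smul (h_form (h_of_lat \<alpha>) h) (r_op \<alpha> (i - k) v) else 0)"
proof (induction i rule: less_induct)
  case (less i)
  let ?a = "heis_annihilate (h_of_lat \<alpha>)" and ?n = "h_form (h_of_lat \<alpha>) h"
  show ?case
  proof (cases "i = 0")
    case False
    have "smul (of_nat i) (r_op \<alpha> i (heis_create h k v))
        = - (\<Sum>j = 1..i. heis_create h k (?a j (r_op \<alpha> (i - j) v))
            + (if j = k then smul (of_nat j * ?n) (r_op \<alpha> (i - j) v) else 0)
            - (if k \<le> i - j then smul ?n (?a j (r_op \<alpha> (i - k - j) v)) else 0))"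
      unfolding r_op_rec
    proof (intro arg_cong[where f = uminus] sum.cong refl)
      fix j
      assume j: "j \<in> {1..i}"
      have "r_op \<alpha> (i - j) (heis_create h k v) = heis_create h k (r_op \<alpha> (i - j) v)
          - (if k \<le> i - j then smul ?n (r_op \<alpha> (i - k - j) v) else 0)"
        using j less[of "i - j"] by (simp add: add.commute)
      then show "?a j (r_op \<alpha> (i - j) (heis_create h k v)) =
          heis_create h k (?a j (r_op \<alpha> (i - j) v))
            + (if j = k then smul (of_nat j * ?n) (r_op \<alpha> (i - j) v) else 0)
            - (if k \<le> i - j then smul ?n (?a j (r_op \<alpha> (i - k - j) v)) else 0)"
        using j assms
        by (simp add: lin_diff[OF lin_heis_annihilate] lin_smul[OF lin_heis_annihilate]
            lin_0[OF lin_heis_annihilate] heis_annihilate_create)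
    qed
    also have "\<dots> = heis_create h k (smul (of_nat i) (r_op \<alpha> i v))
        - (\<Sum>j = 1..i. if j = k then smul (of_nat j * ?n) (r_op \<alpha> (i - j) v) else 0)
        + (\<Sum>j = 1..i. if k \<le> i - j then smul ?n (?a j (r_op \<alpha> (i - k - j) v)) else 0)"
    proof -
      have "- (a + b - c) = - a - b + c" for a b c :: "('a, complex) fock"
        by simp
      then show ?thesis
        unfolding r_op_rec lin_uminus[OF lin_heis_create] lin_sum[OF lin_heis_create] sum.distrib
          sum_subtractf by blast
    qed
    also have "(\<Sum>j = 1..i. if j = k then smul (of_nat j * ?n) (r_op \<alpha> (i - j) v) else 0)
        = (if k \<le> i then smul (of_nat k * ?n) (r_op \<alpha> (i - k) v) else 0)"
      using assms by simp
    also have "(\<Sum>j = 1..i. if k \<le> i - j then smul ?n (?a j (r_op \<alpha> (i - k - j) v)) else 0)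
        = (if k \<le> i then - smul (of_nat (i - k) * ?n) (r_op \<alpha> (i - k) v) else 0)"
    proof (cases "k \<le> i")
      case True
      have "(\<Sum>j = 1..i. if k \<le> i - j then smul ?n (?a j (r_op \<alpha> (i - k - j) v)) else 0)
          = (\<Sum>j = 1..i - k. smul ?n (?a j (r_op \<alpha> (i - k - j) v)))"
        using True assms by (intro sum.mono_neutral_cong_right) auto
      also have "\<dots> = - smul ?n (smul (of_nat (i - k)) (r_op \<alpha> (i - k) v))"
        unfolding r_op_rec smul.scale_sum_right smul.scale_minus_right by simp
      finally show ?thesis using True by (simp add: mult.commute)
    next
      case False
      then show ?thesis using assms by (auto intro!: sum.neutral)
    qed
    finally have "smul (of_nat i) (r_op \<alpha> i (heis_create h k v)) =
        smul (of_nat i) (heis_create h k (r_op \<alpha> i v)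
          - (if k \<le> i then smul ?n (r_op \<alpha> (i - k) v) else 0))"
      by (auto simp: smul.scale_right_diff_distrib lin_smul[OF lin_heis_create] of_nat_diff
          left_diff_distrib smul.scale_left_diff_distrib)
    then show ?thesis using False by (simp add: smul_cancel)
  qed (use assms in simp)
qed

lemma r_op_iota_e: "r_op \<alpha> i (iota_e \<beta>) = (if i = 0 then iota_e \<beta> else 0)"
proof (induction i rule: less_induct)
  case (less i)
  have "heis_annihilate (h_of_lat \<alpha>) j (r_op \<alpha> (i - j) (iota_e \<beta>)) = 0" if "j \<in> {1..i}" for j
  proof -
    have "heis_annihilate (h_of_lat \<alpha>) j (iota_e \<beta>) = 0"
      by (simp add: iota_e_def heis_annihilate_single)
    then show ?thesis
      using less[of "i - j"] that by (auto simp: lin_0[OF lin_heis_annihilate])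
  qed
  then have "smul (of_nat i) (r_op \<alpha> i (iota_e \<beta>)) = 0"
    unfolding r_op_rec by (simp add: sum.neutral)
  then show ?case
    using smul_cancel[of "of_nat i" "r_op \<alpha> i (iota_e \<beta>)" 0] by auto
qed

lemma r_op_locally_nilpotent: "\<exists>N. \<forall>i\<ge>N. r_op \<alpha> i v = 0"
proof (induction v rule: fock_induct)
  case (add u v)
  then obtain N N' where "\<forall>i\<ge>N. r_op \<alpha> i u = 0" "\<forall>i\<ge>N'. r_op \<alpha> i v = 0" by blast
  then show ?case
    by (intro exI[of _ "max N N'"]) (auto simp: lin_add[OF lin_r_op])
next
  case (scale c v)
  then obtain N where "\<forall>i\<ge>N. r_op \<alpha> i v = 0" by blast
  then show ?case by (intro exI[of _ N]) (simp add: lin_smul[OF lin_r_op])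
next
  case (basis b)
  obtain M \<beta> where b: "b = (M, \<beta>)" by force
  show ?case
    unfolding b
  proof (induction M)
    case empty
    show ?case
      using r_op_iota_e[of \<alpha> _ \<beta>] by (intro exI[of _ 1]) (auto simp: iota_e_def)
  next
    case (add x M)
    obtain i k where x: "x = (i, k)" by force
    obtain N where N: "\<forall>i\<ge>N. r_op \<alpha> i (Poly_Mapping.single (M, \<beta>) 1) = 0" using add by blast
    have "r_op \<alpha> j (Poly_Mapping.single (add_mset x M, \<beta>) 1) = 0" if "j \<ge> N + Suc k" for j
      unfolding x heis_create_simple_root[symmetric]
      using N that by (simp add: r_op_heis_create lin_0[OF lin_heis_create])
    then show ?case by blast
  qed
qed (auto simp: lin_0[OF lin_r_op])

lemma lin_e_op: "lin (e_op \<epsilon> \<alpha>)"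
  by (simp add: e_op_def)

lemma e_op_single:
  "e_op \<epsilon> \<alpha> (Poly_Mapping.single (M, \<beta>) c) = Poly_Mapping.single (M, \<alpha> + \<beta>) (c * of_int (\<epsilon> \<alpha> \<beta>))"
  by (simp add: e_op_def)

lemma e_op_iota_e: "e_op \<epsilon> \<alpha> (iota_e \<beta>) = smul (of_int (\<epsilon> \<alpha> \<beta>)) (iota_e (\<alpha> + \<beta>))"
  by (simp add: iota_e_def e_op_single)

lemma e_op_s_op: "e_op \<epsilon> \<alpha> (s_op \<beta> m v) = s_op \<beta> m (e_op \<epsilon> \<alpha> v)"
proof (rule lin_commutes_with_s_op[OF lin_e_op])
  fix j v
  show "e_op \<epsilon> \<alpha> (heis_create (h_of_lat \<beta>) j v) = heis_create (h_of_lat \<beta>) j (e_op \<epsilon> \<alpha> v)"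
    by (rule fock_eqI[where S = "\<lambda>v. e_op \<epsilon> \<alpha> (heis_create (h_of_lat \<beta>) j v)" and v = v])
       (simp_all add: lin_compose lin_e_op lin_heis_create heis_create_single e_op_single
          lin_sum[OF lin_e_op] mult.commute)
qed

lemma e_op_r_op: "e_op \<epsilon> \<alpha> (r_op \<beta> m v) = r_op \<beta> m (e_op \<epsilon> \<alpha> v)"
proof (rule lin_commutes_with_r_op[OF lin_e_op])
  fix j v
  show "e_op \<epsilon> \<alpha> (heis_annihilate (h_of_lat \<beta>) j v) = heis_annihilate (h_of_lat \<beta>) j (e_op \<epsilon> \<alpha> v)"
    by (rule fock_eqI[where S = "\<lambda>v. e_op \<epsilon> \<alpha> (heis_annihilate (h_of_lat \<beta>) j v)" and v = v])
       (simp_all add: lin_compose lin_e_op lin_heis_annihilate heis_annihilate_single e_op_single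
          lin_sum[OF lin_e_op] mult_ac)
qed

section \<open>Vectors with prescribed support\<close>

definition supported :: "'b set \<Rightarrow> ('b \<Rightarrow>\<^sub>0 'k::comm_ring_1) set" where
  "supported A = {v. Poly_Mapping.keys v \<subseteq> A}"

lemma supported_iff: "v \<in> supported A \<longleftrightarrow> (\<forall>b. b \<notin> A \<longrightarrow> Poly_Mapping.lookup v b = 0)"
  by (auto simp: supported_def in_keys_iff)

lemma lookup_supported: "v \<in> supported A \<Longrightarrow> b \<notin> A \<Longrightarrow> Poly_Mapping.lookup v b = 0"
  by (simp add: supported_iff)

lemma subspace_supported: "smul.subspace (supported A)"
  by (auto simp: smul.subspace_def supported_iff lookup_add)

lemma single_supported: "b \<in> A \<Longrightarrow> Poly_Mapping.single b c \<in> supported A"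
  by (auto simp: supported_def)

lemma supported_mono: "v \<in> supported A \<Longrightarrow> A \<subseteq> A' \<Longrightarrow> v \<in> supported A'"
  by (auto simp: supported_def)

lemma supported_induct [consumes 1, case_names zero add scale basis]:
  assumes "v \<in> supported A" "P 0" "\<And>u v. P u \<Longrightarrow> P v \<Longrightarrow> P (u + v)" "\<And>c v. P v \<Longrightarrow> P (smul c v)"
    and "\<And>b. b \<in> A \<Longrightarrow> P (Poly_Mapping.single b 1)"
  shows "P v"
proof -
  have "P (\<Sum>b\<in>A'. smul (f b) (Poly_Mapping.single b 1))" if "finite A'" "A' \<subseteq> A" for A' f
    using that by (induction A') (auto intro: assms simp del: smul_single)
  then show ?thesis
    using assms(1) by (subst fock_expand[OF finite_keys order_refl]) (simp add: supported_def)
qed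

lemma lin_supported:
  assumes "lin T" "\<And>b. b \<in> A \<Longrightarrow> T (Poly_Mapping.single b 1) \<in> supported A'" "v \<in> supported A"
  shows "T v \<in> supported A'"
  using assms(3)
  by (induction rule: supported_induct)
     (auto simp: lin_0[OF assms(1)] lin_add[OF assms(1)] lin_smul[OF assms(1)] assms(2)
       intro: smul.subspace_0 smul.subspace_add smul.subspace_scale subspace_supported)

lemma supported_divide:
  "smul (of_nat m) v \<in> supported A \<Longrightarrow> m > 0 \<Longrightarrow> v \<in> supported A" for v :: "'b \<Rightarrow>\<^sub>0 complex"
  by (auto simp: supported_def in_keys_iff subset_iff)

abbreviation component :: "'n lat \<Rightarrow> ('n, 'k::comm_ring_1) fock set" where
  "component \<beta> \<equiv> supported {b. snd b = \<beta>}"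

lemma heis_create_component: "v \<in> component \<beta> \<Longrightarrow> heis_create h k v \<in> component \<beta>"
  by (rule lin_supported[OF lin_heis_create])
     (auto simp: heis_create_single intro!: smul.subspace_sum subspace_supported single_supported)

lemma s_op_component: "v \<in> component \<beta> \<Longrightarrow> s_op \<alpha> m v \<in> component \<beta>"
proof (induction m rule: less_induct)
  case (less m)
  show ?case
  proof (cases "m = 0")
    case False
    have "smul (of_nat m) (s_op \<alpha> m v) \<in> component \<beta>"
      unfolding s_op_rec using less
      by (intro smul.subspace_sum subspace_supported heis_create_component) auto
    then show ?thesis using False supported_divide by blast
  qed (use less in simp)
qed

text \<open>
  On a component the exponent of $x^\alpha$ is constant, so there the vertex operator is a single sum
  over $j$, in terms of operators that can be evaluated on the integral basis.
\<close>

lemma lattice_vertex_op_component: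
  fixes v :: "('n::{finite,linorder}, complex) fock"
  assumes "v \<in> component \<beta>"
  shows "\<exists>N0. \<forall>N\<ge>N0. lattice_vertex_op \<epsilon> \<alpha> m v =
    (\<Sum>j<N. let i = int j - lat_form \<alpha> \<beta> - m - 1 in
       if i \<ge> 0 then s_op \<alpha> (nat i) (r_op \<alpha> j (e_op \<epsilon> \<alpha> v)) else 0)"
proof -
  define t where "t = (\<lambda>j v. let i = int j - lat_form \<alpha> \<beta> - m - 1 in
       if i \<ge> 0 then s_op \<alpha> (nat i) (r_op \<alpha> j (e_op \<epsilon> \<alpha> v)) else 0)"
  have lin_t: "lin (t j)" for j
    unfolding t_def Let_def
    by (cases "int j - lat_form \<alpha> \<beta> - m - 1 \<ge> 0")
       (simp_all add: lin_zero lin_compose[OF lin_s_op] lin_compose[OF lin_r_op] lin_e_op)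
  have lin_Y: "lin (lattice_vertex_op \<epsilon> \<alpha> m)"
    by (simp add: lattice_vertex_op_def)
  have "\<exists>N0. \<forall>N\<ge>N0. lattice_vertex_op \<epsilon> \<alpha> m v = (\<Sum>j<N. t j v)"
    using assms
  proof (induction rule: supported_induct)
    case (add u v)
    then obtain N N' where "\<forall>K\<ge>N. lattice_vertex_op \<epsilon> \<alpha> m u = (\<Sum>j<K. t j u)"
      "\<forall>K\<ge>N'. lattice_vertex_op \<epsilon> \<alpha> m v = (\<Sum>j<K. t j v)" by blast
    then show ?case
      by (intro exI[of _ "max N N'"]) (auto simp: lin_add[OF lin_t] lin_add[OF lin_Y] sum.distrib)
  next
    case (scale c v)
    then obtain N where "\<forall>K\<ge>N. lattice_vertex_op \<epsilon> \<alpha> m v = (\<Sum>j<K. t j v)" by blast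
    then show ?case
      by (intro exI[of _ N]) (simp add: lin_smul[OF lin_t] lin_smul[OF lin_Y] smul.scale_sum_right)
  next
    case (basis b)
    then obtain M where b: "b = (M, \<beta>)" by (cases b) auto
    obtain N where N: "\<forall>i\<ge>N. r_op \<alpha> i (e_op \<epsilon> \<alpha> (Poly_Mapping.single b 1)) = 0"
      using r_op_locally_nilpotent by blast
    have "lattice_vertex_op \<epsilon> \<alpha> m (Poly_Mapping.single b 1)
        = Sum_any (\<lambda>j. t j (Poly_Mapping.single b 1))"
      by (simp add: lattice_vertex_op_def b t_def)
    moreover have "Sum_any (\<lambda>j. t j (Poly_Mapping.single b 1)) = (\<Sum>j<K. t j (Poly_Mapping.single b 1))"
      if "K \<ge> N" for K
      using N that
      by (intro Sum_any_eq_sum_lessThan) (auto simp: t_def Let_def lin_0[OF lin_s_op])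
    ultimately show ?case by auto
  qed (simp add: lin_0[OF lin_t] lin_0[OF lin_Y])
  then show ?thesis unfolding t_def .
qed

section \<open>The integral form\<close>

lemma int_basis_empty: "int_basis ({#}, \<alpha>) = iota_e \<alpha>"
  by (simp add: int_basis_def)

lemma int_basis_add_mset:
  "int_basis (add_mset (i, k) M, \<alpha>) = s_op (simple_root i) (Suc k) (int_basis (M, \<alpha>))"
proof -
  interpret comp_fun_commute
    "\<lambda>(i, k). s_op (simple_root i) (Suc k) :: ('a, complex) fock \<Rightarrow> _"
    by unfold_locales (auto simp: fun_eq_iff intro: s_op_commute)
  show ?thesis by (simp add: int_basis_def)
qed

lemma s_op_int_basis:
  "s_op (simple_root i) m (int_basis (M, \<alpha>)) =
     int_basis (if m = 0 then M else add_mset (i, m - 1) M, \<alpha>)"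
  by (cases m) (auto simp: int_basis_add_mset)

lemma int_basis_component: "int_basis (M, \<alpha>) \<in> component \<alpha>"
proof (induction M)
  case empty
  show ?case by (simp add: int_basis_empty iota_e_def single_supported)
next
  case (add x M)
  then show ?case by (cases x) (simp add: int_basis_add_mset s_op_component)
qed

text \<open>
  The filtration by the number of Heisenberg factors.  The leading part of $s_{\alpha,m}$ for it is
  $\alpha(-m)/m$, so the change from monomials to \<^const>\<open>int_basis\<close> is triangular.
\<close>

abbreviation long_monomials :: "nat \<Rightarrow> ('n, complex) fock set" where
  "long_monomials d \<equiv> supported {b. d \<le> size (fst b)}"

lemma long_monomials_Suc: "v \<in> long_monomials (Suc d) \<Longrightarrow> v \<in> long_monomials d"
  by (erule supported_mono) auto

lemma heis_create_long: "v \<in> long_monomials d \<Longrightarrow> heis_create h k v \<in> long_monomials (Suc d)"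
  by (rule lin_supported[OF lin_heis_create])
     (auto simp: heis_create_single intro!: smul.subspace_sum subspace_supported single_supported)

lemma s_op_long: "v \<in> long_monomials d \<Longrightarrow> m > 0 \<Longrightarrow> s_op \<alpha> m v \<in> long_monomials (Suc d)"
proof (induction m rule: less_induct)
  case (less m)
  have "s_op \<alpha> (m - j) v \<in> long_monomials d" if "j \<in> {1..m}" for j
    using that less.prems less.IH[of "m - j"] by (cases "j = m") (auto intro: long_monomials_Suc)
  then have "smul (of_nat m) (s_op \<alpha> m v) \<in> long_monomials (Suc d)"
    unfolding s_op_rec
    by (intro smul.subspace_sum subspace_supported heis_create_long) auto
  then show ?case using less.prems supported_divide by blast
qed

lemma s_op_leading_term:
  assumes "v \<in> long_monomials d" "m > 0"
  shows "s_op \<alpha> m v - smul (1 / of_nat m) (heis_create (h_of_lat \<alpha>) m v) \<in> long_monomials (Suc (Suc d))"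
proof -
  have "(\<Sum>j = 1..m. heis_create (h_of_lat \<alpha>) j (s_op \<alpha> (m - j) v))
      = heis_create (h_of_lat \<alpha>) m v + (\<Sum>j\<in>{1..m} - {m}. heis_create (h_of_lat \<alpha>) j (s_op \<alpha> (m - j) v))"
    using assms(2) by (subst sum.remove[of _ m]) auto
  then have "smul (of_nat m) (s_op \<alpha> m v - smul (1 / of_nat m) (heis_create (h_of_lat \<alpha>) m v))
      = (\<Sum>j\<in>{1..m} - {m}. heis_create (h_of_lat \<alpha>) j (s_op \<alpha> (m - j) v))"
    using assms(2) s_op_rec[of m \<alpha> v] by (simp add: smul.scale_right_diff_distrib)
  also have "\<dots> \<in> long_monomials (Suc (Suc d))"
    using assms by (intro smul.subspace_sum subspace_supported heis_create_long s_op_long) auto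
  finally show ?thesis using assms(2) supported_divide by blast
qed

lemma int_basis_leading_term:
  "\<exists>c. c \<noteq> 0 \<and> int_basis (M, \<alpha>) - Poly_Mapping.single (M, \<alpha>) c \<in> long_monomials (Suc (size M))"
proof (induction M)
  case empty
  show ?case
    by (intro exI[of _ 1]) (simp add: int_basis_empty iota_e_def smul.subspace_0 subspace_supported)
next
  case (add x M)
  obtain i k where x: "x = (i, k)" by force
  obtain c where c: "c \<noteq> 0"
    "int_basis (M, \<alpha>) - Poly_Mapping.single (M, \<alpha>) c \<in> long_monomials (Suc (size M))"
    using add by blast
  let ?s = "s_op (simple_root i) (Suc k)" and ?m = "Poly_Mapping.single (M, \<alpha>) c"
  let ?c = "c / of_nat (Suc k)"
  have "?s (int_basis (M, \<alpha>) - ?m) \<in> long_monomials (Suc (Suc (size M)))"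
    using s_op_long[OF c(2)] by blast
  moreover have "?s ?m - Poly_Mapping.single (add_mset x M, \<alpha>) ?c \<in> long_monomials (Suc (Suc (size M)))"
    using s_op_leading_term[of ?m "size M" "Suc k" "simple_root i"]
    by (simp add: heis_create_simple_root x single_supported)
  ultimately have "?s (int_basis (M, \<alpha>) - ?m) + (?s ?m - Poly_Mapping.single (add_mset x M, \<alpha>) ?c)
      \<in> long_monomials (Suc (Suc (size M)))"
    by (rule smul.subspace_add[OF subspace_supported])
  then have "int_basis (add_mset x M, \<alpha>) - Poly_Mapping.single (add_mset x M, \<alpha>) ?c
      \<in> long_monomials (Suc (size (add_mset x M)))"
    by (simp add: x int_basis_add_mset lin_diff[OF lin_s_op])
  moreover have "?c \<noteq> 0" using c(1) by (simp del: of_nat_Suc)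
  ultimately show ?case by blast
qed

lemma lookup_int_basis:
  assumes "size (fst b) \<le> size (fst b')"
  shows "Poly_Mapping.lookup (int_basis b') b \<noteq> 0 \<longleftrightarrow> b = b'"
proof -
  obtain c where c: "c \<noteq> 0"
    "int_basis b' - Poly_Mapping.single b' c \<in> long_monomials (Suc (size (fst b')))"
    using int_basis_leading_term[of "fst b'" "snd b'"] by auto
  have "Poly_Mapping.lookup (int_basis b' - Poly_Mapping.single b' c) b = 0"
    using assms by (intro lookup_supported[OF c(2)]) auto
  then show ?thesis using c(1) by (auto simp: lookup_minus lookup_single when_def split: if_splits)
qed

lemma int_vector_superset:
  assumes "finite A" "Poly_Mapping.keys c \<subseteq> A"
  shows "int_vector c = (\<Sum>b\<in>A. smul (of_int (Poly_Mapping.lookup c b)) (int_basis b))"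
  unfolding int_vector_def
  by (rule sum.mono_neutral_left) (use assms in \<open>auto simp: in_keys_iff\<close>)

lemma int_vector_diff: "int_vector (c - d) = int_vector c - int_vector d"
proof -
  let ?A = "Poly_Mapping.keys c \<union> Poly_Mapping.keys d"
  have "Poly_Mapping.keys (c - d) \<subseteq> ?A"
    by (auto simp: in_keys_iff lookup_minus)
  then show ?thesis
    by (simp add: int_vector_superset[where A = ?A] lookup_minus smul.scale_left_diff_distrib
        sum_subtractf)
qed

lemma int_vector_0 [simp]: "int_vector 0 = 0"
  by (simp add: int_vector_def)

lemma int_vector_add: "int_vector (c + d) = int_vector c + int_vector d"
  using int_vector_diff[of c "- d"] int_vector_diff[of 0 d] by simp

lemma int_vector_single [simp]: "int_vector (Poly_Mapping.single b z) = smul (of_int z) (int_basis b)"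
  by (subst int_vector_superset[where A = "{b}"]) auto

lemma int_vector_eq_0_imp:
  assumes "int_vector c = 0"
  shows "c = 0"
proof (rule ccontr)
  assume "c \<noteq> 0"
  then obtain b where b: "b \<in> Poly_Mapping.keys c"
    "\<And>b'. b' \<in> Poly_Mapping.keys c \<Longrightarrow> size (fst b) \<le> size (fst b')"
    using ex_has_least_nat[of "\<lambda>b. b \<in> Poly_Mapping.keys c" _ "\<lambda>b. size (fst b)"]
    by (metis keys_eq_empty ex_in_conv)
  have "0 = Poly_Mapping.lookup (int_vector c) b" using assms by simp
  also have "\<dots> = (\<Sum>b'\<in>Poly_Mapping.keys c.
      of_int (Poly_Mapping.lookup c b') * Poly_Mapping.lookup (int_basis b') b)"
    by (simp add: int_vector_def lookup_sum)
  also have "\<dots> = (\<Sum>b'\<in>Poly_Mapping.keys c. if b' = b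
      then of_int (Poly_Mapping.lookup c b) * Poly_Mapping.lookup (int_basis b) b else 0)"
    using lookup_int_basis[OF b(2)] by (intro sum.cong) auto
  also have "\<dots> = of_int (Poly_Mapping.lookup c b) * Poly_Mapping.lookup (int_basis b) b"
    using b(1) by simp
  finally show False
    using lookup_int_basis[of b b] b(1) by (auto simp: in_keys_iff)
qed

lemma int_coords_int_vector [simp]: "int_coords (int_vector c) = c"
  unfolding int_coords_def
proof (rule the_equality)
  fix d
  assume "int_vector d = int_vector c"
  then have "int_vector (d - c) = 0" by (simp add: int_vector_diff)
  then show "d = c" using int_vector_eq_0_imp by fastforce
qed simp

text \<open>
  The coefficient at $\mathbf 1$ is the same in both bases, since every other element of the integral
  basis has only monomials with a Heisenberg factor or in another component.
\<close>

lemma lookup_int_vector_vac: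
  "Poly_Mapping.lookup (int_vector c) ({#}, 0) = of_int (Poly_Mapping.lookup c ({#}, 0))"
proof -
  have *: "Poly_Mapping.lookup (int_basis b) ({#}, 0) = (if b = ({#}, 0) then 1 else 0)" for b
    using lookup_int_basis[of "({#}, 0)" b] by (auto simp: int_basis_empty iota_e_def)
  have "Poly_Mapping.lookup (int_vector c) ({#}, 0) = (\<Sum>b\<in>Poly_Mapping.keys c.
      of_int (Poly_Mapping.lookup c b) * (if b = ({#}, 0) then 1 else 0))"
    by (simp add: int_vector_def lookup_sum *)
  also have "\<dots> = (\<Sum>b\<in>Poly_Mapping.keys c. if b = ({#}, 0) then of_int (Poly_Mapping.lookup c ({#}, 0)) else 0)"
    by (intro sum.cong) auto
  finally show ?thesis by (simp add: in_keys_iff)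
qed

definition int_span :: "('n::{finite,linorder}) fock_index set \<Rightarrow> ('n, complex) fock set" where
  "int_span S = int_vector ` supported S"

lemma add_subgroup_int_span: "add_subgroup (int_span S)"
  unfolding add_subgroup_def
proof (intro conjI ballI)
  show "0 \<in> int_span S"
    unfolding int_span_def by (rule image_eqI[of _ _ 0]) (auto simp: supported_def)
next
  fix u v
  assume "u \<in> int_span S" "v \<in> int_span S"
  then obtain c d where "u = int_vector c" "v = int_vector d" "c \<in> supported S" "d \<in> supported S"
    by (auto simp: int_span_def)
  then show "u - v \<in> int_span S"
    unfolding int_span_def
    by (intro image_eqI[of _ _ "c - d"]) (auto simp: int_vector_diff smul.subspace_diff subspace_supported)
qed

lemma int_basis_int_span: "b \<in> S \<Longrightarrow> int_basis b \<in> int_span S"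
  unfolding int_span_def
  by (rule image_eqI[of _ _ "Poly_Mapping.single b 1"]) (auto simp: single_supported)

lemma int_span_mono: "v \<in> int_span S \<Longrightarrow> S \<subseteq> S' \<Longrightarrow> v \<in> int_span S'"
  by (auto simp: int_span_def supported_def)

lemma smul_of_int_mem: "add_subgroup A \<Longrightarrow> v \<in> A \<Longrightarrow> smul (of_int z) v \<in> A"
  for v :: "'b \<Rightarrow>\<^sub>0 'k::comm_ring_1"
  by (rule smul.add_subgroup_scale_of_int)

lemma int_span_subset:
  assumes A: "add_subgroup A" and "\<And>b. b \<in> S \<Longrightarrow> int_basis b \<in> A"
  shows "int_span S \<subseteq> A"
proof
  fix v
  assume "v \<in> int_span S"
  then obtain c where c: "v = int_vector c" "c \<in> supported S" by (auto simp: int_span_def)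
  then show "v \<in> A"
    using assms(2) unfolding c(1) int_vector_def supported_def
    by (intro add_subgroup_sum[OF A] smul_of_int_mem[OF A]) auto
qed

text \<open>
  Linear operators can be tested on basis elements even if the target is only an additive subgroup.
\<close>

lemma lin_int_span:
  assumes "lin T" "add_subgroup A" "\<And>b. b \<in> S \<Longrightarrow> T (int_basis b) \<in> A" "v \<in> int_span S"
  shows "T v \<in> A"
proof -
  have "add_subgroup {v. T v \<in> A}"
    using assms(2) by (auto simp: add_subgroup_def lin_0[OF assms(1)] lin_diff[OF assms(1)])
  then show ?thesis using int_span_subset[of "{v. T v \<in> A}" S] assms by auto
qed

abbreviation integral_form :: "('n::{finite,linorder}, complex) fock set" where
  "integral_form \<equiv> int_span UNIV"

lemma integral_form_eq: "integral_form = range int_vector"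
  by (simp add: int_span_def supported_def)

lemma lat_induct [case_names zero simple_root add uminus]:
  assumes "P 0" "\<And>i. P (simple_root i)" "\<And>\<alpha> \<beta>. P \<alpha> \<Longrightarrow> P \<beta> \<Longrightarrow> P (\<alpha> + \<beta>)" "\<And>\<alpha>. P \<alpha> \<Longrightarrow> P (- \<alpha>)"
  shows "P (\<alpha> :: ('n::finite) lat)"
proof -
  have nat: "P (Poly_Mapping.single i (int n))" for i n
  proof (induction n)
    case (Suc n)
    then have "P (simple_root i + Poly_Mapping.single i (int n))" by (intro assms)
    then show ?case by (simp add: simple_root_def flip: single_add)
  qed (simp add: assms)
  have single: "P (Poly_Mapping.single i z)" for i z
  proof (cases z rule: int_cases2)
    case (nonpos n)
    then show ?thesis using assms(4)[OF nat[of i n]] by (simp add: single_uminus)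
  qed (simp add: nat)
  have "P (\<Sum>i\<in>A. Poly_Mapping.single i (f i))" for A f
    by (induction A rule: infinite_finite_induct) (auto intro: assms single)
  moreover have "\<alpha> = (\<Sum>i\<in>UNIV. Poly_Mapping.single i (Poly_Mapping.lookup \<alpha> i))"
    by (rule poly_mapping_eqI) (simp add: lookup_sum lookup_single when_def)
  ultimately show ?thesis by metis
qed

lemma s_op_integral_form: "v \<in> integral_form \<Longrightarrow> s_op \<alpha> m v \<in> integral_form"
proof (induction \<alpha> arbitrary: m v rule: lat_induct)
  case zero
  then show ?case by (simp add: s_op_zero_root add_subgroup_0 add_subgroup_int_span)
next
  case (simple_root i)
  show ?case
  proof (rule lin_int_span[OF lin_s_op add_subgroup_int_span _ simple_root])
    fix b :: "'a fock_index"
    show "s_op (simple_root i) m (int_basis b) \<in> integral_form"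
      by (cases b) (simp add: s_op_int_basis int_basis_int_span)
  qed
next
  case (add \<alpha> \<beta>)
  then show ?case
    unfolding s_op_add by (intro add_subgroup_sum add_subgroup_int_span) auto
next
  case (uminus \<alpha>)
  show ?case
    using uminus.prems
  proof (induction m rule: less_induct)
    case (less m)
    show ?case
    proof (cases "m = 0")
      case False
      \<comment> \<open>The series of $-\alpha$ is inverse to that of $\alpha$.\<close>
      have "0 = s_op (\<alpha> + (- \<alpha>)) m v"
        using False by (simp add: s_op_zero_root)
      also have "\<dots> = s_op (- \<alpha>) m v + (\<Sum>i\<in>{..m} - {0}. s_op \<alpha> i (s_op (- \<alpha>) (m - i) v))"
        unfolding s_op_add by (subst sum.remove[of _ 0]) auto
      finally have "s_op (- \<alpha>) m v = - (\<Sum>i\<in>{..m} - {0}. s_op \<alpha> i (s_op (- \<alpha>) (m - i) v))"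
        by (simp add: eq_neg_iff_add_eq_0)
      also have "\<dots> \<in> integral_form"
        using less by (intro add_subgroup_uminus add_subgroup_sum add_subgroup_int_span uminus.IH) auto
      finally show ?thesis .
    qed (use less in simp)
  qed
qed

definition weight :: "('n \<times> nat) multiset \<Rightarrow> nat" where
  "weight M = (\<Sum>x\<in>#M. Suc (snd x))"

lemma weight_simps [simp]: "weight {#} = 0" "weight (add_mset x M) = Suc (snd x) + weight M"
  by (simp_all add: weight_def)

text \<open>
  Moving $r_{\alpha,j}$ through a product of $s_{\alpha_i,m}$ takes off a total weight of $j$.
\<close>

lemma r_op_int_basis:
  "r_op \<alpha> j (int_basis (M, \<gamma>)) \<in> int_span {b. weight (fst b) + j \<le> weight M \<and> snd b = \<gamma>}"
proof (induction M arbitrary: j)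
  case empty
  show ?case
    by (cases "j = 0")
       (auto simp: r_op_iota_e int_basis_empty add_subgroup_0 add_subgroup_int_span
         intro: int_basis_int_span[of "({#}, \<gamma>)", unfolded int_basis_empty])
next
  case (add x M)
  obtain i k where x: "x = (i, k)" by force
  let ?S = "\<lambda>j M. {b. weight (fst b) + j \<le> weight M \<and> snd b = \<gamma>}"
  have *: "s_op (simple_root i) (Suc k - l) (r_op \<alpha> (j - l) (int_basis (M, \<gamma>))) \<in> int_span (?S j (add_mset x M))"
    if "l \<le> j" "l \<le> Suc k" for l
  proof (rule lin_int_span[OF lin_s_op add_subgroup_int_span _ add.IH])
    fix b :: "'a fock_index"
    assume "b \<in> ?S (j - l) M"
    moreover obtain N \<beta> where b: "b = (N, \<beta>)" by force
    ultimately show "s_op (simple_root i) (Suc k - l) (int_basis b) \<in> int_span (?S j (add_mset x M))"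
      using that unfolding b s_op_int_basis
      by (intro int_basis_int_span) (auto simp: x)
  qed
  then show ?case
    unfolding x int_basis_add_mset r_op_s_op
  proof (intro add_subgroup_sum[OF add_subgroup_int_span])
    fix l
    assume "l \<in> {..j}"
    then show "(if l \<le> Suc k then smul (of_int ((-1) ^ l * int_binomial (lat_form \<alpha> (simple_root i)) l))
        (s_op (simple_root i) (Suc k - l) (r_op \<alpha> (j - l) (int_basis (M, \<gamma>)))) else 0)
        \<in> int_span (?S j (add_mset (i, k) M))"
      using *[of l] unfolding x
      by (cases "l \<le> Suc k")
         (simp_all only: if_True if_False smul_of_int_mem add_subgroup_0 add_subgroup_int_span atMost_iff)
  qed
qed

lemma r_op_integral_form: "v \<in> integral_form \<Longrightarrow> r_op \<alpha> m v \<in> integral_form"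
proof (rule lin_int_span[OF lin_r_op add_subgroup_int_span])
  fix b :: "'a fock_index"
  show "r_op \<alpha> m (int_basis b) \<in> integral_form"
    using r_op_int_basis[of \<alpha> m "fst b" "snd b"] by (auto intro: int_span_mono)
qed

lemma e_op_int_basis:
  "e_op \<epsilon> \<alpha> (int_basis (M, \<beta>)) = smul (of_int (\<epsilon> \<alpha> \<beta>)) (int_basis (M, \<alpha> + \<beta>))"
proof (induction M)
  case (add x M)
  then show ?case
    by (cases x) (simp add: int_basis_add_mset e_op_s_op lin_smul[OF lin_s_op])
qed (simp add: int_basis_empty e_op_iota_e)

lemma e_op_integral_form: "v \<in> integral_form \<Longrightarrow> e_op \<epsilon> \<alpha> v \<in> integral_form"
proof (rule lin_int_span[OF lin_e_op add_subgroup_int_span])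
  fix b :: "'a fock_index"
  show "e_op \<epsilon> \<alpha> (int_basis b) \<in> integral_form"
    by (cases b) (auto simp: e_op_int_basis intro: smul_of_int_mem add_subgroup_int_span int_basis_int_span)
qed

lemma lin_lattice_vertex_op: "lin (lattice_vertex_op \<epsilon> \<alpha> m)"
  by (simp add: lattice_vertex_op_def)

lemma lattice_vertex_op_integral_form:
  "v \<in> integral_form \<Longrightarrow> lattice_vertex_op \<epsilon> \<alpha> m v \<in> integral_form"
proof (rule lin_int_span[OF lin_lattice_vertex_op add_subgroup_int_span])
  fix b :: "'a fock_index"
  obtain M \<beta> where b: "b = (M, \<beta>)" by force
  obtain N where N: "lattice_vertex_op \<epsilon> \<alpha> m (int_basis b) =
    (\<Sum>j<N. let i = int j - lat_form \<alpha> \<beta> - m - 1 in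
       if i \<ge> 0 then s_op \<alpha> (nat i) (r_op \<alpha> j (e_op \<epsilon> \<alpha> (int_basis b))) else 0)"
    using lattice_vertex_op_component[OF int_basis_component[of M \<beta>]] unfolding b by blast
  show "lattice_vertex_op \<epsilon> \<alpha> m (int_basis b) \<in> integral_form"
    unfolding N
    by (auto simp: Let_def add_subgroup_0 add_subgroup_int_span int_basis_int_span
        intro!: add_subgroup_sum s_op_integral_form r_op_integral_form e_op_integral_form)
qed

text \<open>
  In the expansion of a mode of $\iota(e_{\alpha_i})$ at $s_N \iota(e_{\gamma-\alpha_i})$, the term
  without annihilation operators is, up to sign, a given basis element $s_{\alpha_i,k} s_N \iota(e_\gamma)$.
  In the other terms the weight of $N$ is reduced before a single $s_{\alpha_i,k+j}$ is applied,
  whence an induction on the weight of $N$ alone, for all $k$.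
\<close>

lemma integral_form_generated:
  fixes A :: "('n::{finite,linorder}, complex) fock set"
  assumes cocycle: "lat_cocycle \<epsilon>" and A: "add_subgroup A" and iota: "\<And>\<gamma>. iota_e \<gamma> \<in> A"
    and modes: "\<And>\<alpha> m v. v \<in> integral_form \<Longrightarrow> v \<in> A \<Longrightarrow> lattice_vertex_op \<epsilon> \<alpha> m v \<in> A"
  shows "integral_form \<subseteq> A"
proof -
  have step: "s_op (simple_root i) k (int_basis (N, \<gamma>)) \<in> A" for N \<gamma> i k
  proof (induction "weight N" arbitrary: N \<gamma> i k rule: less_induct)
    case less
    have N_in: "int_basis (N, \<gamma>) \<in> A" for \<gamma>
    proof (cases N)
      case (add x N')
      then show ?thesis
        using less[of N' "fst x" "Suc (snd x)" \<gamma>] by (cases x) (simp add: int_basis_add_mset)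
    qed (simp add: int_basis_empty iota)
    let ?\<alpha> = "simple_root i"
    define \<beta> where "\<beta> = \<gamma> - ?\<alpha>"
    \<comment> \<open>For this mode the term with $r_{\alpha,j}$ contains $s_{\alpha,j+k}$.\<close>
    define m where "m = - lat_form ?\<alpha> \<beta> - int k - 1"
    define e where "e = \<epsilon> ?\<alpha> \<beta>"
    have e: "e \<in> {1, -1}" using cocycle by (simp add: lat_cocycle_def e_def)
    obtain K where "\<forall>K'\<ge>K. lattice_vertex_op \<epsilon> ?\<alpha> m (int_basis (N, \<beta>)) =
      (\<Sum>j<K'. let i' = int j - lat_form ?\<alpha> \<beta> - m - 1 in
       if i' \<ge> 0 then s_op ?\<alpha> (nat i') (r_op ?\<alpha> j (e_op \<epsilon> ?\<alpha> (int_basis (N, \<beta>)))) else 0)"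
      using lattice_vertex_op_component[OF int_basis_component[of N \<beta>]] by blast
    then have "lattice_vertex_op \<epsilon> ?\<alpha> m (int_basis (N, \<beta>)) =
      (\<Sum>j<Suc K. let i' = int j - lat_form ?\<alpha> \<beta> - m - 1 in
       if i' \<ge> 0 then s_op ?\<alpha> (nat i') (r_op ?\<alpha> j (e_op \<epsilon> ?\<alpha> (int_basis (N, \<beta>)))) else 0)"
      by (elim allE[of _ "Suc K"]) (simp del: sum.lessThan_Suc)
    also have "\<dots> = (\<Sum>j<Suc K. smul (of_int e) (s_op ?\<alpha> (j + k) (r_op ?\<alpha> j (int_basis (N, \<gamma>)))))"
    proof (intro sum.cong refl)
      fix j
      have "int j - lat_form ?\<alpha> \<beta> - m - 1 = int (j + k)" by (simp add: m_def)
      moreover have "e_op \<epsilon> ?\<alpha> (int_basis (N, \<beta>)) = smul (of_int e) (int_basis (N, \<gamma>))"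
        by (simp add: e_op_int_basis e_def \<beta>_def)
      ultimately show "(let i' = int j - lat_form ?\<alpha> \<beta> - m - 1 in
          if i' \<ge> 0 then s_op ?\<alpha> (nat i') (r_op ?\<alpha> j (e_op \<epsilon> ?\<alpha> (int_basis (N, \<beta>)))) else 0)
          = smul (of_int e) (s_op ?\<alpha> (j + k) (r_op ?\<alpha> j (int_basis (N, \<gamma>))))"
        by (simp only: Let_def nat_int of_nat_0_le_iff if_True lin_smul[OF lin_r_op] lin_smul[OF lin_s_op])
    qed
    also have "\<dots> = smul (of_int e) (s_op ?\<alpha> k (int_basis (N, \<gamma>))) +
        (\<Sum>j<K. smul (of_int e) (s_op ?\<alpha> (Suc j + k) (r_op ?\<alpha> (Suc j) (int_basis (N, \<gamma>)))))"
      by (subst sum.lessThan_Suc_shift) simp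
    finally have "smul (of_int e) (s_op ?\<alpha> k (int_basis (N, \<gamma>))) =
        lattice_vertex_op \<epsilon> ?\<alpha> m (int_basis (N, \<beta>)) -
        (\<Sum>j<K. smul (of_int e) (s_op ?\<alpha> (Suc j + k) (r_op ?\<alpha> (Suc j) (int_basis (N, \<gamma>)))))"
      by simp
    also have "\<dots> \<in> A"
    proof (intro add_subgroup_diff[OF A] add_subgroup_sum[OF A] smul_of_int_mem[OF A])
      show "lattice_vertex_op \<epsilon> ?\<alpha> m (int_basis (N, \<beta>)) \<in> A"
        by (intro modes N_in int_basis_int_span) auto
    next
      fix j
      show "s_op ?\<alpha> (Suc j + k) (r_op ?\<alpha> (Suc j) (int_basis (N, \<gamma>))) \<in> A"
      proof (rule lin_int_span[OF lin_s_op A _ r_op_int_basis])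
        fix b :: "'n fock_index"
        assume "b \<in> {b. weight (fst b) + Suc j \<le> weight N \<and> snd b = \<gamma>}"
        then show "s_op ?\<alpha> (Suc j + k) (int_basis b) \<in> A"
          using less[of "fst b" i "Suc j + k" "snd b"] by (cases b) simp
      qed
    qed
    finally have "smul (of_int e) (s_op ?\<alpha> k (int_basis (N, \<gamma>))) \<in> A" .
    from smul_of_int_mem[OF A this, of e] show ?case using e by auto
  qed
  show ?thesis
    using step[of _ 0] by (intro int_span_subset[OF A]) auto
qed

section \<open>Integrality of the vertex algebra structure\<close>

locale lattice_vertex_algebra_structure =
  fixes \<epsilon> :: "('n::{finite,linorder}) lat \<Rightarrow> 'n lat \<Rightarrow> int"
    and Y :: "('n, complex) fock \<Rightarrow> int \<Rightarrow> ('n, complex) fock \<Rightarrow> ('n, complex) fock"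
  assumes cocycle: "lat_cocycle \<epsilon>" and lattice_structure: "lattice_vertex_algebra \<epsilon> Y"
begin

sublocale vertex_algebra smul "iota_e 0" Y
  using lattice_structure by (simp add: lattice_vertex_algebra_def)

lemma Y_iota_e: "Y (iota_e \<alpha>) m = lattice_vertex_op \<epsilon> \<alpha> m"
  and Y_heis: "Y (heis h (-1) (iota_e 0)) m = heis h m"
  using lattice_structure by (simp_all add: lattice_vertex_algebra_def)

text \<open>
  The modes of the $\iota(e_\alpha)$ preserve the integral form and generate it from $\mathbf 1$, and
  products are reduced to their factors by \<open>modes_of_product_preserve\<close>.
\<close>

lemma Y_integral_form:
  assumes "u \<in> integral_form" "v \<in> integral_form"
  shows "Y u m v \<in> integral_form"
proof -
  let ?A = "{u. \<forall>m. \<forall>v\<in>integral_form. Y u m v \<in> integral_form}"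
  have "integral_form \<subseteq> ?A"
  proof (rule integral_form_generated[OF cocycle])
    show "add_subgroup ?A"
      using add_subgroup_int_span[of UNIV]
      by (auto simp: add_subgroup_def Y_diff_left)
    show iota: "iota_e \<gamma> \<in> ?A" for \<gamma>
      by (auto simp: Y_iota_e lattice_vertex_op_integral_form)
    show "lattice_vertex_op \<epsilon> \<alpha> m v \<in> ?A" if "v \<in> ?A" for \<alpha> m v
      using that iota[of \<alpha>] modes_of_product_preserve[OF add_subgroup_int_span[of UNIV]]
      unfolding Y_iota_e[symmetric] by blast
  qed
  then show ?thesis using assms by blast
qed

end

section \<open>Base change\<close>

lemma lookup_map_of_int [simp]:
  "Poly_Mapping.lookup (Poly_Mapping.map of_int c :: 'b \<Rightarrow>\<^sub>0 'k::ring_1) b = of_int (Poly_Mapping.lookup c b)"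
  by (simp add: Poly_Mapping.map.rep_eq when_def)

lemma base_change_int_vector: "base_change (int_vector c) = Poly_Mapping.map of_int c"
  by (simp add: base_change_def)

lemma base_change_diff:
  assumes "u \<in> integral_form" "v \<in> integral_form"
  shows "base_change (u - v) = base_change u - base_change v"
  using assms
  by (auto simp: integral_form_eq base_change_int_vector lookup_minus simp flip: int_vector_diff
      intro!: poly_mapping_eqI)

lemma base_change_0 [simp]: "base_change 0 = 0"
  using base_change_diff[of 0 0] by (simp add: add_subgroup_0 add_subgroup_int_span)

lemma base_change_add:
  assumes "u \<in> integral_form" "v \<in> integral_form"
  shows "base_change (u + v) = base_change u + base_change v"
  using assms
  by (auto simp: integral_form_eq base_change_int_vector lookup_add simp flip: int_vector_add
      intro!: poly_mapping_eqI)

lemma base_change_sum: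
  "(\<And>i. i \<in> I \<Longrightarrow> f i \<in> integral_form) \<Longrightarrow> base_change (sum f I) = (\<Sum>i\<in>I. base_change (f i))"
  by (induction I rule: infinite_finite_induct)
     (auto simp: base_change_add add_subgroup_sum add_subgroup_int_span)

lemma int_vector_smul: "int_vector (smul z c) = smul (of_int z) (int_vector c)"
  by (subst int_vector_superset[where A = "Poly_Mapping.keys c"])
     (auto simp: int_vector_def in_keys_iff smul.scale_sum_right)

lemma base_change_smul:
  assumes "v \<in> integral_form"
  shows "base_change (smul (of_int z) v) = smul (of_int z) (base_change v)"
  using assms
  by (auto simp: integral_form_eq base_change_int_vector simp flip: int_vector_smul
      intro!: poly_mapping_eqI)

lemma int_basis_integral_form [simp]: "int_basis b \<in> integral_form"
  by (simp add: int_basis_int_span)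

lemma base_change_int_basis [simp]: "base_change (int_basis b) = Poly_Mapping.single b 1"
  using base_change_int_vector[of "Poly_Mapping.single b 1"]
  by (auto intro!: poly_mapping_eqI simp: lookup_single when_def)

lemma iota_e_integral_form [simp]: "iota_e \<alpha> \<in> integral_form"
  using int_basis_integral_form[of "({#}, \<alpha>)"] by (simp add: int_basis_empty)

lemma base_change_iota_e [simp]: "base_change (iota_e \<alpha>) = iota_e \<alpha>"
  using base_change_int_basis[of "({#}, \<alpha>)"] by (simp add: int_basis_empty iota_e_def)

lemma lookup_base_change_vac:
  assumes "v \<in> integral_form" "Poly_Mapping.lookup v ({#}, 0) = 0"
  shows "Poly_Mapping.lookup (base_change v) ({#}, 0) = 0"
  using assms by (auto simp: integral_form_eq base_change_int_vector lookup_int_vector_vac)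

lemma lin_base_change_op: "lin (base_change_op T)"
  by (simp add: base_change_op_def)

lemma base_change_op_base_change:
  fixes T :: "('n::{finite,linorder}, complex) fock \<Rightarrow> ('n, complex) fock"
  assumes lin: "lin T" and T: "\<And>v. v \<in> integral_form \<Longrightarrow> T v \<in> integral_form"
    and v: "v \<in> integral_form"
  shows "base_change_op T (base_change v) = (base_change (T v) :: ('n, 'f::field) fock)"
proof -
  let ?A = "{v \<in> integral_form. base_change_op T (base_change v) = (base_change (T v) :: ('n, 'f) fock)}"
  have "integral_form \<subseteq> ?A"
  proof (rule int_span_subset)
    show "add_subgroup ?A"
      using add_subgroup_int_span[of UNIV]
      by (auto simp: add_subgroup_def base_change_diff lin_diff[OF lin] T lin_0[OF lin]
          lin_diff[OF lin_base_change_op] lin_0[OF lin_base_change_op])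
  qed (simp add: base_change_op_def)
  then show ?thesis using v by blast
qed

lemma lin_base_change_Y_left: "lin (\<lambda>u. base_change_Y Y u m v)"
  by (simp add: base_change_Y_def)

lemma lin_base_change_Y_right: "lin (base_change_Y Y u m)"
  unfolding base_change_Y_def lin_ext_def[of _ u]
  by (intro lin_pointwise_sum lin_scaled lin_lin_ext)

context lattice_vertex_algebra_structure
begin

lemma base_change_Y_base_change:
  assumes u: "u \<in> integral_form" and v: "v \<in> integral_form"
  shows "base_change_Y Y (base_change u) m (base_change v) = (base_change (Y u m v) :: ('n, 'f::field) fock)"
proof -
  note ag = add_subgroup_int_span[of UNIV]
  let ?A = "\<lambda>u. {v \<in> integral_form. base_change_Y Y (base_change u) m (base_change v) = (base_change (Y u m v) :: ('n, 'f) fock)}"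
  have basis: "integral_form \<subseteq> ?A (int_basis b)" for b
  proof (rule int_span_subset)
    show "add_subgroup (?A (int_basis b))"
      using ag
      by (auto simp: add_subgroup_def base_change_diff lin_diff[OF lin_base_change_Y_right]
          lin_0[OF lin_base_change_Y_right] Y_diff_right Y_integral_form)
  qed (simp add: base_change_Y_def)
  let ?A' = "{u \<in> integral_form. base_change_Y Y (base_change u) m (base_change v) = (base_change (Y u m v) :: ('n, 'f) fock)}"
  have "integral_form \<subseteq> ?A'"
  proof (rule int_span_subset)
    show "add_subgroup ?A'"
      using ag v
      by (auto simp: add_subgroup_def base_change_diff lin_diff[OF lin_base_change_Y_left]
          lin_0[OF lin_base_change_Y_left] Y_diff_left Y_integral_form)
  qed (use basis v in auto)
  then show ?thesis using u by blast
qed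

lemma base_change_Y_single:
  "base_change_Y Y (Poly_Mapping.single b 1) m (Poly_Mapping.single b' 1) =
     base_change (Y (int_basis b) m (int_basis b'))"
  using base_change_Y_base_change[of "int_basis b" "int_basis b'" m] by simp

lemma jacobi_defect_base_change:
  assumes "u \<in> integral_form" "v \<in> integral_form" "w \<in> integral_form"
  shows "jacobi_defect smul (base_change_Y Y) p q r N (base_change u) (base_change v) (base_change w)
    = base_change (jacobi_defect smul Y p q r N u v w)"
  unfolding jacobi_defect_def
  by (simp only: assms add_subgroup_int_span base_change_Y_base_change Y_integral_form base_change_diff base_change_sum
      base_change_smul add_subgroup_sum add_subgroup_diff smul_of_int_mem)

lemma base_change_truncation: "\<exists>N. \<forall>m\<ge>N. base_change_Y Y u m v = 0"
proof (induction u arbitrary: v rule: fock_induct)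
  case (add u u')
  then obtain N N' where "\<forall>m\<ge>N. base_change_Y Y u m v = 0" "\<forall>m\<ge>N'. base_change_Y Y u' m v = 0"
    by meson
  then show ?case
    by (intro exI[of _ "max N N'"]) (auto simp: lin_add[OF lin_base_change_Y_left])
next
  case (scale c u)
  then obtain N where "\<forall>m\<ge>N. base_change_Y Y u m v = 0" by meson
  then show ?case
    by (intro exI[of _ N]) (auto simp: lin_smul[OF lin_base_change_Y_left])
next
  case (basis b)
  show ?case
  proof (induction v rule: fock_induct)
    case (add v v')
    then obtain N N' where "\<forall>m\<ge>N. base_change_Y Y (Poly_Mapping.single b 1) m v = 0"
      "\<forall>m\<ge>N'. base_change_Y Y (Poly_Mapping.single b 1) m v' = 0"
      by meson
    then show ?case
      by (intro exI[of _ "max N N'"]) (auto simp: lin_add[OF lin_base_change_Y_right])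
  next
    case (scale c v)
    then obtain N where "\<forall>m\<ge>N. base_change_Y Y (Poly_Mapping.single b 1) m v = 0" by meson
    then show ?case
      by (intro exI[of _ N]) (auto simp: lin_smul[OF lin_base_change_Y_right])
  next
    case (basis b')
    obtain N where "\<forall>m\<ge>N. Y (int_basis b) m (int_basis b') = 0" using truncation by blast
    then show ?case by (intro exI[of _ N]) (simp add: base_change_Y_single)
  qed (simp add: lin_0[OF lin_base_change_Y_right])
qed (simp add: lin_0[OF lin_base_change_Y_left])

lemma eventually_jacobi_defect_base_change:
  fixes u v w :: "('n, 'f::field) fock"
  shows "\<forall>\<^sub>F N in sequentially. jacobi_defect smul (base_change_Y Y) p q r N u v w = 0"
proof -
  let ?J = "\<lambda>N. jacobi_defect smul (base_change_Y Y :: ('n, 'f) fock \<Rightarrow> _) p q r N"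
  have lin_minus: "lin (\<lambda>x. S x - T x)" if "lin S" "lin T"
    for S T :: "('n, 'f) fock \<Rightarrow> ('n, 'f) fock"
    using lin_plus[OF that(1) lin_neg[OF that(2)]] by simp
  have lin1: "lin (\<lambda>u. ?J N u v w)" for N v w
    unfolding jacobi_defect_def
    by (intro lin_minus lin_pointwise_sum lin_scaled lin_base_change_Y_left lin_base_change_Y_right
        lin_compose[OF lin_base_change_Y_right lin_base_change_Y_left]
        lin_compose[OF lin_base_change_Y_left lin_base_change_Y_left])
  have lin2: "lin (\<lambda>v. ?J N u v w)" for N u w
    unfolding jacobi_defect_def
    by (intro lin_minus lin_pointwise_sum lin_scaled lin_base_change_Y_left lin_base_change_Y_right
        lin_compose[OF lin_base_change_Y_right lin_base_change_Y_left]
        lin_compose[OF lin_base_change_Y_left lin_base_change_Y_right])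
  have lin3: "lin (\<lambda>w. ?J N u v w)" for N u v
    unfolding jacobi_defect_def
    by (intro lin_minus lin_pointwise_sum lin_scaled lin_base_change_Y_right
        lin_compose[OF lin_base_change_Y_right lin_base_change_Y_right])
  have reduce: "\<forall>\<^sub>F N in sequentially. T N x = 0"
    if T: "\<And>N. lin (T N)" and "\<And>b. \<forall>\<^sub>F N in sequentially. T N (Poly_Mapping.single b 1) = 0"
    for T :: "nat \<Rightarrow> ('n, 'f) fock \<Rightarrow> ('n, 'f) fock" and x
  proof (induction x rule: fock_induct)
    case (add x y)
    then show ?case by eventually_elim (simp add: lin_add[OF T])
  next
    case (scale c x)
    then show ?case by eventually_elim (simp add: lin_smul[OF T])
  qed (simp_all add: lin_0[OF T] that(2))
  show ?thesis
  proof (rule reduce[OF lin1], rule reduce[OF lin2], rule reduce[OF lin3])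
    fix a b c :: "'n fock_index"
    have "\<forall>\<^sub>F N in sequentially. jacobi_defect smul Y p q r N (int_basis a) (int_basis b) (int_basis c) = 0"
      using eventually_jacobi_defect[of Y smul p q r "int_basis a" "int_basis b" "int_basis c"]
        truncation jacobi[of r "int_basis a" p "int_basis b" q "int_basis c"]
      by simp
    then show "\<forall>\<^sub>F N in sequentially. ?J N (Poly_Mapping.single a 1) (Poly_Mapping.single b 1) (Poly_Mapping.single c 1) = 0"
    proof eventually_elim
      case (elim N)
      then show ?case
        using jacobi_defect_base_change[of "int_basis a" "int_basis b" "int_basis c" p q r N] by simp
    qed
  qed
qed

text \<open>
  The structure constants on the integral basis are integers, and all axioms are multilinear with
  integer coefficients.  They hold on the reductions of integral vectors, which span.
\<close>

theorem vertex_algebra_base_change: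
  "vertex_algebra (smul :: 'f::field \<Rightarrow> _) (iota_e 0 :: ('n, 'f) fock) (base_change_Y Y)"
proof -
  let ?Y = "base_change_Y Y :: ('n, 'f) fock \<Rightarrow> _"
  interpret F: vector_space "smul :: 'f \<Rightarrow> ('n, 'f) fock \<Rightarrow> _" by (rule vector_space_smul)
  show ?thesis
  proof unfold_locales
    fix u u' v v' :: "('n, 'f) fock" and c m
    show "?Y (u + u') m v = ?Y u m v + ?Y u' m v" by (rule lin_add[OF lin_base_change_Y_left])
    show "?Y (smul c u) m v = smul c (?Y u m v)" by (rule lin_smul[OF lin_base_change_Y_left])
    show "?Y u m (v + v') = ?Y u m v + ?Y u m v'" by (rule lin_add[OF lin_base_change_Y_right])
    show "?Y u m (smul c v) = smul c (?Y u m v)" by (rule lin_smul[OF lin_base_change_Y_right])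
    show "\<exists>N. \<forall>m\<ge>N. ?Y u m v = 0" by (rule base_change_truncation)
    have "?Y (iota_e 0) m v = smul (if m = -1 then 1 else 0) v"
    proof (induction v rule: fock_induct)
      case (basis b)
      show ?case
        using base_change_Y_base_change[of "iota_e 0" "int_basis b" m, where ?'f = 'f]
        by (simp add: vacuum del: smul_single)
    qed (simp_all add: lin_0[OF lin_base_change_Y_right] lin_add[OF lin_base_change_Y_right]
        lin_smul[OF lin_base_change_Y_right] smul.scale_right_distrib mult.commute)
    then show "?Y (iota_e 0) m v = (if m = -1 then v else 0)" by simp
    show "?Y v (-1) (iota_e 0) = v"
    proof (induction v rule: fock_induct)
      case (basis b)
      show ?case
        using base_change_Y_base_change[of "int_basis b" "iota_e 0" "-1", where ?'f = 'f]
        by (simp add: creation_constant)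
    qed (simp_all add: lin_0[OF lin_base_change_Y_left] lin_add[OF lin_base_change_Y_left]
        lin_smul[OF lin_base_change_Y_left])
    assume m: "m \<ge> 0"
    show "?Y v m (iota_e 0) = 0"
    proof (induction v rule: fock_induct)
      case (basis b)
      show ?case
        using base_change_Y_base_change[of "int_basis b" "iota_e 0" m, where ?'f = 'f] m
        by (simp add: creation_regular)
    qed (simp_all add: lin_0[OF lin_base_change_Y_left] lin_add[OF lin_base_change_Y_left]
        lin_smul[OF lin_base_change_Y_left])
  next
    fix p q r and u v w :: "('n, 'f) fock"
    have "\<forall>\<^sub>F N in sequentially. jacobi_defect smul ?Y p q r N u v w =
     Sum_any (\<lambda>i::nat. smul ((-1) ^ i * of_int (int_binomial r i))
          (?Y u (p + r - int i) (?Y v (q + int i) w)))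
       - Sum_any (\<lambda>i::nat. smul ((if even r then 1 else -1) * (-1) ^ i * of_int (int_binomial r i))
          (?Y v (q + r - int i) (?Y u (p + int i) w)))
       - Sum_any (\<lambda>i::nat. smul (of_int (int_binomial p i))
          (?Y (?Y u (r + int i) v) (p + q - int i) w))" (is "\<forall>\<^sub>F N in sequentially. _ = ?S")
      by (rule eventually_jacobi_defect)
         (simp_all add: base_change_truncation lin_0[OF lin_base_change_Y_left]
           lin_0[OF lin_base_change_Y_right])
    with eventually_jacobi_defect_base_change[of p q r u v w]
    have "\<forall>\<^sub>F N in sequentially. ?S = 0"
      by eventually_elim simp
    then have "?S = 0" by simp
    then show "Sum_any (\<lambda>i::nat. smul ((-1) ^ i * of_int (int_binomial r i))
          (?Y u (p + r - int i) (?Y v (q + int i) w)))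
       - Sum_any (\<lambda>i::nat. smul ((if even r then 1 else -1) * (-1) ^ i * of_int (int_binomial r i))
          (?Y v (q + r - int i) (?Y u (p + int i) w)))
       = Sum_any (\<lambda>i::nat. smul (of_int (int_binomial p i))
          (?Y (?Y u (r + int i) v) (p + q - int i) w))"
      by simp
  qed
qed

text \<open>
  The integral vectors whose reductions lie in $T$ form an additive subgroup, to which \<open>integral_form_generated\<close> applies.
\<close>

lemma base_change_generated:
  fixes T :: "('n, 'f::field) fock set"
  assumes T: "smul.subspace T" and vac: "iota_e 0 \<in> T"
    and modes: "\<And>\<alpha> m v. v \<in> T \<Longrightarrow> base_change_Y Y (iota_e \<alpha>) m v \<in> T"
  shows "T = UNIV"
proof -
  interpret F: vertex_algebra "smul :: 'f \<Rightarrow> _" "iota_e 0 :: ('n, 'f) fock" "base_change_Y Y"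
    by (rule vertex_algebra_base_change)
  let ?A = "{v \<in> integral_form. base_change v \<in> T}"
  have "integral_form \<subseteq> ?A"
  proof (rule integral_form_generated[OF cocycle])
    show "add_subgroup ?A"
      using add_subgroup_int_span[of UNIV] smul.subspace_imp_add_subgroup[OF T]
      by (auto simp: add_subgroup_def base_change_diff)
    show "iota_e \<gamma> \<in> ?A" for \<gamma>
      using modes[OF vac, of \<gamma> "-1"] by (simp add: F.creation_constant)
    show "lattice_vertex_op \<epsilon> \<alpha> m v \<in> ?A" if "v \<in> integral_form" "v \<in> ?A" for \<alpha> m v
      using modes[of "base_change v" \<alpha> m] that
        base_change_Y_base_change[of "iota_e \<alpha>" v m, where ?'f = 'f]
      by (simp add: lattice_vertex_op_integral_form Y_iota_e)
  qed
  then have "base_change (int_basis b) \<in> T" for b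
    using int_basis_integral_form[of b] by blast
  then have basis: "Poly_Mapping.single b 1 \<in> T" for b
    by simp
  have "v \<in> T" for v
    by (induction v rule: fock_induct)
       (auto simp: basis smul.subspace_0[OF T] intro: smul.subspace_add[OF T] smul.subspace_scale[OF T])
  then show ?thesis by blast
qed

end

section \<open>The reductions of the operators\<close>

abbreviation s_red :: "('n::{finite,linorder}) lat \<Rightarrow> nat \<Rightarrow> ('n, 'f::field) fock \<Rightarrow> ('n, 'f) fock" where
  "s_red \<alpha> m \<equiv> base_change_op (s_op \<alpha> m)"

abbreviation r_red :: "('n::{finite,linorder}) lat \<Rightarrow> nat \<Rightarrow> ('n, 'f::field) fock \<Rightarrow> ('n, 'f) fock" where
  "r_red \<alpha> m \<equiv> base_change_op (r_op \<alpha> m)"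

abbreviation e_red :: "(('n::{finite,linorder}) lat \<Rightarrow> 'n lat \<Rightarrow> int) \<Rightarrow> 'n lat \<Rightarrow> ('n, 'f::field) fock \<Rightarrow> ('n, 'f) fock" where
  "e_red \<epsilon> \<alpha> \<equiv> base_change_op (e_op \<epsilon> \<alpha>)"

lemma s_red_base_change: "v \<in> integral_form \<Longrightarrow> s_red \<alpha> m (base_change v) = base_change (s_op \<alpha> m v)"
  and r_red_base_change: "v \<in> integral_form \<Longrightarrow> r_red \<alpha> m (base_change v) = base_change (r_op \<alpha> m v)"
  and e_red_base_change: "v \<in> integral_form \<Longrightarrow> e_red \<epsilon> \<alpha> (base_change v) = base_change (e_op \<epsilon> \<alpha> v)"
  by (simp_all add: base_change_op_base_change lin_s_op lin_r_op lin_e_op s_op_integral_form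
      r_op_integral_form e_op_integral_form)

lemma base_change_op_single:
  "base_change_op T (Poly_Mapping.single b 1) = base_change (T (int_basis b))"
  by (simp add: base_change_op_def)

lemma lin_eqI_base_change:
  assumes "lin S" "lin T" "\<And>v. v \<in> integral_form \<Longrightarrow> S (base_change v) = T (base_change v)"
  shows "S v = T v"
proof (rule lin_eqI[OF assms(1,2)])
  fix b
  show "S (Poly_Mapping.single b 1) = T (Poly_Mapping.single b 1)"
    using assms(3)[OF int_basis_integral_form[of b]] by simp
qed

lemma s_red_single:
  "s_red (simple_root i) (Suc k) (Poly_Mapping.single (M, \<alpha>) 1) = Poly_Mapping.single (add_mset (i, k) M, \<alpha>) 1"
  by (simp add: base_change_op_single flip: int_basis_add_mset)

lemma r_red_iota_e: "r_red \<alpha> m (iota_e \<beta>) = (if m = 0 then iota_e \<beta> else 0)"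
  using base_change_op_single[of "r_op \<alpha> m" "({#}, \<beta>)"]
  by (cases "m = 0") (simp_all add: int_basis_empty r_op_iota_e flip: iota_e_def)

lemma e_red_single:
  "e_red \<epsilon> \<alpha> (Poly_Mapping.single (M, \<beta>) 1) = smul (of_int (\<epsilon> \<alpha> \<beta>)) (Poly_Mapping.single (M, \<alpha> + \<beta>) 1)"
  by (simp add: base_change_op_single e_op_int_basis base_change_smul)

lemma e_red_s_red: "e_red \<epsilon> \<alpha> (s_red \<beta> m v) = s_red \<beta> m (e_red \<epsilon> \<alpha> v)"
  and e_red_r_red: "e_red \<epsilon> \<alpha> (r_red \<beta> m v) = r_red \<beta> m (e_red \<epsilon> \<alpha> v)"
proof -
  show "e_red \<epsilon> \<alpha> (s_red \<beta> m v) = s_red \<beta> m (e_red \<epsilon> \<alpha> v)"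
    by (rule lin_eqI_base_change[where S = "\<lambda>v. e_red \<epsilon> \<alpha> (s_red \<beta> m v)" and v = v])
       (simp_all add: lin_compose[OF lin_base_change_op lin_base_change_op] s_red_base_change
         e_red_base_change s_op_integral_form e_op_integral_form e_op_s_op)
  show "e_red \<epsilon> \<alpha> (r_red \<beta> m v) = r_red \<beta> m (e_red \<epsilon> \<alpha> v)"
    by (rule lin_eqI_base_change[where S = "\<lambda>v. e_red \<epsilon> \<alpha> (r_red \<beta> m v)" and v = v])
       (simp_all add: lin_compose[OF lin_base_change_op lin_base_change_op] r_red_base_change
         e_red_base_change r_op_integral_form e_op_integral_form e_op_r_op)
qed

lemma base_change_int_span: "v \<in> int_span S \<Longrightarrow> base_change v \<in> supported S"
  by (auto simp: int_span_def base_change_int_vector supported_iff)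

lemma r_red_component:
  fixes v :: "('n::{finite,linorder}, 'f::field) fock"
  assumes "v \<in> component \<beta>"
  shows "r_red \<alpha> m v \<in> component \<beta>"
proof (rule lin_supported[OF lin_base_change_op _ assms])
  fix b :: "'n fock_index"
  assume "b \<in> {b. snd b = \<beta>}"
  then obtain M where b: "b = (M, \<beta>)" by (cases b) auto
  have "r_op \<alpha> m (int_basis b) \<in> int_span {b. snd b = \<beta>}"
    using r_op_int_basis[of \<alpha> m M \<beta>] unfolding b by (rule int_span_mono) auto
  then show "r_red \<alpha> m (Poly_Mapping.single b 1 :: ('n, 'f) fock) \<in> component \<beta>"
    unfolding base_change_op_single by (rule base_change_int_span)
qed

lemma e_red_component:
  fixes v :: "('n::{finite,linorder}, 'f::field) fock"
  assumes "v \<in> component \<beta>"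
  shows "e_red \<epsilon> \<alpha> v \<in> component (\<alpha> + \<beta>)"
proof (rule lin_supported[OF lin_base_change_op _ assms])
  fix b :: "'n fock_index"
  assume "b \<in> {b. snd b = \<beta>}"
  then obtain M where b: "b = (M, \<beta>)" by (cases b) auto
  show "e_red \<epsilon> \<alpha> (Poly_Mapping.single b 1 :: ('n, 'f) fock) \<in> component (\<alpha> + \<beta>)"
    by (simp add: b e_red_single single_supported)
qed

lemma r_red_locally_nilpotent: "\<exists>N. \<forall>m\<ge>N. r_red \<alpha> m v = 0"
proof (induction v rule: fock_induct)
  case (add u v)
  then obtain N N' where "\<forall>i\<ge>N. r_red \<alpha> i u = 0" "\<forall>i\<ge>N'. r_red \<alpha> i v = 0" by blast
  then show ?case
    by (intro exI[of _ "max N N'"]) (auto simp: lin_add[OF lin_base_change_op])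
next
  case (scale c v)
  then obtain N where "\<forall>i\<ge>N. r_red \<alpha> i v = 0" by blast
  then show ?case by (intro exI[of _ N]) (simp add: lin_smul[OF lin_base_change_op])
next
  case (basis b)
  obtain N where "\<forall>m\<ge>N. r_op \<alpha> m (int_basis b) = 0" using r_op_locally_nilpotent by blast
  then show ?case by (intro exI[of _ N]) (simp add: base_change_op_single)
qed (auto simp: lin_0[OF lin_base_change_op])

context lattice_vertex_algebra_structure
begin

lemma iota_e_mode_component:
  fixes v :: "('n, 'f::field) fock"
  assumes "v \<in> component \<beta>"
  shows "\<exists>N0. \<forall>N\<ge>N0. base_change_Y Y (iota_e \<alpha>) m v =
    (\<Sum>j<N. let i = int j - lat_form \<alpha> \<beta> - m - 1 in
       if i \<ge> 0 then s_red \<alpha> (nat i) (r_red \<alpha> j (e_red \<epsilon> \<alpha> v)) else 0)"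
proof -
  define t where "t = (\<lambda>j (v :: ('n, 'f) fock). let i = int j - lat_form \<alpha> \<beta> - m - 1 in
       if i \<ge> 0 then s_red \<alpha> (nat i) (r_red \<alpha> j (e_red \<epsilon> \<alpha> v)) else 0)"
  have lin_t: "lin (t j)" for j
    unfolding t_def Let_def
    by (cases "int j - lat_form \<alpha> \<beta> - m - 1 \<ge> 0")
       (simp_all add: lin_zero lin_compose[OF lin_base_change_op] lin_base_change_op)
  let ?Y = "base_change_Y Y (iota_e \<alpha>) m :: ('n, 'f) fock \<Rightarrow> _"
  have "\<exists>N0. \<forall>N\<ge>N0. ?Y v = (\<Sum>j<N. t j v)"
    using assms
  proof (induction rule: supported_induct)
    case (add u v)
    then obtain N N' where "\<forall>K\<ge>N. ?Y u = (\<Sum>j<K. t j u)" "\<forall>K\<ge>N'. ?Y v = (\<Sum>j<K. t j v)" by blast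
    then show ?case
      by (intro exI[of _ "max N N'"])
         (auto simp: lin_add[OF lin_t] lin_add[OF lin_base_change_Y_right] sum.distrib)
  next
    case (scale c v)
    then obtain N where "\<forall>K\<ge>N. ?Y v = (\<Sum>j<K. t j v)" by blast
    then show ?case
      by (intro exI[of _ N])
         (simp add: lin_smul[OF lin_t] lin_smul[OF lin_base_change_Y_right] smul.scale_sum_right)
  next
    case (basis b)
    then obtain M where b: "b = (M, \<beta>)" by (cases b) auto
    obtain N0 where N0: "\<forall>N\<ge>N0. lattice_vertex_op \<epsilon> \<alpha> m (int_basis b) =
      (\<Sum>j<N. let i = int j - lat_form \<alpha> \<beta> - m - 1 in
       if i \<ge> 0 then s_op \<alpha> (nat i) (r_op \<alpha> j (e_op \<epsilon> \<alpha> (int_basis b))) else 0)"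
      using lattice_vertex_op_component[OF int_basis_component[of M \<beta>]] unfolding b by blast
    have "?Y (Poly_Mapping.single b 1) = (\<Sum>j<N. t j (Poly_Mapping.single b 1))" if "N \<ge> N0" for N
    proof -
      have "?Y (Poly_Mapping.single b 1) = base_change (lattice_vertex_op \<epsilon> \<alpha> m (int_basis b))"
        using base_change_Y_base_change[OF iota_e_integral_form[of \<alpha>] int_basis_integral_form[of b], of m]
        by (simp add: Y_iota_e)
      also have "\<dots> = (\<Sum>j<N. base_change (let i = int j - lat_form \<alpha> \<beta> - m - 1 in
          if i \<ge> 0 then s_op \<alpha> (nat i) (r_op \<alpha> j (e_op \<epsilon> \<alpha> (int_basis b))) else 0))"
        unfolding N0[rule_format, OF that]
        by (rule base_change_sum)
           (auto simp: Let_def add_subgroup_0 add_subgroup_int_span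
             intro: s_op_integral_form r_op_integral_form e_op_integral_form int_basis_integral_form)
      also have "\<dots> = (\<Sum>j<N. t j (base_change (int_basis b)))"
        by (rule sum.cong)
           (simp_all only: t_def Let_def s_red_base_change r_red_base_change e_red_base_change
             s_op_integral_form r_op_integral_form e_op_integral_form int_basis_integral_form
             base_change_0 if_distrib[of base_change])
      finally show ?thesis by simp
    qed
    then show ?case by blast
  qed (simp add: lin_0[OF lin_t] lin_0[OF lin_base_change_Y_right])
  then show ?thesis unfolding t_def .
qed

text \<open>
  Every $D^{(k)} w$ with $k > 0$ is a combination of monomials with a Heisenberg factor.  For
  $w = \iota(e_\beta)$ it is $s_{\beta,k} \iota(e_\beta)$, and by \<open>translation_mode\<close>
  $D^{(k)} h(-m) w'$ is a combination of vectors $h(-m-i) D^{(k-i)} w'$.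
\<close>

lemma translation_vac_coefficient:
  assumes "k > 0"
  shows "Poly_Mapping.lookup (Y w (- int k - 1) (iota_e 0)) ({#}, 0) = 0"
proof (induction w rule: fock_induct)
  case (basis b)
  have long: "Poly_Mapping.lookup v ({#}, 0) = 0" if "v \<in> long_monomials (Suc 0)" for v :: "('n, complex) fock"
    using lookup_supported[OF that] by simp
  have any: "v \<in> long_monomials 0" for v :: "('n, complex) fock"
    by (simp add: supported_def)
  obtain M \<beta> where b: "b = (M, \<beta>)" by force
  show ?case
  proof (cases M)
    case empty
    have "iota_e 0 \<in> component 0" by (simp add: iota_e_def single_supported)
    from lattice_vertex_op_component[OF this, of \<epsilon> \<beta> "- int k - 1"]
    obtain N where N: "Y (iota_e \<beta>) (- int k - 1) (iota_e 0) =
      (\<Sum>j<N. let i = int j - lat_form \<beta> 0 - (- int k - 1) - 1 in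
       if i \<ge> 0 then s_op \<beta> (nat i) (r_op \<beta> j (e_op \<epsilon> \<beta> (iota_e 0))) else 0)"
      unfolding Y_iota_e by blast
    have "(let i = int j - lat_form \<beta> 0 - (- int k - 1) - 1 in
       if i \<ge> 0 then s_op \<beta> (nat i) (r_op \<beta> j (e_op \<epsilon> \<beta> (iota_e 0))) else 0) \<in> long_monomials (Suc 0)" for j
    proof (cases "j = 0")
      case True
      have "lat_form \<beta> 0 = 0" by (simp add: lat_form_def)
      then show ?thesis using True assms s_op_long[OF any] by simp
    next
      case False
      then show ?thesis
        by (simp add: e_op_iota_e lin_smul[OF lin_r_op] r_op_iota_e lin_0[OF lin_s_op] Let_def
            smul.subspace_0 subspace_supported)
    qed
    then have "Y (iota_e \<beta>) (- int k - 1) (iota_e 0) \<in> long_monomials (Suc 0)"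
      unfolding N by (intro smul.subspace_sum subspace_supported)
    then show ?thesis using long by (simp add: b empty iota_e_def)
  next
    case (add x N)
    obtain i l where x: "x = (i, l)" by force
    let ?h = "h_of_lat (simple_root i)"
    let ?u = "heis ?h (-1) (iota_e 0)" and ?v = "Poly_Mapping.single (N, \<beta>) 1"
    have create: "Y ?u (- int (Suc l) - int j) v \<in> long_monomials (Suc 0)" for j v
    proof -
      have "- int (Suc l) - int j = - int (Suc l + j)" by simp
      then have "heis ?h (- int (Suc l) - int j) = heis_create ?h (Suc l + j)"
        by (simp only: heis_neg add_Suc zero_less_Suc)
      then show ?thesis by (simp only: Y_heis heis_create_long[OF any])
    qed
    have "Poly_Mapping.single b 1 = Y ?u (- int (Suc l)) ?v"
      unfolding Y_heis using heis_neg[of "Suc l" ?h] by (simp add: heis_create_simple_root b add x)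
    then have "Y (Poly_Mapping.single b 1) (- int k - 1) (iota_e 0) \<in> long_monomials (Suc 0)"
      by (simp only: translation_mode smul.subspace_sum smul.subspace_scale subspace_supported create)
    then show ?thesis by (rule long)
  qed
qed (simp_all add: add_left scale_left lookup_add)

end

section \<open>The bilinear form\<close>

lemma lat_form_add_right: "lat_form \<alpha> (\<beta> + \<gamma>) = lat_form \<alpha> \<beta> + lat_form \<alpha> \<gamma>"
  by (simp add: lat_form_def lookup_add algebra_simps sum.distrib)

lemma lat_form_0_right: "lat_form \<alpha> 0 = 0"
  by (simp add: lat_form_def)

text \<open>
  Two ways to sum over the pairs $(i,j)$ with $i = j - c$.
\<close>

lemma sum_diagonal:
  fixes t :: "nat \<Rightarrow> nat \<Rightarrow> 'a::comm_monoid_add"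
  assumes "\<And>i j. i \<ge> N \<Longrightarrow> t i j = 0" "\<And>i j. j \<ge> N \<Longrightarrow> t i j = 0"
  shows "(\<Sum>j<N. if int j - c \<ge> 0 then t (nat (int j - c)) j else 0)
    = (\<Sum>i<N. if int i + c \<ge> 0 then t i (nat (int i + c)) else 0)"
proof -
  have "(\<Sum>i<N. if int i = int j - c then t i j else 0) =
      (if int j - c \<ge> 0 then t (nat (int j - c)) j else 0)" for j
  proof -
    have "(\<Sum>i<N. if int i = int j - c then t i j else 0)
        = (\<Sum>i<N. if i = nat (int j - c) then if int j - c \<ge> 0 then t i j else 0 else 0)"
      by (intro sum.cong) auto
    then show ?thesis using assms(1)[of "nat (int j - c)" j] by (auto simp: not_less)
  qed
  note 1 = this
  have 2: "(\<Sum>j<N. if int i = int j - c then t i j else 0) =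
      (if int i + c \<ge> 0 then t i (nat (int i + c)) else 0)" for i
  proof -
    have "(\<Sum>j<N. if int i = int j - c then t i j else 0)
        = (\<Sum>j<N. if j = nat (int i + c) then if int i + c \<ge> 0 then t i j else 0 else 0)"
      by (intro sum.cong) auto
    then show ?thesis using assms(2)[of "nat (int i + c)" i] by (auto simp: not_less)
  qed
  have "(\<Sum>j<N. if int j - c \<ge> 0 then t (nat (int j - c)) j else 0)
      = (\<Sum>j<N. \<Sum>i<N. if int i = int j - c then t i j else 0)"
    by (simp only: 1)
  also have "\<dots> = (\<Sum>i<N. \<Sum>j<N. if int i = int j - c then t i j else 0)"
    by (rule sum.swap)
  finally show ?thesis by (simp only: 2)
qed

locale lattice_form = lattice_vertex_algebra_structure \<epsilon> Y
  for \<epsilon> :: "('n::{finite,linorder}) lat \<Rightarrow> 'n lat \<Rightarrow> int"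
    and Y :: "('n, complex) fock \<Rightarrow> int \<Rightarrow> ('n, complex) fock \<Rightarrow> ('n, complex) fock" +
  fixes B :: "('n, 'f::field) fock \<Rightarrow> ('n, 'f) fock \<Rightarrow> 'f"
  assumes form: "lattice_bilinear_form B"
begin

lemma B_add_left: "B (u + u') v = B u v + B u' v"
  and B_smul_left: "B (smul c u) v = c * B u v"
  and B_sym: "B u v = B v u"
  and B_iota_e: "B (iota_e \<alpha>) (iota_e \<beta>) = (if \<alpha> = - \<beta> then 1 else 0)"
  and B_s_red: "B (s_red \<alpha> m u) v = B u (r_red \<alpha> m v)"
  using form unfolding lattice_bilinear_form_def by blast+

lemma B_add_right: "B u (v + v') = B u v + B u v'"
  and B_smul_right: "B u (smul c v) = c * B u v"
  and B_s_red_right: "B u (s_red \<alpha> m v) = B (r_red \<alpha> m u) v"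
  using B_add_left B_smul_left B_s_red B_sym by metis+

lemma B_0_left [simp]: "B 0 v = 0" and B_0_right [simp]: "B v 0 = 0"
  using B_smul_left[of 0 0 v] B_smul_right[of v 0 0] by simp_all

lemma B_sum_left: "B (sum f I) v = (\<Sum>i\<in>I. B (f i) v)"
  and B_sum_right: "B v (sum f I) = (\<Sum>i\<in>I. B v (f i))"
  by (induction I rule: infinite_finite_induct) (simp_all add: B_add_left B_add_right)

text \<open>
  The factors $s_{\alpha,m}$ of a basis element become $r_{\alpha,m}$ on $\iota(e_0)$, which is zero for
  $m > 0$.
\<close>

lemma B_iota_e_0: "B u (iota_e 0) = Poly_Mapping.lookup u ({#}, 0)"
proof (induction u rule: fock_induct)
  case (basis b)
  obtain M \<beta> where b: "b = (M, \<beta>)" by force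
  show ?case
  proof (cases M)
    case empty
    then show ?thesis using B_iota_e[of \<beta> 0] by (simp add: b iota_e_def lookup_single when_def)
  next
    case (add x N)
    obtain i k where x: "x = (i, k)" by force
    have "B (Poly_Mapping.single (add_mset (i, k) N, \<beta>) 1) (iota_e 0) = 0"
      unfolding s_red_single[symmetric] B_s_red by (simp add: r_red_iota_e)
    then show ?thesis by (simp add: b add x lookup_single)
  qed
qed (simp_all add: B_add_left B_smul_left lookup_add)

lemma B_orthogonal:
  assumes "u \<in> component \<beta>" "v \<in> component \<gamma>" "\<beta> + \<gamma> \<noteq> 0"
  shows "B u v = 0"
proof -
  have iota: "B (iota_e \<beta>) v = 0" if "v \<in> component \<gamma>" for v
    using that
  proof (induction rule: supported_induct)
    case (basis b)
    then obtain N where b: "b = (N, \<gamma>)" by (cases b) auto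
    show ?case
    proof (cases N)
      case empty
      then show ?thesis using B_iota_e[of \<beta> \<gamma>] assms(3) by (auto simp: b iota_e_def)
    next
      case (add x N')
      then show ?thesis
        by (cases x) (simp add: b B_s_red_right r_red_iota_e flip: s_red_single)
    qed
  qed (simp_all add: B_add_right B_smul_right)
  show ?thesis
    using assms(1)
  proof (induction rule: supported_induct)
    case (basis b)
    then obtain M where b: "b = (M, \<beta>)" by (cases b) auto
    have "B (Poly_Mapping.single (M, \<beta>) 1) v = 0" if "v \<in> component \<gamma>" for v
      using that
    proof (induction M arbitrary: v)
      case empty
      then show ?case using iota by (simp add: iota_e_def)
    next
      case (add x M)
      then show ?case
        by (cases x) (simp add: B_s_red r_red_component flip: s_red_single)
    qed
    then show ?case using assms(2) by (simp add: b)
  qed (simp_all add: B_add_left B_smul_left)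
qed

text \<open>
  Because $e_\alpha$ commutes with all $s_{\beta,m}$ and $r_{\beta,m}$, it suffices to compare
  $(\iota(e_\beta), e_\alpha \iota(e_\gamma))$ with $(e_\alpha \iota(e_\beta), \iota(e_\gamma))$.  Both vanish
  unless $\alpha + \beta + \gamma = 0$, and then the signs are $\epsilon(\alpha,\gamma)$ and
  $\epsilon(\alpha,\beta) = \epsilon(\alpha,\alpha) \epsilon(\alpha,\gamma)$.
\<close>

lemma B_e_red: "B u (e_red \<epsilon> \<alpha> v) = of_int (\<epsilon> \<alpha> \<alpha>) * B (e_red \<epsilon> \<alpha> u) v"
proof -
  have iota: "B (iota_e \<beta>) (e_red \<epsilon> \<alpha> v) = of_int (\<epsilon> \<alpha> \<alpha>) * B (e_red \<epsilon> \<alpha> (iota_e \<beta>)) v" for \<beta> v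
  proof (induction v rule: fock_induct)
    case (basis b)
    obtain N \<gamma> where b: "b = (N, \<gamma>)" by force
    have e_iota: "e_red \<epsilon> \<alpha> (iota_e \<beta>) = smul (of_int (\<epsilon> \<alpha> \<beta>)) (iota_e (\<alpha> + \<beta>))"
      for \<beta> unfolding iota_e_def by (rule e_red_single)
    show ?case
    proof (cases N)
      case empty
      have eps: "\<epsilon> \<alpha> \<gamma> = \<epsilon> \<alpha> \<alpha> * \<epsilon> \<alpha> \<beta>" if "\<beta> = - (\<alpha> + \<gamma>)"
      proof -
        have pm: "\<epsilon> \<alpha> \<delta> = 1 \<or> \<epsilon> \<alpha> \<delta> = -1" for \<delta>
          using cocycle unfolding lat_cocycle_def by blast
        have "\<epsilon> \<alpha> (0 + 0) = \<epsilon> \<alpha> 0 * \<epsilon> \<alpha> 0"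
          using cocycle unfolding lat_cocycle_def by blast
        with pm[of 0] have "\<epsilon> \<alpha> 0 = 1" by (elim disjE) simp_all
        moreover have "\<epsilon> \<alpha> (\<gamma> + (\<alpha> + \<beta>)) = \<epsilon> \<alpha> \<gamma> * (\<epsilon> \<alpha> \<alpha> * \<epsilon> \<alpha> \<beta>)"
          using cocycle unfolding lat_cocycle_def by metis
        moreover have "\<gamma> + (\<alpha> + \<beta>) = 0" using that by simp
        ultimately show ?thesis using pm[of \<gamma>] pm[of \<alpha>] pm[of \<beta>] by auto
      qed
      have iff: "\<alpha> + \<beta> = - \<gamma> \<longleftrightarrow> \<beta> = - (\<alpha> + \<gamma>)"
        by (simp only: eq_neg_iff_add_eq_0 add_ac)
      have single: "(Poly_Mapping.single b 1 :: ('n, 'f) fock) = iota_e \<gamma>"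
        by (simp add: b empty iota_e_def)
      show ?thesis
        unfolding single e_iota B_smul_left B_smul_right B_iota_e iff
        by (cases "\<beta> = - (\<alpha> + \<gamma>)") (simp_all only: eps simp_thms if_True if_False of_int_mult mult.assoc mult_1_right mult_zero_right)
    next
      case (add x N')
      obtain i k where x: "x = (i, k)" by force
      show ?thesis
        unfolding b add x s_red_single[symmetric] e_red_s_red B_s_red_right e_iota
        by (simp add: r_red_iota_e lin_smul[OF lin_base_change_op])
    qed
  qed (simp_all add: lin_0[OF lin_base_change_op] lin_add[OF lin_base_change_op]
      lin_smul[OF lin_base_change_op] B_add_right B_smul_right algebra_simps)
  show ?thesis
  proof (induction u arbitrary: v rule: fock_induct)
    case (basis b)
    obtain M \<beta> where b: "b = (M, \<beta>)" by force
    have "B (Poly_Mapping.single (M, \<beta>) 1) (e_red \<epsilon> \<alpha> v) =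
        of_int (\<epsilon> \<alpha> \<alpha>) * B (e_red \<epsilon> \<alpha> (Poly_Mapping.single (M, \<beta>) 1)) v"
    proof (induction M arbitrary: v)
      case empty
      then show ?case using iota[of \<beta> v] by (simp add: iota_e_def)
    next
      case (add x M)
      obtain i k where x: "x = (i, k)" by force
      show ?case
        unfolding x s_red_single[symmetric] B_s_red e_red_s_red e_red_r_red[symmetric] by (rule add)
    qed
    then show ?case by (simp add: b)
  qed (simp_all add: lin_0[OF lin_base_change_op] lin_add[OF lin_base_change_op]
      lin_smul[OF lin_base_change_op] B_add_left B_smul_left algebra_simps)
qed

text \<open>
  Taking adjoints in $s_{\alpha,i} r_{\alpha,j} e_\alpha$ exchanges $i$ and $j$.  For arguments in the
  components of $\beta$ and $\gamma$ only pairs with a fixed $i - j$ occur, a number that involves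
  $\langle\alpha,\gamma\rangle$ on the left and $\langle\alpha,\beta\rangle$ on the right.  The form
  vanishes unless $\alpha + \beta + \gamma = 0$, and then
  $\langle\alpha,\beta\rangle = - \langle\alpha,\alpha\rangle - \langle\alpha,\gamma\rangle$, so that the
  adjoint is the same mode for all components.
\<close>

lemma B_iota_e_mode:
  "B u (base_change_Y Y (iota_e \<alpha>) q v) =
     of_int (\<epsilon> \<alpha> \<alpha>) * B (base_change_Y Y (iota_e \<alpha>) (lat_form \<alpha> \<alpha> - 2 - q) u) v"
proof (induction u rule: fock_induct)
  case (basis b)
  obtain M \<beta> where b: "b = (M, \<beta>)" by force
  define u where "u = (Poly_Mapping.single b 1 :: ('n, 'f) fock)"
  have u: "u \<in> component \<beta>" by (simp add: u_def b single_supported)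
  show ?case
    unfolding u_def[symmetric]
  proof (induction v rule: fock_induct)
    case (basis b')
    obtain M' \<gamma> where b': "b' = (M', \<gamma>)" by force
    define v where "v = (Poly_Mapping.single b' 1 :: ('n, 'f) fock)"
    have v: "v \<in> component \<gamma>" by (simp add: v_def b' single_supported)
    define q' where "q' = lat_form \<alpha> \<alpha> - 2 - q"
    define c where "c = lat_form \<alpha> \<gamma> + q + 1"
    define t where "t = (\<lambda>i j. B (r_red \<alpha> i u) (r_red \<alpha> j (e_red \<epsilon> \<alpha> v)))"
    have t': "of_int (\<epsilon> \<alpha> \<alpha>) * B (r_red \<alpha> i (e_red \<epsilon> \<alpha> u)) (r_red \<alpha> j v) = t i j" for i j
      unfolding t_def e_red_r_red[symmetric] B_e_red ..
    obtain N1 where N1: "\<And>N. N \<ge> N1 \<Longrightarrow> base_change_Y Y (iota_e \<alpha>) q v =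
      (\<Sum>j<N. let i = int j - lat_form \<alpha> \<gamma> - q - 1 in
       if i \<ge> 0 then s_red \<alpha> (nat i) (r_red \<alpha> j (e_red \<epsilon> \<alpha> v)) else 0)"
      using iota_e_mode_component[OF v] by blast
    obtain N2 where N2: "\<And>N. N \<ge> N2 \<Longrightarrow> base_change_Y Y (iota_e \<alpha>) q' u =
      (\<Sum>i<N. let j = int i - lat_form \<alpha> \<beta> - q' - 1 in
       if j \<ge> 0 then s_red \<alpha> (nat j) (r_red \<alpha> i (e_red \<epsilon> \<alpha> u)) else 0)"
      using iota_e_mode_component[OF u] by blast
    obtain N3 where N3: "\<And>i. i \<ge> N3 \<Longrightarrow> r_red \<alpha> i u = 0" using r_red_locally_nilpotent by blast
    obtain N4 where N4: "\<And>j. j \<ge> N4 \<Longrightarrow> r_red \<alpha> j (e_red \<epsilon> \<alpha> v) = 0" using r_red_locally_nilpotent by blast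
    define N where "N = N1 + N2 + N3 + N4"
    have t0: "i \<ge> N \<Longrightarrow> t i j = 0" "j \<ge> N \<Longrightarrow> t i j = 0" for i j
      by (simp_all add: t_def N_def N3 N4)
    have "B u (base_change_Y Y (iota_e \<alpha>) q v)
        = (\<Sum>j<N. if int j - c \<ge> 0 then t (nat (int j - c)) j else 0)"
    proof -
      have "B u (let i = int j - lat_form \<alpha> \<gamma> - q - 1 in
          if i \<ge> 0 then s_red \<alpha> (nat i) (r_red \<alpha> j (e_red \<epsilon> \<alpha> v)) else 0)
          = (if int j - c \<ge> 0 then t (nat (int j - c)) j else 0)" for j
        by (simp add: c_def t_def B_s_red_right Let_def algebra_simps)
      moreover have "N \<ge> N1" by (simp add: N_def)
      ultimately show ?thesis by (simp only: N1 B_sum_right)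
    qed
    moreover have "of_int (\<epsilon> \<alpha> \<alpha>) * B (base_change_Y Y (iota_e \<alpha>) q' u) v
        = (\<Sum>i<N. if int i - lat_form \<alpha> \<beta> - q' - 1 \<ge> 0
            then t i (nat (int i - lat_form \<alpha> \<beta> - q' - 1)) else 0)"
    proof -
      have "of_int (\<epsilon> \<alpha> \<alpha>) * B (let j = int i - lat_form \<alpha> \<beta> - q' - 1 in
          if j \<ge> 0 then s_red \<alpha> (nat j) (r_red \<alpha> i (e_red \<epsilon> \<alpha> u)) else 0) v
          = (if int i - lat_form \<alpha> \<beta> - q' - 1 \<ge> 0
            then t i (nat (int i - lat_form \<alpha> \<beta> - q' - 1)) else 0)" for i
        by (simp add: t'[symmetric] B_s_red Let_def)
      moreover have "N \<ge> N2" by (simp add: N_def)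
      ultimately show ?thesis by (simp only: N2 B_sum_left sum_distrib_left)
    qed
    moreover have "(\<Sum>j<N. if int j - c \<ge> 0 then t (nat (int j - c)) j else 0)
        = (\<Sum>i<N. if int i - lat_form \<alpha> \<beta> - q' - 1 \<ge> 0
            then t i (nat (int i - lat_form \<alpha> \<beta> - q' - 1)) else 0)"
    proof (cases "\<beta> + (\<alpha> + \<gamma>) = 0")
      case True
      have "lat_form \<alpha> \<beta> + (lat_form \<alpha> \<alpha> + lat_form \<alpha> \<gamma>) = 0"
        using arg_cong[OF True, of "lat_form \<alpha>"] by (simp only: lat_form_add_right lat_form_0_right)
      then have "int i - lat_form \<alpha> \<beta> - q' - 1 = int i + c" for i
        by (simp add: q'_def c_def)
      then show ?thesis using sum_diagonal[of N t c, OF t0] by (simp only:)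
    next
      case False
      have "t i j = 0" for i j
        unfolding t_def
        by (rule B_orthogonal[OF r_red_component[OF u] r_red_component[OF e_red_component[OF v]] False])
      then show ?thesis by (simp only: if_cancel)
    qed
    ultimately show ?case by (simp add: v_def q'_def)
  qed (simp_all add: lin_0[OF lin_base_change_Y_right] lin_add[OF lin_base_change_Y_right]
      lin_smul[OF lin_base_change_Y_right] B_add_right B_smul_right algebra_simps)
qed (simp_all add: lin_0[OF lin_base_change_Y_right] lin_add[OF lin_base_change_Y_right]
      lin_smul[OF lin_base_change_Y_right] B_add_left B_smul_left algebra_simps)

theorem form_radical_ideal: "va_ideal smul (iota_e 0) (base_change_Y Y) (form_radical B)"
proof (rule vertex_algebra.form_radical_is_ideal[OF vertex_algebra_base_change, where g = iota_e and B = B])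
  show "\<exists>c q'. \<forall>u v. B u (base_change_Y Y (iota_e \<alpha>) q v) = c * B (base_change_Y Y (iota_e \<alpha>) q' u) v" for \<alpha> q
    using B_iota_e_mode by blast
  show "B (base_change_Y Y w (- int k - 1) (iota_e 0)) (iota_e 0) = 0" if "k \<ge> 1" for w k
  proof (induction w rule: fock_induct)
    case (basis b)
    have "Poly_Mapping.lookup (base_change (Y (int_basis b) (- int k - 1) (iota_e 0)) :: ('n, 'f) fock) ({#}, 0) = 0"
      using that by (intro lookup_base_change_vac translation_vac_coefficient Y_integral_form) auto
    then show ?case
      using base_change_Y_base_change[of "int_basis b" "iota_e 0" "- int k - 1", where ?'f = 'f]
      by (simp add: B_iota_e_0)
  qed (simp_all add: lin_0[OF lin_base_change_Y_left] lin_add[OF lin_base_change_Y_left]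
      lin_smul[OF lin_base_change_Y_left] B_add_left B_smul_left)
  show "T = UNIV" if "smul.subspace T" "iota_e 0 \<in> T"
    "\<And>\<alpha> q v. v \<in> T \<Longrightarrow> base_change_Y Y (iota_e \<alpha>) q v \<in> T" for T
    using that by (rule base_change_generated)
  show "B (u + u') v = B u v + B u' v" for u u' v by (rule B_add_left)
  show "B (smul c u) v = c * B u v" for c u v by (rule B_smul_left)
  show "B u v = B v u" for u v by (rule B_sym)
qed

end

section \<open>A vector in the radical\<close>

lemma bij_betw_pos: "bij_betw pos (UNIV :: 'n::{finite,linorder} set) {1..CARD('n)}"
proof -
  have "pos i < pos j" if "i < j" for i j :: 'n
  proof -
    have "{k. k \<le> i} \<subseteq> {k. k \<le> j}" "j \<in> {k. k \<le> j}" "j \<notin> {k. k \<le> i}"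
      using that by auto
    then have "{k. k \<le> i} \<subset> {k. k \<le> j}" by blast
    then show ?thesis unfolding pos_def by (intro psubset_card_mono) auto
  qed
  then have inj: "inj (pos :: 'n \<Rightarrow> nat)"
    by (metis injI less_irrefl linorder_neqE)
  have "pos i \<ge> 1" "pos i \<le> CARD('n)" for i :: 'n
    unfolding pos_def by (auto simp: Suc_le_eq card_gt_0_iff intro!: card_mono)
  then have "range (pos :: 'n \<Rightarrow> nat) \<subseteq> {1..CARD('n)}" by auto
  moreover have "card (range (pos :: 'n \<Rightarrow> nat)) = card {1..CARD('n)}"
    using inj by (simp add: card_image)
  ultimately show ?thesis
    using inj by (simp add: bij_betw_def card_subset_eq)
qed

text \<open>
  The vector $(1,2,\dots,n)$ is in the kernel of the Cartan matrix modulo $n+1$, the determinant of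
  that matrix: the entries are in arithmetic progression and the matrix takes negated second
  differences, so that only the last row contributes.
\<close>

lemma cartan_pos_sum:
  fixes j :: "'n::{finite,linorder}"
  shows "(\<Sum>i\<in>UNIV. int (pos i) * cartan j i) = (if pos j = CARD('n) then int (CARD('n) + 1) else 0)"
proof -
  let ?a = "pos j" and ?n = "CARD('n)"
  have inj: "pos i = pos j \<longleftrightarrow> i = j" for i
    using bij_betw_pos[where 'n = 'n] by (auto simp: bij_betw_def inj_on_def)
  have a: "1 \<le> ?a" "?a \<le> ?n"
    using bij_betwE[OF bij_betw_pos[where 'n = 'n]] by auto
  have "(\<Sum>i\<in>UNIV. int (pos i) * cartan j i)
      = (\<Sum>i\<in>(UNIV :: 'n set). (\<lambda>x. int x * (if x = ?a then 2 else if x = ?a + 1 \<or> ?a = x + 1 then -1 else 0)) (pos i))"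
    by (rule sum.cong) (auto simp: cartan_def inj)
  also have "\<dots> = (\<Sum>x = 1..?n. int x * (if x = ?a then 2 else if x = ?a + 1 \<or> ?a = x + 1 then -1 else 0))"
    by (rule sum.reindex_bij_betw[OF bij_betw_pos])
  also have "\<dots> = (\<Sum>x = 1..?n. (if x = ?a then 2 * int ?a else 0) - (if x = ?a + 1 then int ?a + 1 else 0)
      - (if x = ?a - 1 then int ?a - 1 else 0))"
    using a by (intro sum.cong) auto
  also have "\<dots> = (if ?a = ?n then int (?n + 1) else 0)"
  proof -
    have "?n = Suc 0" if "\<not> Suc 0 \<le> ?n - Suc 0" using a that by linarith
    then show ?thesis using a by (auto simp: sum_subtractf)
  qed
  finally show ?thesis .
qed

lemma lat_form_simple_root: "lat_form (simple_root i) (simple_root j) = cartan i j"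
proof -
  have "lat_form (simple_root i) (simple_root j) =
      (\<Sum>k\<in>UNIV. \<Sum>l\<in>UNIV. if k = i then if l = j then cartan i j else 0 else 0)"
    unfolding lat_form_def
    by (intro sum.cong refl) (simp add: simple_root_def lookup_single when_def)
  also have "\<dots> = (\<Sum>k\<in>UNIV. if k = i then cartan i j else 0)"
    by (intro sum.cong refl) simp
  finally show ?thesis by simp
qed

text \<open>
  Of the sum in \<open>r_op_s_op\<close> only the term $l = k + 1$ survives: for $l \le k$ an
  $r_{\alpha_j,m}$ with $m > 0$ is applied to $\iota(e_\gamma)$.
\<close>

lemma r_red_s_red_iota_e:
  "r_red (simple_root j) (Suc k) (s_red (simple_root i) 1 (iota_e \<gamma> :: ('n::{finite,linorder}, 'f::field) fock)) =
     (if k = 0 then smul (- of_int (cartan j i)) (iota_e \<gamma>) else 0)"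
proof -
  have b1: "int_binomial n (Suc 0) = n" for n by (simp add: int_binomial_def)
  have "r_op (simple_root j) (Suc k) (s_op (simple_root i) 1 (iota_e \<gamma>)) =
     (\<Sum>l\<in>{Suc k}. if l \<le> 1 then smul (of_int ((-1) ^ l * int_binomial (cartan j i) l))
        (s_op (simple_root i) (1 - l) (r_op (simple_root j) (Suc k - l) (iota_e \<gamma>))) else 0)"
    unfolding r_op_s_op lat_form_simple_root
    by (rule sum.mono_neutral_right) (auto simp: r_op_iota_e lin_0[OF lin_s_op])
  also have "\<dots> = (if k = 0 then smul (of_int (- cartan j i)) (iota_e \<gamma>) else 0)"
    by (simp add: b1)
  finally have "r_op (simple_root j) (Suc k) (s_op (simple_root i) 1 (iota_e \<gamma>)) =
      (if k = 0 then smul (of_int (- cartan j i)) (iota_e \<gamma>) else 0)" .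
  then have "base_change (r_op (simple_root j) (Suc k) (s_op (simple_root i) 1 (iota_e \<gamma>))) =
      (if k = 0 then smul (of_int (- cartan j i)) (iota_e \<gamma>) else 0 :: ('n, 'f) fock)"
    by (simp only: base_change_smul iota_e_integral_form base_change_0 base_change_iota_e if_distrib[of base_change])
  moreover have "r_red (simple_root j) (Suc k) (s_red (simple_root i) 1 (base_change (iota_e \<gamma>) :: ('n, 'f) fock))
      = base_change (r_op (simple_root j) (Suc k) (s_op (simple_root i) 1 (iota_e \<gamma>)))"
    by (simp only: s_red_base_change r_red_base_change s_op_integral_form iota_e_integral_form)
  ultimately show ?thesis
    by (simp only: base_change_iota_e of_int_minus)
qed

text \<open>
  With $h = \sum_i i\,\alpha_i$ the vector is $h(-1) \mathbf 1$, where $h$ is orthogonal to all roots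
  modulo $n+1$.  Hence it is killed by all $r_{\alpha_j,m}$ with $m > 0$, and it is orthogonal to every
  $s_{\alpha_j,m} u$.
\<close>

lemma (in lattice_form) cartan_kernel_vector_in_radical:
  assumes "of_nat (CARD('n) + 1) = (0 :: 'f)"
  shows "(\<Sum>i\<in>UNIV. smul (of_nat (pos i)) (s_red (simple_root i) 1 (iota_e 0))) \<in> form_radical B"
    (is "?v \<in> _")
proof -
  have "B ?v u = 0" for u
  proof (induction u rule: fock_induct)
    case (basis b)
    obtain N \<beta> where b: "b = (N, \<beta>)" by force
    show ?case
    proof (cases N)
      case empty
      then have "Poly_Mapping.single b 1 = (iota_e \<beta> :: ('n, 'f) fock)" by (simp add: b iota_e_def)
      then show ?thesis by (simp add: B_sum_left B_smul_left B_s_red r_red_iota_e)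
    next
      case (add x N')
      obtain j k where x: "x = (j, k)" by force
      have "of_int (\<Sum>i\<in>UNIV. int (pos i) * cartan j i) = (0 :: 'f)"
        unfolding cartan_pos_sum using assms by (simp del: of_nat_add)
      then have "(\<Sum>i\<in>UNIV. of_nat (pos i) * - of_int (cartan j i)) = (0 :: 'f)"
        by (simp add: sum_negf)
      then have *: "(\<Sum>i\<in>UNIV. smul (of_nat (pos i) * - of_int (cartan j i)) (iota_e 0)) = (0 :: ('n, 'f) fock)"
        by (simp only: smul.scale_zero_left flip: smul.scale_sum_left)
      have "r_red (simple_root j) (Suc k) ?v = (\<Sum>i\<in>UNIV. smul (of_nat (pos i))
          (if k = 0 then smul (- of_int (cartan j i)) (iota_e 0) else 0))"
        by (simp only: lin_sum[OF lin_base_change_op] lin_smul[OF lin_base_change_op] r_red_s_red_iota_e)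
      also have "\<dots> = 0"
        using * by (cases "k = 0")
          (simp_all only: if_True if_False smul.scale_scale smul.scale_zero_right sum.neutral_const simp_thms)
      finally have v0: "r_red (simple_root j) (Suc k) ?v = 0" .
      have "B ?v (Poly_Mapping.single b 1) = B (r_red (simple_root j) (Suc k) ?v) (Poly_Mapping.single (N', \<beta>) 1)"
        by (simp only: b add x B_s_red_right flip: s_red_single)
      then show ?thesis unfolding v0 by simp
    qed
  qed (simp_all add: B_add_right B_smul_right)
  then show ?thesis by (simp add: form_radical_def)
qed

theorem lemma4p3:
  fixes p :: nat
    and \<epsilon> :: "('n::{finite,linorder}) lat \<Rightarrow> 'n lat \<Rightarrow> int"
    and Y :: "('n, complex) fock \<Rightarrow> int \<Rightarrow> ('n, complex) fock \<Rightarrow> ('n, complex) fock"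
    and B :: "('n, 'f::alg_closed_field) fock \<Rightarrow> ('n, 'f) fock \<Rightarrow> 'f"
  assumes "prime p" and "p > 2" and "CHAR('f) = p"
    and "[CARD('n) + 1 = 0] (mod p)"
    and "lat_cocycle \<epsilon>"
    and "lattice_vertex_algebra \<epsilon> Y"
    and "lattice_bilinear_form B"
  shows "va_ideal smul (iota_e 0) (base_change_Y Y) (form_radical B) \<and>
         form_radical B \<noteq> {0} \<and> form_radical B \<noteq> UNIV"
proof -
  interpret lattice_form \<epsilon> Y B
    using assms by unfold_locales
  let ?v = "\<Sum>i\<in>UNIV. smul (of_nat (pos i)) (s_red (simple_root i) 1 (iota_e 0)) :: ('n, 'f) fock"
  have "p dvd CARD('n) + 1" using assms by (simp add: cong_0_iff)
  then have "of_nat (CARD('n) + 1) = (0 :: 'f)"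
    using assms(3) by (simp only: of_nat_eq_0_iff_char_dvd)
  then have v: "?v \<in> form_radical B" by (rule cartan_kernel_vector_in_radical)
  have "1 \<in> {1..CARD('n)}" by (simp add: Suc_le_eq)
  then obtain i0 :: 'n where i0: "pos i0 = 1"
    using bij_betw_pos[where 'n = 'n] unfolding bij_betw_def by (metis imageE)
  have "?v = (\<Sum>i\<in>UNIV. Poly_Mapping.single ({#(i, 0)#}, 0) (of_nat (pos i)))"
    by (simp add: iota_e_def s_red_single)
  then have "Poly_Mapping.lookup ?v ({#(i0, 0)#}, 0) = (\<Sum>i\<in>UNIV. if i = i0 then of_nat (pos i) else 0)"
    by (simp only: lookup_sum lookup_single when_def) (auto intro!: sum.cong)
  then have "?v \<noteq> 0" using i0 by auto
  moreover have "iota_e 0 \<notin> form_radical B"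
    using B_iota_e[of 0 0] by (auto simp: form_radical_def intro!: exI[of _ "iota_e 0"])
  ultimately show ?thesis
    using form_radical_ideal v by blast
qed

end
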